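(* Let $X$ be an $\alpha$-determinantal process on $\mathbb{R}^d$ with positive semi-definite Hermitian kernel $K$ and background measure $\mu$. Assume $d\mu(x)=f(x)\,dx$ with $c^{-1}\le f(x)\le c$ for all $x\in\mathbb{R}^d$ and some constant $c>0$, and $K(x,x)\le b$ for all $x\in\mathbb{R}^d$ and some $b>0$. Let $\varphi:\mathbb{R}^d\to\mathbb{R}$ be a bounded compactly supported (measurable) function with $\|\varphi\|_2>0$, let $\varphi_L(\cdot)=\varphi(\cdot/L)$ and $\Lambda(\varphi_L)=\sum_{x\in X}\varphi_L(x)$. Assume one of the following conditions: (i) For every $\delta>0$ there exist $m_\delta>0$ and $r=r(\delta)>0$ such that $\mathrm{Vol}(\{y\in C(x,r):K(y,y)\ge m_\delta\})\ge(1-\delta)\mathrm{Vol}(C(x,r))$ for all $x\in\mathbb{R}^d$; and if $\alpha<0$, moreover $\|K\|_{\mathrm{op}}<|\alpha|^{-1}$. (ii.a) $\alpha<0$, $d>4$, and there are $a,\delta>0$ such that $|K(x,y)|\ge a$ whenever $\|x-y\|<\delta$. (ii.b) $\alpha<0$, and there exist $\beta\in(\frac d2,d)$, constants $r,c_1,c_2>0$ and $n_0\in\mathbb{N}_+$ such that for every $x\in\mathbb{R}^d$ the set $E_x=\{y:|K(x,y)|\ge c_1\|x-y\|^{-\beta}\}$ satisfies $\mathrm{Vol}(E_x\cap A^x_n(r))\ge c_2\mathrm{Vol}(A_n^x(r))$ for all $n\ge n_0$. (ii.c) $\alpha<0$, $d>2$, $\varphi\in C^2$, $$\sup_{x\in\mathbb{R}^d}\int_{\mathbb{R}^d}\|x-y\|^3|K(x,y)|^2dy<\infty\quad\text{and}\quad\inf_{x\in\mathbb{R}^d}\inf_{u\in\mathbb{S}^{d-1}}\int_{\mathbb{R}^d}|\langle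 y-x,u\rangle|^2|K(x,y)|^2dy>0.$$ Then there are constants $c_0>0$ and $L_0>0$ such that $\mathrm{Var}[\Lambda(\varphi_L)]\ge c_0L^\eta$ for all $L\ge L_0$, where $\eta=d$ in case (i), $\eta=d-4$ in case (ii.a), $\eta=2(d-\beta)$ in case (ii.b), and $\eta=d-2$ in case (ii.c).
   Context: $C(x,r)$ is the cube with centre $x$ and side length $r$; $A_n^x(r)=\{y\in\mathbb{R}^d: nr\le\|x-y\|\le(n+1)r\}$; $\mathrm{Vol}$ is Lebesgue measure; $\mathbb{S}^{d-1}$ is the unit sphere of $\mathbb{R}^d$. For an $n\times n$ complex matrix $A$, $\mathrm{Det}_\alpha[A]=\sum_{\sigma\in S_n}\alpha^{n-\nu(\sigma)}\prod_{i=1}^nA_{i\sigma(i)}$, where $\nu(\sigma)$ is the number of cycles of $\sigma$. The $\alpha$-determinantal process with kernel $K:\mathbb{R}^d\times\mathbb{R}^d\to\mathbb{C}$ and background measure $\mu$ is the random locally finite point set $X\subset\mathbb{R}^d$ whose $n$-point correlation functions with respect to $\mu^{\otimes n}$ are $\rho_n(x_1,\dots,x_n)=\mathrm{Det}_\alpha[(K(x_i,x_j))_{1\le i,j\le n}]$ for all $n\ge1$. The same letter $K$ denotes the integral operator $f\mapsto\int K(\cdot,y)f(y)\,d\mu(y)$ on $L^2(\mu)$, and $\|K\|_{\mathrm{op}}$ its operator norm. Standing assumptions (ensuring existence of the process): $K$ is a bounded, Hermitian, positive semi-definite, locally trace class operator on $L^2(\mu)$ (with the kernel normalized on the diagonal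 so that $\mathrm{Tr}[\mathbf 1_BK\mathbf 1_B]=\int_BK(x,x)\,d\mu(x)$ for compact $B$); $\alpha\in\{2/m:m\in\mathbb{N}_+\}\cup\{-1/m:m\in\mathbb{N}_+\}$; and if $\alpha<0$ then $\mathrm{Spec}(K)\subset[0,-1/\alpha]$. *)

theory Defs
  imports "HOL-Probability.Probability" "HOL-Combinatorics.Orbits"
begin

section \<open>Operators on complex $L^2$ spaces\<close>

text \<open>Elements of $L^2(\mu)$ are represented by square integrable functions; equality in
  $L^2(\mu)$ is equality almost everywhere. The inner product is linear in its second argument.\<close>

definition L2_space :: "'a measure \<Rightarrow> ('a \<Rightarrow> complex) set" where
  "L2_space M = {f \<in> borel_measurable M. integrable M (\<lambda>x. (cmod (f x))\<^sup>2)}"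

definition L2_norm :: "'a measure \<Rightarrow> ('a \<Rightarrow> 'b::{banach, second_countable_topology}) \<Rightarrow> real" where
  "L2_norm M f = sqrt (\<integral>x. (norm (f x))\<^sup>2 \<partial>M)"

definition L2_inner :: "'a measure \<Rightarrow> ('a \<Rightarrow> complex) \<Rightarrow> ('a \<Rightarrow> complex) \<Rightarrow> complex" where
  "L2_inner M f g = (\<integral>x. cnj (f x) * g x \<partial>M)"

definition L2_bounded_operator ::
    "'a measure \<Rightarrow> (('a \<Rightarrow> complex) \<Rightarrow> 'a \<Rightarrow> complex) \<Rightarrow> bool" where
  "L2_bounded_operator M T \<longleftrightarrow>
     (\<forall>f\<in>L2_space M. T f \<in> L2_space M) \<and>
     (\<forall>f\<in>L2_space M. \<forall>g\<in>L2_space M. \<forall>a b.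
        AE x in M. T (\<lambda>y. a * f y + b * g y) x = a * T f x + b * T g x) \<and>
     (\<exists>C. \<forall>f\<in>L2_space M. L2_norm M (T f) \<le> C * L2_norm M f)"

definition L2_op_norm :: "'a measure \<Rightarrow> (('a \<Rightarrow> complex) \<Rightarrow> 'a \<Rightarrow> complex) \<Rightarrow> real" where
  "L2_op_norm M T = (SUP f \<in> {f \<in> L2_space M. L2_norm M f \<le> 1}. L2_norm M (T f))"

definition L2_hermitian :: "'a measure \<Rightarrow> (('a \<Rightarrow> complex) \<Rightarrow> 'a \<Rightarrow> complex) \<Rightarrow> bool" where
  "L2_hermitian M T \<longleftrightarrow>
     (\<forall>f\<in>L2_space M. \<forall>g\<in>L2_space M. L2_inner M f (T g) = L2_inner M (T f) g)"

definition L2_positive :: "'a measure \<Rightarrow> (('a \<Rightarrow> complex) \<Rightarrow> 'a \<Rightarrow> complex) \<Rightarrow> bool" where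
  "L2_positive M T \<longleftrightarrow> (\<forall>f\<in>L2_space M. L2_inner M f (T f) \<in> \<real>\<^sub>\<ge>\<^sub>0)"

definition L2_spectrum :: "'a measure \<Rightarrow> (('a \<Rightarrow> complex) \<Rightarrow> 'a \<Rightarrow> complex) \<Rightarrow> complex set" where
  "L2_spectrum M T = {z. \<not> (\<exists>S. L2_bounded_operator M S \<and>
     (\<forall>f\<in>L2_space M. (AE x in M. T (S f) x - z * S f x = f x) \<and>
                     (AE x in M. S (\<lambda>y. T f y - z * f y) x = f x)))}"

definition L2_orthonormal_basis :: "'a measure \<Rightarrow> (nat \<Rightarrow> 'a \<Rightarrow> complex) \<Rightarrow> bool" where
  "L2_orthonormal_basis M e \<longleftrightarrow>
     (\<forall>k. e k \<in> L2_space M) \<and>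
     (\<forall>j k. L2_inner M (e j) (e k) = (if j = k then 1 else 0)) \<and>
     (\<forall>f\<in>L2_space M. (\<forall>k. L2_inner M (e k) f = 0) \<longrightarrow> (AE x in M. f x = 0))"

text \<open>Trace of a \<^emph>\<open>positive\<close> operator on an infinite-dimensional separable $L^2$ space.
  For such operators the series has nonnegative terms, and neither its convergence (which is the
  trace class property) nor its value depends on the orthonormal basis.\<close>

definition L2_has_trace ::
    "'a measure \<Rightarrow> (('a \<Rightarrow> complex) \<Rightarrow> 'a \<Rightarrow> complex) \<Rightarrow> complex \<Rightarrow> bool" where
  "L2_has_trace M T t \<longleftrightarrow>
     (\<exists>e. L2_orthonormal_basis M e \<and> (\<lambda>k. L2_inner M (e k) (T (e k))) sums t)"

text \<open>The compression $\mathbf 1_B T \mathbf 1_B$.\<close>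

definition L2_compress ::
    "'a set \<Rightarrow> (('a \<Rightarrow> complex) \<Rightarrow> 'a \<Rightarrow> complex) \<Rightarrow> ('a \<Rightarrow> complex) \<Rightarrow> 'a \<Rightarrow> complex" where
  "L2_compress B T f = (\<lambda>x. indicator B x * T (\<lambda>y. indicator B y * f y) x)"

definition L2_locally_trace_class ::
    "'a::topological_space measure \<Rightarrow> (('a \<Rightarrow> complex) \<Rightarrow> 'a \<Rightarrow> complex) \<Rightarrow> bool" where
  "L2_locally_trace_class M T \<longleftrightarrow> (\<forall>B. compact B \<longrightarrow> (\<exists>t. L2_has_trace M (L2_compress B T) t))"

section \<open>Kernels\<close>

definition kernel_op :: "'a measure \<Rightarrow> ('a \<Rightarrow> 'a \<Rightarrow> complex) \<Rightarrow> ('a \<Rightarrow> complex) \<Rightarrow> 'a \<Rightarrow> complex" where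
  "kernel_op M K f = (\<lambda>x. \<integral>y. K x y * f y \<partial>M)"

text \<open>The integrability clause makes the integral defining the operator meaningful: the
  Bochner integral of a non-integrable function is zero by convention.\<close>

definition bounded_kernel :: "'a::topological_space measure \<Rightarrow> ('a \<Rightarrow> 'a \<Rightarrow> complex) \<Rightarrow> bool" where
  "bounded_kernel M K \<longleftrightarrow>
     (\<lambda>(x, y). K x y) \<in> borel_measurable (borel \<Otimes>\<^sub>M borel) \<and>
     (\<forall>f\<in>L2_space M. AE x in M. integrable M (\<lambda>y. K x y * f y)) \<and>
     L2_bounded_operator M (kernel_op M K)"

definition diagonal_normalized :: "'a::topological_space measure \<Rightarrow> ('a \<Rightarrow> 'a \<Rightarrow> complex) \<Rightarrow> bool" where
  "diagonal_normalized M K \<longleftrightarrow> (\<forall>B. compact B \<longrightarrow>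
     set_integrable M B (\<lambda>x. K x x) \<and>
     L2_has_trace M (L2_compress B (kernel_op M K)) (LINT x:B|M. K x x))"

section \<open>The $\alpha$-determinantal process\<close>

text \<open>The cycles of a permutation, fixed points included, are its orbits.\<close>

definition num_cycles :: "nat \<Rightarrow> (nat \<Rightarrow> nat) \<Rightarrow> nat" where
  "num_cycles n \<sigma> = card (orbit \<sigma> ` {..<n})"

definition alpha_det :: "real \<Rightarrow> nat \<Rightarrow> (nat \<Rightarrow> nat \<Rightarrow> complex) \<Rightarrow> complex" where
  "alpha_det \<alpha> n A = (\<Sum>\<sigma> | \<sigma> permutes {..<n}.
     complex_of_real \<alpha> ^ (n - num_cycles n \<sigma>) * (\<Prod>i<n. A i (\<sigma> i)))"

definition random_locally_finite_set ::
    "'w measure \<Rightarrow> ('w \<Rightarrow> 'a::euclidean_space set) \<Rightarrow> bool" where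
  "random_locally_finite_set P X \<longleftrightarrow>
     (\<forall>\<omega>\<in>space P. \<forall>B. compact B \<longrightarrow> finite (X \<omega> \<inter> B)) \<and>
     (\<forall>B\<in>sets borel. bounded B \<longrightarrow> (\<lambda>\<omega>. card (X \<omega> \<inter> B)) \<in> measurable P (count_space UNIV))"

text \<open>$\rho$ is a density of the $n$-th factorial moment measure: the inner integral is the sum of
  $h(x_1,\dots,x_n)$ over all $n$-tuples of distinct points of $X$.\<close>

definition correlation_function ::
    "'w measure \<Rightarrow> ('w \<Rightarrow> 'a set) \<Rightarrow> 'a measure \<Rightarrow> nat \<Rightarrow> ((nat \<Rightarrow> 'a) \<Rightarrow> complex) \<Rightarrow> bool" where
  "correlation_function P X M n \<rho> \<longleftrightarrow>
     \<rho> \<in> borel_measurable (Pi\<^sub>M {..<n} (\<lambda>_. M)) \<and>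
     (AE t in Pi\<^sub>M {..<n} (\<lambda>_. M). \<rho> t \<in> \<real>\<^sub>\<ge>\<^sub>0) \<and>
     (\<forall>h \<in> borel_measurable (Pi\<^sub>M {..<n} (\<lambda>_. M)) :: ((nat \<Rightarrow> 'a) \<Rightarrow> ennreal) set.
        (\<integral>\<^sup>+\<omega>. (\<integral>\<^sup>+t. h t \<partial>count_space {t \<in> {..<n} \<rightarrow>\<^sub>E X \<omega>. inj_on t {..<n}}) \<partial>P) =
        (\<integral>\<^sup>+t. h t * ennreal (Re (\<rho> t)) \<partial>Pi\<^sub>M {..<n} (\<lambda>_. M)))"

definition alpha_determinantal_process ::
    "'w measure \<Rightarrow> ('w \<Rightarrow> 'a::euclidean_space set) \<Rightarrow> real \<Rightarrow> ('a \<Rightarrow> 'a \<Rightarrow> complex) \<Rightarrow> 'a measure \<Rightarrow> bool"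
  where
  "alpha_determinantal_process P X \<alpha> K M \<longleftrightarrow>
     prob_space P \<and> random_locally_finite_set P X \<and>
     (\<forall>n\<ge>1. correlation_function P X M n (\<lambda>t. alpha_det \<alpha> n (\<lambda>i j. K (t i) (t j))))"

definition linear_statistic :: "('a \<Rightarrow> real) \<Rightarrow> 'a set \<Rightarrow> real" where
  "linear_statistic \<phi> S = (\<Sum>\<^sub>\<infinity>x\<in>S. \<phi> x)"

section \<open>Geometry and smoothness\<close>

definition cube :: "'a::euclidean_space \<Rightarrow> real \<Rightarrow> 'a set" where
  "cube x r = cbox (x - (r / 2) *\<^sub>R One) (x + (r / 2) *\<^sub>R One)"

definition annulus :: "nat \<Rightarrow> 'a::euclidean_space \<Rightarrow> real \<Rightarrow> 'a set" where
  "annulus n x r = {y. real n * r \<le> norm (x - y) \<and> norm (x - y) \<le> (real n + 1) * r}"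

definition C2_function :: "('a::euclidean_space \<Rightarrow> real) \<Rightarrow> bool" where
  "C2_function \<phi> \<longleftrightarrow>
     (\<exists>(D :: 'a \<Rightarrow> 'a \<Rightarrow>\<^sub>L real) (D2 :: 'a \<Rightarrow> 'a \<Rightarrow>\<^sub>L 'a \<Rightarrow>\<^sub>L real).
        (\<forall>x. (\<phi> has_derivative blinfun_apply (D x)) (at x)) \<and>
        (\<forall>x. (D has_derivative blinfun_apply (D2 x)) (at x)) \<and>
        continuous_on UNIV D2)"

section \<open>The four conditions\<close>

definition condition_i ::
    "real \<Rightarrow> ('a::euclidean_space \<Rightarrow> 'a \<Rightarrow> complex) \<Rightarrow> 'a measure \<Rightarrow> bool" where
  "condition_i \<alpha> K M \<longleftrightarrow>
     (\<forall>\<delta>>0. \<exists>m>0. \<exists>r>0. \<forall>x.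
        measure lborel {y \<in> cube x r. Re (K y y) \<ge> m} \<ge> (1 - \<delta>) * measure lborel (cube x r)) \<and>
     (\<alpha> < 0 \<longrightarrow> L2_op_norm M (kernel_op M K) < inverse \<bar>\<alpha>\<bar>)"

definition condition_iia :: "real \<Rightarrow> ('a::euclidean_space \<Rightarrow> 'a \<Rightarrow> complex) \<Rightarrow> bool" where
  "condition_iia \<alpha> K \<longleftrightarrow> \<alpha> < 0 \<and> DIM('a) > 4 \<and>
     (\<exists>a>0. \<exists>\<delta>>0. \<forall>x y. norm (x - y) < \<delta> \<longrightarrow> cmod (K x y) \<ge> a)"

text \<open>The value at $y = x$, where $0^{-\beta}$ is zero in HOL, is irrelevant: for $n \ge 1$ and
  $r > 0$ the annulus does not contain its centre.\<close>

definition condition_iib :: "real \<Rightarrow> ('a::euclidean_space \<Rightarrow> 'a \<Rightarrow> complex) \<Rightarrow> real \<Rightarrow> bool" where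
  "condition_iib \<alpha> K \<beta> \<longleftrightarrow> \<alpha> < 0 \<and> real DIM('a) / 2 < \<beta> \<and> \<beta> < real DIM('a) \<and>
     (\<exists>r>0. \<exists>c1>0. \<exists>c2>0. \<exists>n0\<ge>1. \<forall>x. \<forall>n\<ge>n0.
        measure lborel ({y. cmod (K x y) \<ge> c1 * norm (x - y) powr (- \<beta>)} \<inter> annulus n x r)
          \<ge> c2 * measure lborel (annulus n x r))"

definition condition_iic ::
    "real \<Rightarrow> ('a::euclidean_space \<Rightarrow> 'a \<Rightarrow> complex) \<Rightarrow> ('a \<Rightarrow> real) \<Rightarrow> bool" where
  "condition_iic \<alpha> K \<phi> \<longleftrightarrow> \<alpha> < 0 \<and> DIM('a) > 2 \<and> C2_function \<phi> \<and>
     (SUP x. \<integral>\<^sup>+y. ennreal (norm (x - y) ^ 3 * (cmod (K x y))\<^sup>2) \<partial>lborel) < \<infinity> \<and>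
     (INF x. INF u\<in>sphere 0 1.
        \<integral>\<^sup>+y. ennreal (\<bar>(y - x) \<bullet> u\<bar>\<^sup>2 * (cmod (K x y))\<^sup>2) \<partial>lborel) > 0"

end

theory Submission
  imports Defs
begin

text \<open>
  Write $R$ for the norm of $K$ and $k(x) = K(x,x)$. Comparing traces with Hilbert--Schmidt norms
  gives $\int |K(x,y)|^2 d\mu(y) \le R\, k(x)$ for almost every $x$, and since the norm of a positive
  operator belongs to its spectrum, $|\alpha| R \le 1$ when $\alpha < 0$. The correlation functions give
  \[ \mathrm{Var}[\Lambda(\varphi)] = \int \varphi^2 k\, d\mu
     + \alpha \iint \varphi(x) \varphi(y) |K(x,y)|^2 d\mu(x) d\mu(y). \]
  For $\alpha > 0$ the double integral is nonnegative because $|K|^2$ is positive semidefinite. For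
  $\alpha < 0$ the identity $2ab = a^2 + b^2 - (a-b)^2$ bounds the variance below by
  $(1 - |\alpha| R) \int \varphi^2 k\, d\mu
   + \frac{|\alpha|}{2} \iint |\varphi(x)-\varphi(y)|^2 |K(x,y)|^2 d\mu(x) d\mu(y)$.
  In case (i) the first term has order $L^d$. In the other cases the second term is bounded below:
  in (ii.a) by comparing the scaled test function with its translates by short vectors (which even gives the
  rate $L^{d-2}$), in (ii.b) by pairs with $y$ outside the support at distance of order $L$ from
  $x$, and in (ii.c) by a first order Taylor expansion.
\<close>

section \<open>Complex $L^2$ spaces\<close>

text \<open>An operator inequality has to become a pointwise bound on the kernel, although the
  sections \<open>K x\<close> are a priori not square integrable and the trace formula speaks only
  of compact sets. The bridge is |T f|^2 \<le> R <f, T f>, obtained from Cauchy-Schwarz for the form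
  of \<open>T\<close> in place of functional calculus. Summed over truncated basis functions 1_B
  e_k, its left side is a Hilbert-Schmidt integral of the kernel with one variable in B, its right
  side R times the trace; as B is an arbitrary compact set, the inequality localises to almost every
  point. For \<alpha> < 0 the bound |\<alpha>| R \<le> 1 then makes the diagonal term harmless, and
  the strict inequality of case (i) is the gap that lets this term alone carry the rate. For
  \<alpha> > 0, positivity of \<open>K\<close> is known only for integrals against functions, not
  for finite sets of points, so the Schur product enters through matrix coefficients in a basis. The
  geometric estimates use Lebesgue measure and pass to \<mu> at the cost of one factor
  \<open>c\<close> per integration variable.\<close>

lemma borel_measurable_cnj [measurable]: "cnj \<in> borel_measurable borel"
  by (intro borel_measurable_continuous_onI continuous_intros)

lemma L2_spaceI:
  "f \<in> borel_measurable M \<Longrightarrow> integrable M (\<lambda>x. (cmod (f x))\<^sup>2) \<Longrightarrow> f \<in> L2_space M"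
  by (simp add: L2_space_def)

lemma L2_space_measurable [measurable_dest]: "f \<in> L2_space M \<Longrightarrow> f \<in> borel_measurable M"
  by (simp add: L2_space_def)

lemma L2_space_integrable: "f \<in> L2_space M \<Longrightarrow> integrable M (\<lambda>x. (cmod (f x))\<^sup>2)"
  by (simp add: L2_space_def)

lemma L2_space_dominated:
  assumes "f \<in> L2_space M" "g \<in> borel_measurable M" "AE x in M. cmod (g x) \<le> C * cmod (f x)"
  shows "g \<in> L2_space M"
proof (rule L2_spaceI)
  note [measurable] = assms(2)
  show "integrable M (\<lambda>x. (cmod (g x))\<^sup>2)"
  proof (rule Bochner_Integration.integrable_bound)
    show "integrable M (\<lambda>x. C\<^sup>2 * (cmod (f x))\<^sup>2)" using L2_space_integrable[OF assms(1)] by simp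
    show "AE x in M. norm ((cmod (g x))\<^sup>2) \<le> norm (C\<^sup>2 * (cmod (f x))\<^sup>2)"
      using assms(3)
    proof eventually_elim
      case (elim x)
      have "(cmod (g x))\<^sup>2 \<le> (C * cmod (f x))\<^sup>2" by (rule power_mono[OF elim]) simp
      then show ?case by (simp add: power_mult_distrib)
    qed
  qed simp
qed fact

lemma integrable_mult_L2:
  assumes "f \<in> L2_space M" "g \<in> L2_space M"
  shows "integrable M (\<lambda>x. f x * g x)"
proof (rule Bochner_Integration.integrable_bound)
  note [measurable] = assms
  show "integrable M (\<lambda>x. (cmod (f x))\<^sup>2 + (cmod (g x))\<^sup>2)"
    using assms by (simp add: L2_space_integrable)
  show "AE x in M. norm (f x * g x) \<le> norm ((cmod (f x))\<^sup>2 + (cmod (g x))\<^sup>2)"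
  proof (intro AE_I2)
    fix x
    have "2 * cmod (f x) * cmod (g x) \<le> (cmod (f x))\<^sup>2 + (cmod (g x))\<^sup>2"
      by (rule sum_squares_bound)
    moreover have "0 \<le> cmod (f x) * cmod (g x)" by simp
    ultimately have "cmod (f x) * cmod (g x) \<le> (cmod (f x))\<^sup>2 + (cmod (g x))\<^sup>2" by linarith
    then show "norm (f x * g x) \<le> norm ((cmod (f x))\<^sup>2 + (cmod (g x))\<^sup>2)"
      by (simp add: norm_mult)
  qed
  show "(\<lambda>x. f x * g x) \<in> borel_measurable M" using assms by measurable
qed

lemma L2_cnj: "f \<in> L2_space M \<Longrightarrow> (\<lambda>x. cnj (f x)) \<in> L2_space M"
  by (rule L2_space_dominated[where C = 1]) auto

lemma L2_cmult: "f \<in> L2_space M \<Longrightarrow> (\<lambda>x. c * f x) \<in> L2_space M"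
  by (rule L2_space_dominated[where C = "cmod c"]) (auto simp: norm_mult)

lemma L2_add:
  assumes "f \<in> L2_space M" "g \<in> L2_space M"
  shows "(\<lambda>x. f x + g x) \<in> L2_space M"
proof (rule L2_spaceI)
  show "(\<lambda>x. f x + g x) \<in> borel_measurable M" using assms by measurable
  show "integrable M (\<lambda>x. (cmod (f x + g x))\<^sup>2)"
  proof (rule Bochner_Integration.integrable_bound)
    show "integrable M (\<lambda>x. 2 * (cmod (f x))\<^sup>2 + 2 * (cmod (g x))\<^sup>2)"
      using assms by (simp add: L2_space_integrable)
    show "AE x in M. norm ((cmod (f x + g x))\<^sup>2) \<le> norm (2 * (cmod (f x))\<^sup>2 + 2 * (cmod (g x))\<^sup>2)"
    proof (intro AE_I2)
      fix x
      have "(cmod (f x + g x))\<^sup>2 \<le> (cmod (f x) + cmod (g x))\<^sup>2"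
        by (intro power_mono norm_triangle_ineq) simp
      also have "\<dots> \<le> 2 * (cmod (f x))\<^sup>2 + 2 * (cmod (g x))\<^sup>2"
        using sum_squares_bound[of "cmod (f x)" "cmod (g x)"] by (simp add: power2_sum)
      finally show "norm ((cmod (f x + g x))\<^sup>2) \<le> norm (2 * (cmod (f x))\<^sup>2 + 2 * (cmod (g x))\<^sup>2)"
        by simp
    qed
    show "(\<lambda>x. (cmod (f x + g x))\<^sup>2) \<in> borel_measurable M" using assms by measurable
  qed
qed

lemma L2_diff:
  assumes "f \<in> L2_space M" "g \<in> L2_space M"
  shows "(\<lambda>x. f x - g x) \<in> L2_space M"
  using L2_add[OF assms(1) L2_cmult[OF assms(2), of "-1"]] by simp

lemma L2_zero: "(\<lambda>x. 0) \<in> L2_space M"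
  by (simp add: L2_space_def)

lemma L2_sum: "(\<And>i. i \<in> I \<Longrightarrow> f i \<in> L2_space M) \<Longrightarrow> (\<lambda>x. \<Sum>i\<in>I. f i x) \<in> L2_space M"
  by (induction I rule: infinite_finite_induct) (auto simp: L2_zero intro: L2_add)

lemma L2_mult_bounded:
  assumes "f \<in> L2_space M" "h \<in> borel_measurable M" "\<And>x. cmod (h x) \<le> C"
  shows "(\<lambda>x. h x * f x) \<in> L2_space M"
proof (rule L2_space_dominated[OF assms(1), where C = C])
  show "(\<lambda>x. h x * f x) \<in> borel_measurable M" using assms(1,2) by measurable
qed (auto simp: norm_mult intro!: AE_I2 mult_right_mono assms(3))

lemma L2_mult_indicator:
  assumes "f \<in> L2_space M" "A \<in> sets M"
  shows "(\<lambda>x. indicator A x * f x) \<in> L2_space M"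
  by (rule L2_mult_bounded[OF assms(1), where C = 1]) (use assms in \<open>auto simp: indicator_def\<close>)

lemma L2_indicator:
  assumes "A \<in> sets M" "emeasure M A < \<infinity>"
  shows "indicator A \<in> L2_space M"
proof (rule L2_spaceI)
  have "(\<lambda>x. (cmod (indicator A x))\<^sup>2) = (indicator A :: 'a \<Rightarrow> real)"
    by (auto simp: indicator_def)
  then show "integrable M (\<lambda>x. (cmod (indicator A x))\<^sup>2)" using assms by simp
qed (use assms in simp)

lemma integrable_L2_inner:
  "f \<in> L2_space M \<Longrightarrow> g \<in> L2_space M \<Longrightarrow> integrable M (\<lambda>x. cnj (f x) * g x)"
  by (intro integrable_mult_L2 L2_cnj)

lemma L2_inner_add_right:
  "f \<in> L2_space M \<Longrightarrow> g \<in> L2_space M \<Longrightarrow> h \<in> L2_space M \<Longrightarrow>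
    L2_inner M f (\<lambda>x. g x + h x) = L2_inner M f g + L2_inner M f h"
  by (simp add: L2_inner_def distrib_left integrable_L2_inner)

lemma L2_inner_diff_right:
  "f \<in> L2_space M \<Longrightarrow> g \<in> L2_space M \<Longrightarrow> h \<in> L2_space M \<Longrightarrow>
    L2_inner M f (\<lambda>x. g x - h x) = L2_inner M f g - L2_inner M f h"
  by (simp add: L2_inner_def right_diff_distrib integrable_L2_inner)

lemma L2_inner_cmult_right: "L2_inner M f (\<lambda>x. c * g x) = c * L2_inner M f g"
  unfolding L2_inner_def by (simp add: mult.left_commute)

lemma L2_inner_cnj: "L2_inner M g f = cnj (L2_inner M f g)"
  using Bochner_Integration.integral_cnj[of M "\<lambda>x. cnj (f x) * g x"] by (simp add: L2_inner_def mult.commute)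

lemma L2_inner_add_left:
  "f \<in> L2_space M \<Longrightarrow> g \<in> L2_space M \<Longrightarrow> h \<in> L2_space M \<Longrightarrow>
    L2_inner M (\<lambda>x. g x + h x) f = L2_inner M g f + L2_inner M h f"
  by (subst (1 2 3) L2_inner_cnj) (simp add: L2_inner_add_right)

lemma L2_inner_cmult_left: "L2_inner M (\<lambda>x. c * g x) f = cnj c * L2_inner M g f"
  by (subst (1 2) L2_inner_cnj) (simp add: L2_inner_cmult_right)

lemma L2_inner_sum_right:
  "f \<in> L2_space M \<Longrightarrow> (\<And>i. i \<in> I \<Longrightarrow> g i \<in> L2_space M) \<Longrightarrow>
    L2_inner M f (\<lambda>x. \<Sum>i\<in>I. g i x) = (\<Sum>i\<in>I. L2_inner M f (g i))"
  unfolding L2_inner_def by (simp add: sum_distrib_left integrable_L2_inner)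

lemma L2_inner_sum_left:
  "f \<in> L2_space M \<Longrightarrow> (\<And>i. i \<in> I \<Longrightarrow> g i \<in> L2_space M) \<Longrightarrow>
    L2_inner M (\<lambda>x. \<Sum>i\<in>I. g i x) f = (\<Sum>i\<in>I. L2_inner M (g i) f)"
  by (subst L2_inner_cnj) (simp add: L2_inner_sum_right cnj_sum L2_inner_cnj[symmetric])

lemma L2_norm_nonneg [simp]: "0 \<le> L2_norm M f"
  by (simp add: L2_norm_def)

lemma L2_norm_power2: "(L2_norm M f)\<^sup>2 = (\<integral>x. (norm (f x))\<^sup>2 \<partial>M)"
  by (simp add: L2_norm_def)

lemma L2_inner_self: "L2_inner M f f = of_real ((L2_norm M f)\<^sup>2)"
proof -
  have "L2_inner M f f = (\<integral>x. complex_of_real ((cmod (f x))\<^sup>2) \<partial>M)"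
    unfolding L2_inner_def
    by (intro Bochner_Integration.integral_cong refl) (simp add: complex_norm_square mult.commute del: of_real_power)
  then show ?thesis by (simp add: L2_norm_power2 del: of_real_power)
qed

lemma L2_norm_cong_AE:
  assumes "f \<in> borel_measurable M" "g \<in> borel_measurable M" "AE x in M. f x = g x"
  shows "L2_norm M f = L2_norm M g"
  unfolding L2_norm_def using assms by (intro arg_cong[where f = sqrt] integral_cong_AE) auto

lemma L2_inner_cong_AE:
  assumes "f \<in> borel_measurable M" "g \<in> borel_measurable M" "h \<in> borel_measurable M"
    "AE x in M. g x = h x"
  shows "L2_inner M f g = L2_inner M f h"
  unfolding L2_inner_def using assms by (intro integral_cong_AE) auto

lemma nn_integral_L2_norm:
  assumes "f \<in> L2_space M"
  shows "(\<integral>\<^sup>+x. ennreal ((cmod (f x))\<^sup>2) \<partial>M) = ennreal ((L2_norm M f)\<^sup>2)"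
  unfolding L2_norm_power2 by (rule nn_integral_eq_integral) (auto simp: L2_space_integrable[OF assms])

lemma L2_norm_cmult: "L2_norm M (\<lambda>x. c * f x :: complex) = cmod c * L2_norm M f"
  unfolding L2_norm_def by (simp add: norm_mult power_mult_distrib real_sqrt_mult)

text \<open>The discriminant argument behind every Cauchy--Schwarz inequality for a positive
  semidefinite form.\<close>

lemma cmod_square_le_if_quadratic_nonneg:
  fixes A C :: real and B :: complex
  assumes "\<And>z. 0 \<le> A + 2 * Re (z * B) + (cmod z)\<^sup>2 * C"
  shows "(cmod B)\<^sup>2 \<le> A * C"
proof -
  define b where "b = (cmod B)\<^sup>2"
  \<comment> \<open>Taking z to be a real multiple of \<open>cnj B\<close> turns the hypothesis into
    a real quadratic in \<open>t\<close>.\<close>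
  have q: "0 \<le> A + 2 * (t * b) + t\<^sup>2 * b * C" for t :: real
  proof -
    have "Re (of_real t * cnj B * B) = t * b"
      by (simp add: b_def cmod_power2) (simp add: power2_eq_square algebra_simps)
    then show ?thesis
      using assms[of "of_real t * cnj B"]
      by (simp add: norm_mult power_mult_distrib b_def)
  qed
  have b0: "b \<ge> 0" by (simp add: b_def)
  show ?thesis
  proof (cases "C > 0")
    case True
    have "0 \<le> A + 2 * (- (1/C) * b) + (- (1/C))\<^sup>2 * b * C" by (rule q)
    also have "\<dots> = A - b / C" using True by (simp add: power2_eq_square field_simps)
    finally show ?thesis using True by (simp add: b_def[symmetric] field_simps)
  next
    case False
    \<comment> \<open>Without a positive leading coefficient, an expression bounded below for all
      \<open>t\<close> must have slope zero.\<close>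
    have "b = 0"
    proof (rule ccontr)
      assume "b \<noteq> 0"
      then have "b > 0" using b0 by simp
      define t where "t = - (\<bar>A\<bar> + 1) / b"
      have "t * b = - (\<bar>A\<bar> + 1)" using \<open>b > 0\<close> by (simp add: t_def)
      moreover have "t\<^sup>2 * b * C \<le> 0" using False b0 by (simp add: mult_nonneg_nonpos)
      ultimately show False using q[of t] by linarith
    qed
    moreover have "0 \<le> A * C \<or> A * C < 0" by linarith
    moreover have "A \<ge> 0" using q[of 0] by simp
    moreover have "C \<ge> 0"
    proof (rule ccontr)
      assume "\<not> C \<ge> 0"
      define s where "s = (\<bar>A\<bar> + 1) / (- C) + 1"
      have s: "s \<ge> 1" using \<open>\<not> C \<ge> 0\<close> by (simp add: s_def divide_nonneg_neg)
      have "0 \<le> A + s\<^sup>2 * C"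
        using assms[of "of_real s"] \<open>b = 0\<close> by (simp add: b_def)
      moreover have "s * C \<ge> s\<^sup>2 * C"
        using s \<open>\<not> C \<ge> 0\<close> by (intro mult_right_mono_neg) (auto simp: power2_eq_square)
      moreover have "s * C = - (\<bar>A\<bar> + 1) + C" using \<open>\<not> C \<ge> 0\<close> by (simp add: s_def field_simps)
      ultimately show False using \<open>\<not> C \<ge> 0\<close> by linarith
    qed
    ultimately show ?thesis by (simp add: b_def)
  qed
qed

section \<open>Cauchy-Schwarz, limits and completeness\<close>

lemma L2_norm_add_square:
  assumes "f \<in> L2_space M" "g \<in> L2_space M"
  shows "(L2_norm M (\<lambda>x. f x + z * g x))\<^sup>2 =
    (L2_norm M f)\<^sup>2 + 2 * Re (z * L2_inner M f g) + (cmod z)\<^sup>2 * (L2_norm M g)\<^sup>2"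
proof -
  have zg: "(\<lambda>x. z * g x) \<in> L2_space M" using assms(2) by (rule L2_cmult)
  have "of_real ((L2_norm M (\<lambda>x. f x + z * g x))\<^sup>2) =
      L2_inner M f f + z * L2_inner M f g + cnj (z * L2_inner M f g) + z * cnj z * L2_inner M g g"
    unfolding L2_inner_self[symmetric]
    by (simp add: L2_inner_add_right L2_inner_add_left assms zg L2_add L2_inner_cmult_right
        L2_inner_cmult_left L2_inner_cnj[of M g f] algebra_simps)
  from arg_cong[OF this, of Re] show ?thesis
    by (simp add: L2_inner_self complex_norm_square[symmetric] del: of_real_power)
qed

lemma L2_Cauchy_Schwarz:
  assumes "f \<in> L2_space M" "g \<in> L2_space M"
  shows "cmod (L2_inner M f g) \<le> L2_norm M f * L2_norm M g"
proof -
  have "(cmod (L2_inner M f g))\<^sup>2 \<le> (L2_norm M f)\<^sup>2 * (L2_norm M g)\<^sup>2"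
    using cmod_square_le_if_quadratic_nonneg[of "(L2_norm M f)\<^sup>2" "L2_inner M f g" "(L2_norm M g)\<^sup>2"]
    by (metis L2_norm_add_square[OF assms] zero_le_power2)
  then show ?thesis by (simp add: power_mult_distrib[symmetric] power2_le_iff_abs_le)
qed

text \<open>Fatou's lemma makes the limit inferior of |S n - F|^2 vanish almost everywhere; where
  \<open>S n x\<close> converges, this limit inferior is |G x - F x|^2. No subsequence has to be
  extracted.\<close>

lemma L2_limit_unique_AE:
  assumes F: "F \<in> L2_space M" and S: "\<And>n. S n \<in> L2_space M"
    and lim: "(\<lambda>n. L2_norm M (\<lambda>x. S n x - F x)) \<longlonglongrightarrow> 0"
    and pt: "AE x in M. (\<lambda>n. S n x) \<longlonglongrightarrow> G x"
  shows "AE x in M. G x = F x"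
proof -
  note [measurable] = F S
  have "(\<integral>\<^sup>+x. liminf (\<lambda>n. ennreal ((cmod (S n x - F x))\<^sup>2)) \<partial>M)
      \<le> liminf (\<lambda>n. \<integral>\<^sup>+x. ennreal ((cmod (S n x - F x))\<^sup>2) \<partial>M)"
    by (rule nn_integral_liminf) measurable
  also have "(\<lambda>n. \<integral>\<^sup>+x. ennreal ((cmod (S n x - F x))\<^sup>2) \<partial>M) =
      (\<lambda>n. ennreal ((L2_norm M (\<lambda>x. S n x - F x))\<^sup>2))"
    by (intro ext nn_integral_L2_norm L2_diff F S)
  also have "(\<lambda>n. ennreal ((L2_norm M (\<lambda>x. S n x - F x))\<^sup>2)) \<longlonglongrightarrow> ennreal (0\<^sup>2)"
    by (intro tendsto_ennrealI tendsto_power lim)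
  then have "liminf (\<lambda>n. ennreal ((L2_norm M (\<lambda>x. S n x - F x))\<^sup>2)) = 0"
    using lim_imp_Liminf[OF sequentially_bot] by (metis ennreal_0 power_zero_numeral)
  finally have "(\<integral>\<^sup>+x. liminf (\<lambda>n. ennreal ((cmod (S n x - F x))\<^sup>2)) \<partial>M) = 0" by simp
  then have "AE x in M. liminf (\<lambda>n. ennreal ((cmod (S n x - F x))\<^sup>2)) = 0"
    by (subst (asm) nn_integral_0_iff_AE) measurable
  with pt show ?thesis
  proof eventually_elim
    case (elim x)
    have "(\<lambda>n. ennreal ((cmod (S n x - F x))\<^sup>2)) \<longlonglongrightarrow> ennreal ((cmod (G x - F x))\<^sup>2)"
      by (intro tendsto_ennrealI tendsto_power tendsto_norm tendsto_diff tendsto_const elim)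
    then have "ennreal ((cmod (G x - F x))\<^sup>2) = 0"
      using lim_imp_Liminf[OF sequentially_bot] elim by metis
    then show ?case by simp
  qed
qed

text \<open>A subsequence with increments below 2^-k in norm converges almost everywhere; Fatou's
  lemma then turns the Cauchy property into norm convergence of the whole sequence to the pointwise
  limit.\<close>

lemma L2_complete:
  assumes S: "\<And>n. S n \<in> L2_space M"
    and cauchy: "\<And>e. e > 0 \<Longrightarrow> \<exists>N. \<forall>m\<ge>N. \<forall>n\<ge>N. L2_norm M (\<lambda>x. S m x - S n x) < e"
  shows "\<exists>F\<in>L2_space M. (\<lambda>n. L2_norm M (\<lambda>x. S n x - F x)) \<longlonglongrightarrow> 0"
proof -
  note [measurable] = S
  have "\<exists>N. \<forall>k. (\<forall>m\<ge>N k. \<forall>n\<ge>N k. L2_norm M (\<lambda>x. S m x - S n x) < (1/2)^k)"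
    using cauchy[of "(1/2)^k" for k] by (intro choice) auto
  then obtain N where N: "\<And>k m n. m \<ge> N k \<Longrightarrow> n \<ge> N k \<Longrightarrow> L2_norm M (\<lambda>x. S m x - S n x) < (1/2)^k"
    by blast
  \<comment> \<open>Summing the thresholds makes \<open>r\<close> nondecreasing and keeps
    \<open>N k \<le> r k\<close>.\<close>
  define r where "r k = (\<Sum>i\<le>k. N i)" for k
  have r: "N k \<le> r k" "r k \<le> r (Suc k)" for k
    by (auto simp: r_def intro: member_le_sum)
  have rN: "N k \<le> r (Suc k)" for k using r[of k] by simp
  define D where "D k x = S (r (Suc k)) x - S (r k) x" for k x
  have [measurable]: "D k \<in> borel_measurable M" for k unfolding D_def by measurable
  have DL: "D k \<in> L2_space M" for k
    unfolding D_def[abs_def] by (intro L2_diff S)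
  have Dn: "(L2_norm M (D k))\<^sup>2 \<le> ((1/2)^k)\<^sup>2" for k
    unfolding D_def[abs_def] by (intro power_mono less_imp_le[OF N] rN r) simp
  \<comment> \<open>The weight 2^k stands in for Minkowski's inequality: |D k|^2 has integral at
    most 4^-k, so the weighted squares still have a summable integral.\<close>
  have "(\<integral>\<^sup>+x. (\<Sum>k. ennreal (2^k * (cmod (D k x))\<^sup>2)) \<partial>M) =
      (\<Sum>k. \<integral>\<^sup>+x. ennreal (2^k * (cmod (D k x))\<^sup>2) \<partial>M)"
    by (rule nn_integral_suminf) measurable
  also have "\<dots> = (\<Sum>k. ennreal (2^k * (L2_norm M (D k))\<^sup>2))"
    by (simp add: ennreal_mult nn_integral_cmult nn_integral_L2_norm DL)
  also have "\<dots> \<le> (\<Sum>k. ennreal ((1/2)^k))"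
  proof (intro suminf_le ennreal_leI)
    fix k :: nat
    have "2^k * (L2_norm M (D k))\<^sup>2 \<le> 2^k * ((1/2)^k)\<^sup>2" by (intro mult_left_mono Dn) simp
    also have "\<dots> = (1/2)^k" by (simp add: power2_eq_square field_simps)
    finally show "2^k * (L2_norm M (D k))\<^sup>2 \<le> (1/2)^k" .
  qed auto
  also have "\<dots> < \<infinity>"
    by (subst suminf_ennreal2) (auto intro: summable_geometric)
  finally have "AE x in M. (\<Sum>k. ennreal (2^k * (cmod (D k x))\<^sup>2)) \<noteq> \<infinity>"
    by (intro nn_integral_noteq_infinite) (auto simp: less_top)
  then have conv: "AE x in M. convergent (\<lambda>k. S (r k) x)"
  proof eventually_elim
    case (elim x)
    have "summable (\<lambda>k. 2^k * (cmod (D k x))\<^sup>2)"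
      using elim by (intro summable_suminf_not_top) auto
    moreover have "summable (\<lambda>k. (1/2)^k :: real)" by (rule summable_geometric) simp
    ultimately have "summable (\<lambda>k. (1/2)^k + 2^k * (cmod (D k x))\<^sup>2)" by (intro summable_add)
    then have "summable (\<lambda>k. D k x)"
    proof (rule summable_comparison_test'[where N = 0])
      fix k :: nat
      define q where "q = (2::real)^k"
      have q: "q > 0" "(1/2)^k = 1/q" by (auto simp: q_def field_simps)
      \<comment> \<open>Completing the square bounds |D k x| by 2^-k plus the weighted square, both
        of which are summable.\<close>
      have "0 \<le> (1 - q * cmod (D k x))\<^sup>2" by simp
      then have "2 * (q * cmod (D k x)) \<le> 1 + q\<^sup>2 * (cmod (D k x))\<^sup>2"
        by (simp add: power2_diff power_mult_distrib)
      then have "2 * cmod (D k x) \<le> 1/q + q * (cmod (D k x))\<^sup>2"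
        using q by (simp add: field_simps power2_eq_square)
      then show "norm (D k x) \<le> (1/2)^k + 2^k * (cmod (D k x))\<^sup>2"
        unfolding q(2) q_def[symmetric] using norm_ge_zero[of "D k x"] by linarith
    qed
    then have "convergent (\<lambda>n. \<Sum>k<n. D k x)" by (simp add: summable_iff_convergent)
    moreover have "(\<Sum>k<n. D k x) = S (r n) x - S (r 0) x" for n
      unfolding D_def by (rule sum_lessThan_telescope)
    ultimately have "convergent (\<lambda>n. S (r n) x - S (r 0) x)" by simp
    then show ?case by (simp add: convergent_diff_const_right_iff)
  qed
  define F where "F x = lim (\<lambda>k. S (r k) x)" for x
  have [measurable]: "F \<in> borel_measurable M" unfolding F_def[abs_def] by measurable
  have Flim: "AE x in M. (\<lambda>k. S (r k) x) \<longlonglongrightarrow> F x"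
    using conv unfolding F_def by eventually_elim (simp add: convergent_LIMSEQ_iff)
  have bound: "(\<integral>\<^sup>+x. ennreal ((cmod (S n x - F x))\<^sup>2) \<partial>M) \<le> ennreal (((1/2)^k)\<^sup>2)"
    if "n \<ge> N k" for n k
  proof -
    have "(\<integral>\<^sup>+x. ennreal ((cmod (S n x - F x))\<^sup>2) \<partial>M) =
        (\<integral>\<^sup>+x. liminf (\<lambda>j. ennreal ((cmod (S n x - S (r j) x))\<^sup>2)) \<partial>M)"
    proof (rule nn_integral_cong_AE)
      show "AE x in M. ennreal ((cmod (S n x - F x))\<^sup>2) = liminf (\<lambda>j. ennreal ((cmod (S n x - S (r j) x))\<^sup>2))"
        using Flim
      proof eventually_elim
        case (elim x)
        have "(\<lambda>j. ennreal ((cmod (S n x - S (r j) x))\<^sup>2)) \<longlonglongrightarrow> ennreal ((cmod (S n x - F x))\<^sup>2)"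
          by (intro tendsto_ennrealI tendsto_power tendsto_norm tendsto_diff tendsto_const elim)
        then show ?case using lim_imp_Liminf[OF sequentially_bot] by metis
      qed
    qed
    also have "\<dots> \<le> liminf (\<lambda>j. \<integral>\<^sup>+x. ennreal ((cmod (S n x - S (r j) x))\<^sup>2) \<partial>M)"
      by (rule nn_integral_liminf) measurable
    also have "\<dots> \<le> liminf (\<lambda>j. ennreal (((1/2)^k)\<^sup>2))"
    proof (rule Liminf_mono)
      have rk: "k \<le> j \<Longrightarrow> r k \<le> r j" for j by (rule lift_Suc_mono_le[of r]) (rule r)
      have "(\<integral>\<^sup>+x. ennreal ((cmod (S n x - S (r j) x))\<^sup>2) \<partial>M) \<le> ennreal (((1/2)^k)\<^sup>2)" if "j \<ge> k" for j
      proof -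
        have "N k \<le> r j" using rk[OF that] r(1)[of k] by simp
        then show ?thesis
          by (subst nn_integral_L2_norm)
            (auto intro!: L2_diff S ennreal_leI power_mono less_imp_le[OF N] \<open>n \<ge> N k\<close>)
      qed
      then show "\<forall>\<^sub>F j in sequentially. (\<integral>\<^sup>+x. ennreal ((cmod (S n x - S (r j) x))\<^sup>2) \<partial>M) \<le> ennreal (((1/2)^k)\<^sup>2)"
        by (auto simp: eventually_sequentially)
    qed
    also have "\<dots> = ennreal (((1/2)^k)\<^sup>2)" by (simp add: Liminf_const)
    finally show ?thesis .
  qed
  have diffL: "(\<lambda>x. S n x - F x) \<in> L2_space M" if "n \<ge> N k" for n k
  proof (rule L2_spaceI)
    show "integrable M (\<lambda>x. (cmod (S n x - F x))\<^sup>2)"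
      using bound[OF that] by (intro integrableI_nonneg) (auto intro: le_less_trans)
  qed measurable
  have "F \<in> L2_space M"
    using L2_diff[OF S[of "N 0"] diffL[of 0 "N 0"]] by simp
  moreover have "(\<lambda>n. L2_norm M (\<lambda>x. S n x - F x)) \<longlonglongrightarrow> 0"
  proof (rule LIMSEQ_I)
    fix e :: real assume "e > 0"
    then obtain k where k: "(1/2)^k < e" using real_arch_pow_inv[of e "1/2"] by auto
    have "norm (L2_norm M (\<lambda>x. S n x - F x) - 0) < e" if "n \<ge> N k" for n
    proof -
      have "ennreal ((L2_norm M (\<lambda>x. S n x - F x))\<^sup>2) \<le> ennreal (((1/2)^k)\<^sup>2)"
        using bound[OF that] nn_integral_L2_norm[OF diffL[OF that]] by simp
      then have "L2_norm M (\<lambda>x. S n x - F x) \<le> (1/2)^k"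
        by (simp add: power2_le_iff_abs_le)
      then show ?thesis using k by simp
    qed
    then show "\<exists>no. \<forall>n\<ge>no. norm (L2_norm M (\<lambda>x. S n x - F x) - 0) < e" by blast
  qed
  ultimately show ?thesis by blast
qed

section \<open>Orthonormal expansions\<close>

lemma L2_ortho_sum_norm:
  assumes e: "\<And>k. e k \<in> L2_space M" "\<And>j k. L2_inner M (e j) (e k) = (if j = k then 1 else 0)"
    and "finite I"
  shows "(L2_norm M (\<lambda>x. \<Sum>k\<in>I. c k * e k x))\<^sup>2 = (\<Sum>k\<in>I. (cmod (c k))\<^sup>2)"
proof -
  have ce: "(\<lambda>x. c k * e k x) \<in> L2_space M" for k by (intro L2_cmult e)
  have S: "(\<lambda>x. \<Sum>k\<in>I. c k * e k x) \<in> L2_space M" by (intro L2_sum ce)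
  have "of_real ((L2_norm M (\<lambda>x. \<Sum>k\<in>I. c k * e k x))\<^sup>2) =
      (\<Sum>j\<in>I. \<Sum>k\<in>I. cnj (c j) * (c k * (if j = k then 1 else 0)))"
    unfolding L2_inner_self[symmetric]
    by (simp add: L2_inner_sum_left S ce L2_inner_sum_right L2_inner_cmult_left L2_inner_cmult_right e sum_distrib_left)
  also have "\<dots> = (\<Sum>j\<in>I. of_real ((cmod (c j))\<^sup>2))"
    using \<open>finite I\<close> by (intro sum.cong refl) (simp add: complex_norm_square mult.commute if_distrib sum.delta cong: if_cong del: of_real_power)
  finally show ?thesis by (simp flip: of_real_sum of_real_power)
qed

text \<open>The squared distance of two partial sums is a difference of partial sums of the
  numerical series, so the Cauchy property carries over; continuity of the inner product preserves
  the coefficients in the limit.\<close>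

lemma L2_Riesz_Fischer:
  assumes e: "\<And>k. e k \<in> L2_space M" "\<And>j k. L2_inner M (e j) (e k) = (if j = k then 1 else 0)"
    and c: "summable (\<lambda>k. (cmod (c k))\<^sup>2)"
  obtains F where "F \<in> L2_space M"
    "(\<lambda>n. L2_norm M (\<lambda>x. (\<Sum>k<n::nat. c k * e k x) - F x)) \<longlonglongrightarrow> 0"
    "\<And>k. L2_inner M (e k) F = c k"
proof -
  define S where "S n x = (\<Sum>k<n. c k * e k x)" for n :: nat and x
  have S: "S n \<in> L2_space M" for n
    unfolding S_def[abs_def] by (intro L2_sum L2_cmult e)
  have Sdiff: "(L2_norm M (\<lambda>x. S m x - S n x))\<^sup>2 = \<bar>(\<Sum>k<m. (cmod (c k))\<^sup>2) - (\<Sum>k<n. (cmod (c k))\<^sup>2)\<bar>" for m n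
  proof -
    have "(L2_norm M (\<lambda>x. S m x - S n x))\<^sup>2 = (\<Sum>k<m. (cmod (c k))\<^sup>2) - (\<Sum>k<n. (cmod (c k))\<^sup>2)"
      if "n \<le> m" for m n
    proof -
      have *: "sum f {..<m} - sum f {..<n} = sum f {n..<m}" for f :: "nat \<Rightarrow> 'z::ab_group_add"
        using sum_diff[of "{..<m}" "{..<n}" f] that by (simp add: lessThan_minus_lessThan)
      show ?thesis unfolding S_def * by (intro L2_ortho_sum_norm e) simp
    qed
    note le = this
    have comm: "L2_norm M (\<lambda>x. S m x - S n x) = L2_norm M (\<lambda>x. S n x - S m x)"
      by (simp add: L2_norm_def norm_minus_commute)
    show ?thesis
    proof (cases "n \<le> m")
      case True
      then show ?thesis using le[OF True] by (metis abs_of_nonneg zero_le_power2)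
    next
      case False
      then have "m \<le> n" by simp
      from le[OF this] show ?thesis unfolding comm
        by (metis abs_minus_commute abs_of_nonneg zero_le_power2)
    qed
  qed
  have "Cauchy (\<lambda>n. \<Sum>k<n. (cmod (c k))\<^sup>2)"
    using c by (intro convergent_Cauchy) (simp add: summable_iff_convergent)
  have "\<exists>N. \<forall>m\<ge>N. \<forall>n\<ge>N. L2_norm M (\<lambda>x. S m x - S n x) < d" if "d > 0" for d
  proof -
    from \<open>Cauchy _\<close> obtain N where N: "\<forall>m\<ge>N. \<forall>n\<ge>N. norm ((\<Sum>k<m. (cmod (c k))\<^sup>2) - (\<Sum>k<n. (cmod (c k))\<^sup>2)) < d\<^sup>2"
      using \<open>d > 0\<close> by (meson CauchyD zero_less_power)
    have "L2_norm M (\<lambda>x. S m x - S n x) < d" if "m \<ge> N" "n \<ge> N" for m n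
    proof -
      have "(L2_norm M (\<lambda>x. S m x - S n x))\<^sup>2 < d\<^sup>2" using N that by (simp add: Sdiff)
      then show ?thesis using \<open>d > 0\<close> by (simp add: power2_less_imp_less)
    qed
    then show ?thesis by blast
  qed
  from L2_complete[OF S this] obtain F where F: "F \<in> L2_space M"
    and lim: "(\<lambda>n. L2_norm M (\<lambda>x. S n x - F x)) \<longlonglongrightarrow> 0" by blast
  have "L2_inner M (e j) F = c j" for j
  proof -
    have "(\<lambda>n. L2_inner M (e j) (S n) - L2_inner M (e j) F) \<longlonglongrightarrow> 0"
    proof (rule Lim_null_comparison[OF _ lim])
      have ej: "L2_norm M (e j) = 1"
      proof -
        have "complex_of_real ((L2_norm M (e j))\<^sup>2) = 1" using e(2)[of j j] L2_inner_self[of M "e j"] by simp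
        then have "(L2_norm M (e j))\<^sup>2 = 1" by (metis of_real_eq_1_iff)
        then show ?thesis by (simp add: power2_eq_1_iff) (smt (verit) L2_norm_nonneg)
      qed
      show "\<forall>\<^sub>F n in sequentially. norm (L2_inner M (e j) (S n) - L2_inner M (e j) F)
          \<le> L2_norm M (\<lambda>x. S n x - F x)"
        using L2_Cauchy_Schwarz[OF e(1)[of j] L2_diff[OF S F]]
        by (intro always_eventually) (simp add: L2_inner_diff_right e F S ej)
    qed
    then have "(\<lambda>n. L2_inner M (e j) (S n)) \<longlonglongrightarrow> L2_inner M (e j) F" by (simp add: LIM_zero_iff)
    moreover have "(\<lambda>n. L2_inner M (e j) (S n)) \<longlonglongrightarrow> c j"
    proof (rule tendsto_eventually, rule eventually_sequentiallyI[of "Suc j"])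
      fix n assume "Suc j \<le> n"
      then show "L2_inner M (e j) (S n) = c j"
        unfolding S_def[abs_def]
        by (simp add: L2_inner_sum_right e L2_cmult L2_inner_cmult_right if_distrib sum.delta cong: if_cong)
    qed
    ultimately show ?thesis by (rule LIMSEQ_unique)
  qed
  with F lim show ?thesis unfolding S_def by (rule that)
qed

lemma L2_orthonormal_basisD:
  assumes "L2_orthonormal_basis M e"
  shows "e k \<in> L2_space M" "L2_inner M (e j) (e k) = (if j = k then 1 else 0)"
    "f \<in> L2_space M \<Longrightarrow> (\<And>k. L2_inner M (e k) f = 0) \<Longrightarrow> AE x in M. f x = 0"
  using assms unfolding L2_orthonormal_basis_def by auto

lemma L2_Bessel:
  assumes e: "L2_orthonormal_basis M e" and f: "f \<in> L2_space M"
  shows "(\<Sum>k<n. (cmod (L2_inner M (e k) f))\<^sup>2) \<le> (L2_norm M f)\<^sup>2"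
proof -
  note e = L2_orthonormal_basisD[OF e]
  define c where "c k = L2_inner M (e k) f" for k
  define S where "S x = (\<Sum>k<n. c k * e k x)" for x
  have S: "S \<in> L2_space M" unfolding S_def[abs_def] by (intro L2_sum L2_cmult e)
  have "L2_inner M S f = (\<Sum>k<n. complex_of_real ((cmod (c k))\<^sup>2))"
    unfolding S_def[abs_def]
    by (simp add: L2_inner_sum_left f e L2_cmult L2_inner_cmult_left c_def[symmetric] complex_norm_square mult.commute del: of_real_power)
  then have "L2_inner M S f = of_real (\<Sum>k<n. (cmod (c k))\<^sup>2)" by simp
  then have "L2_inner M f S = of_real (\<Sum>k<n. (cmod (c k))\<^sup>2)"
    using L2_inner_cnj[of M f S] by simp
  moreover have "(L2_norm M S)\<^sup>2 = (\<Sum>k<n. (cmod (c k))\<^sup>2)"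
    unfolding S_def[abs_def] by (intro L2_ortho_sum_norm e) simp
  ultimately have "(L2_norm M (\<lambda>x. f x + (-1) * S x))\<^sup>2 = (L2_norm M f)\<^sup>2 - (\<Sum>k<n. (cmod (c k))\<^sup>2)"
    unfolding L2_norm_add_square[OF f S] by simp
  then show ?thesis unfolding c_def by (metis diff_ge_0_iff_ge zero_le_power2)
qed

lemma L2_coefficients_summable:
  assumes e: "L2_orthonormal_basis M e" and f: "f \<in> L2_space M"
  shows "summable (\<lambda>k. (cmod (L2_inner M (e k) f))\<^sup>2)"
  by (rule summableI_nonneg_bounded[OF _ L2_Bessel[OF e f]]) simp

text \<open>The function supplied by Riesz and Fischer has the same coefficients as
  \<open>f\<close>, and the totality clause of an orthonormal basis forces the two to agree almost
  everywhere.\<close>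

lemma L2_expansion:
  assumes e: "L2_orthonormal_basis M e" and f: "f \<in> L2_space M"
  shows "(\<lambda>n. L2_norm M (\<lambda>x. (\<Sum>k<n. L2_inner M (e k) f * e k x) - f x)) \<longlonglongrightarrow> 0"
proof -
  note eD = L2_orthonormal_basisD[OF e]
  obtain F where F: "F \<in> L2_space M"
    "(\<lambda>n. L2_norm M (\<lambda>x. (\<Sum>k<n. L2_inner M (e k) f * e k x) - F x)) \<longlonglongrightarrow> 0"
    "\<And>k. L2_inner M (e k) F = L2_inner M (e k) f"
    using L2_Riesz_Fischer[OF eD(1,2) L2_coefficients_summable[OF e f]] by blast
  have "AE x in M. F x - f x = 0"
    by (rule eD(3)) (auto simp: F f L2_diff L2_inner_diff_right eD)
  then have "L2_norm M (\<lambda>x. (\<Sum>k<n. L2_inner M (e k) f * e k x) - F x) =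
      L2_norm M (\<lambda>x. (\<Sum>k<n. L2_inner M (e k) f * e k x) - f x)" for n
    using F f eD(1)
    by (intro L2_norm_cong_AE borel_measurable_diff borel_measurable_sum borel_measurable_times) auto
  then show ?thesis using F(2) by simp
qed

lemma L2_inner_tendsto:
  assumes "g \<in> L2_space M" "F \<in> L2_space M" "\<And>n. S n \<in> L2_space M"
    and "(\<lambda>n. L2_norm M (\<lambda>x. S n x - F x)) \<longlonglongrightarrow> 0"
  shows "(\<lambda>n. L2_inner M g (S n)) \<longlonglongrightarrow> L2_inner M g F"
proof (rule LIM_zero_cancel, rule Lim_null_comparison)
  show "(\<lambda>n. L2_norm M g * L2_norm M (\<lambda>x. S n x - F x)) \<longlonglongrightarrow> 0"
    using tendsto_mult_left[OF assms(4), of "L2_norm M g"] by simp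
  show "\<forall>\<^sub>F n in sequentially. norm (L2_inner M g (S n) - L2_inner M g F) \<le> L2_norm M g * L2_norm M (\<lambda>x. S n x - F x)"
    using L2_Cauchy_Schwarz[OF assms(1) L2_diff[OF assms(3,2)]]
    by (intro always_eventually) (simp add: L2_inner_diff_right assms)
qed

lemma L2_Parseval_inner:
  assumes e: "L2_orthonormal_basis M e" and f: "f \<in> L2_space M" and g: "g \<in> L2_space M"
  shows "(\<lambda>k. L2_inner M g (e k) * L2_inner M (e k) f) sums L2_inner M g f"
proof -
  note eD = L2_orthonormal_basisD[OF e]
  have "(\<lambda>n. L2_inner M g (\<lambda>x. \<Sum>k<n. L2_inner M (e k) f * e k x)) \<longlonglongrightarrow> L2_inner M g f"
    by (intro L2_inner_tendsto g f L2_expansion e L2_sum L2_cmult eD)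
  moreover have "L2_inner M g (\<lambda>x. \<Sum>k<n. L2_inner M (e k) f * e k x) =
      (\<Sum>k<n. L2_inner M g (e k) * L2_inner M (e k) f)" for n
    by (simp add: L2_inner_sum_right g L2_cmult eD L2_inner_cmult_right) (simp add: mult.commute)
  ultimately show ?thesis unfolding sums_def by simp
qed

lemma L2_Parseval:
  assumes e: "L2_orthonormal_basis M e" and f: "f \<in> L2_space M"
  shows "(\<lambda>k. (cmod (L2_inner M (e k) f))\<^sup>2) sums (L2_norm M f)\<^sup>2"
proof -
  have *: "L2_inner M f (e k) * L2_inner M (e k) f = complex_of_real ((cmod (L2_inner M (e k) f))\<^sup>2)" for k
    unfolding complex_norm_square L2_inner_cnj[of M f "e k"] by (rule mult.commute)
  show ?thesis
    using L2_Parseval_inner[OF e f f] unfolding * L2_inner_self sums_of_real_iff .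
qed

lemma summable_mult_of_square_summable:
  fixes a b :: "nat \<Rightarrow> complex"
  assumes "summable (\<lambda>k. (cmod (a k))\<^sup>2)" "summable (\<lambda>k. (cmod (b k))\<^sup>2)"
  shows "summable (\<lambda>k. cmod (a k * b k))"
proof (rule summable_comparison_test'[where N = 0])
  show "summable (\<lambda>k. (cmod (a k))\<^sup>2 + (cmod (b k))\<^sup>2)" using assms by (rule summable_add)
  fix k
  have "2 * cmod (a k) * cmod (b k) \<le> (cmod (a k))\<^sup>2 + (cmod (b k))\<^sup>2"
    by (rule sum_squares_bound)
  moreover have "0 \<le> cmod (a k) * cmod (b k)" by simp
  ultimately have "cmod (a k) * cmod (b k) \<le> (cmod (a k))\<^sup>2 + (cmod (b k))\<^sup>2" by linarith
  then show "norm (cmod (a k * b k)) \<le> (cmod (a k))\<^sup>2 + (cmod (b k))\<^sup>2" by (simp add: norm_mult)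
qed

section \<open>Positive operators and their spectrum\<close>

text \<open>The factor \<open>1 * f x\<close> keeps the argument in the literal shape a f + b g of
  the linearity clause, which holds only almost everywhere.\<close>

lemma L2_positive_form_quadratic:
  assumes T: "L2_bounded_operator M T" and herm: "L2_hermitian M T"
    and f: "f \<in> L2_space M" and g: "g \<in> L2_space M"
  shows "L2_inner M (\<lambda>x. 1 * f x + z * g x) (T (\<lambda>x. 1 * f x + z * g x)) =
    L2_inner M f (T f) + z * L2_inner M f (T g) + cnj (z * L2_inner M f (T g))
      + z * cnj z * L2_inner M g (T g)"
proof -
  let ?h = "\<lambda>x. 1 * f x + z * g x"
  have TL: "\<And>u. u \<in> L2_space M \<Longrightarrow> T u \<in> L2_space M"
    and lin: "AE x in M. T ?h x = 1 * T f x + z * T g x"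
    using T f g unfolding L2_bounded_operator_def by blast+
  have zg: "(\<lambda>x. z * g x) \<in> L2_space M" and h: "?h \<in> L2_space M"
    using L2_add[OF f L2_cmult[OF g]] L2_cmult[OF g] by auto
  have zTg: "(\<lambda>x. z * T g x) \<in> L2_space M" by (intro L2_cmult TL g)
  have hT: "(\<lambda>x. 1 * T f x + z * T g x) \<in> L2_space M"
    using L2_add[OF TL[OF f] zTg] by simp
  have "L2_inner M ?h (T ?h) = L2_inner M ?h (\<lambda>x. 1 * T f x + z * T g x)"
    using lin by (intro L2_inner_cong_AE L2_space_measurable h TL hT)
  also have "\<dots> = L2_inner M f (T f) + z * L2_inner M f (T g) + cnj z * L2_inner M g (T f)
      + z * cnj z * L2_inner M g (T g)"
    by (simp add: L2_inner_add_right L2_inner_add_left f g zg zTg TL L2_add L2_inner_cmult_right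
        L2_inner_cmult_left algebra_simps)
  also have "L2_inner M g (T f) = cnj (L2_inner M f (T g))"
    using herm f g unfolding L2_hermitian_def by (metis L2_inner_cnj)
  finally show ?thesis by simp
qed

lemma L2_positiveD:
  assumes "L2_positive M T" "f \<in> L2_space M"
  shows "0 \<le> Re (L2_inner M f (T f))" "L2_inner M f (T f) = of_real (Re (L2_inner M f (T f)))"
  using assms unfolding L2_positive_def nonneg_Reals_def by (auto simp: complex_eq_iff)

lemma L2_positive_form_Cauchy_Schwarz:
  assumes T: "L2_bounded_operator M T" and herm: "L2_hermitian M T" and pos: "L2_positive M T"
    and f: "f \<in> L2_space M" and g: "g \<in> L2_space M"
  shows "(cmod (L2_inner M f (T g)))\<^sup>2 \<le> Re (L2_inner M f (T f)) * Re (L2_inner M g (T g))"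
proof (rule cmod_square_le_if_quadratic_nonneg)
  fix z
  have "(\<lambda>x. 1 * f x + z * g x) \<in> L2_space M" using L2_add[OF f L2_cmult[OF g]] by simp
  from L2_positiveD(1)[OF pos this] have "0 \<le> Re (L2_inner M f (T f) + z * L2_inner M f (T g) + cnj (z * L2_inner M f (T g))
      + z * cnj z * L2_inner M g (T g))"
    unfolding L2_positive_form_quadratic[OF T herm f g] .
  then show "0 \<le> Re (L2_inner M f (T f)) + 2 * Re (z * L2_inner M f (T g)) + (cmod z)\<^sup>2 * Re (L2_inner M g (T g))"
    by (simp add: complex_norm_square[symmetric] del: of_real_power)
qed

section \<open>The operator norm and its relation to the quadratic form\<close>

lemma L2_op_norm_bdd:
  assumes "L2_bounded_operator M T"
  shows "bdd_above ((\<lambda>f. L2_norm M (T f)) ` {f \<in> L2_space M. L2_norm M f \<le> 1})"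
proof -
  obtain C where C: "\<forall>f\<in>L2_space M. L2_norm M (T f) \<le> C * L2_norm M f"
    using assms unfolding L2_bounded_operator_def by blast
  show ?thesis
  proof (rule bdd_aboveI2[where M = "max C 0"])
    fix f assume "f \<in> {f \<in> L2_space M. L2_norm M f \<le> 1}"
    then have "L2_norm M (T f) \<le> C * L2_norm M f" "0 \<le> L2_norm M f" "L2_norm M f \<le> 1" using C by auto
    moreover have "C * L2_norm M f \<le> max C 0 * L2_norm M f" by (rule mult_right_mono) auto
    moreover have "max C 0 * L2_norm M f \<le> max C 0 * 1" using \<open>L2_norm M f \<le> 1\<close> by (intro mult_left_mono) auto
    ultimately show "L2_norm M (T f) \<le> max C 0" by linarith
  qed
qed

lemma L2_op_norm_upper:
  assumes "L2_bounded_operator M T" "f \<in> L2_space M" "L2_norm M f \<le> 1"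
  shows "L2_norm M (T f) \<le> L2_op_norm M T"
  unfolding L2_op_norm_def by (rule cSUP_upper[OF _ L2_op_norm_bdd]) (use assms in auto)

lemma L2_op_norm_nonneg:
  assumes "L2_bounded_operator M T"
  shows "0 \<le> L2_op_norm M T"
proof -
  have "L2_norm M (T (\<lambda>x. 0)) \<le> L2_op_norm M T"
    by (rule L2_op_norm_upper[OF assms L2_zero]) (simp add: L2_norm_def)
  then show ?thesis using L2_norm_nonneg order_trans by blast
qed

lemma L2_op_norm_bound:
  assumes T: "L2_bounded_operator M T" and f: "f \<in> L2_space M"
  shows "L2_norm M (T f) \<le> L2_op_norm M T * L2_norm M f"
proof (cases "L2_norm M f = 0")
  case True
  then show ?thesis using T f unfolding L2_bounded_operator_def by (metis mult_zero_right)
next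
  case False
  then have n: "L2_norm M f > 0" using L2_norm_nonneg[of M f] by linarith
  define a where "a = complex_of_real (1 / L2_norm M f)"
  have TL: "\<And>u. u \<in> L2_space M \<Longrightarrow> T u \<in> L2_space M"
    and lin: "AE x in M. T (\<lambda>y. a * f y + 0 * f y) x = a * T f x + 0 * T f x"
    using T f unfolding L2_bounded_operator_def by blast+
  have "L2_norm M (T (\<lambda>y. a * f y)) = L2_norm M (\<lambda>x. a * T f x)"
    using lin by (intro L2_norm_cong_AE L2_space_measurable TL L2_cmult f) simp
  also have "\<dots> = L2_norm M (T f) / L2_norm M f" using n by (subst L2_norm_cmult) (simp add: a_def norm_divide)
  finally have "L2_norm M (T f) / L2_norm M f = L2_norm M (T (\<lambda>y. a * f y))" by simp
  also have "\<dots> \<le> L2_op_norm M T"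
    using n by (intro L2_op_norm_upper T L2_cmult f, subst L2_norm_cmult) (simp add: a_def norm_divide)
  finally show ?thesis using n by (simp add: field_simps)
qed

text \<open>This is T^2 \<le> R T for a positive operator. Cauchy-Schwarz for the form of
  \<open>T\<close>, applied to \<open>f\<close> and \<open>T f\<close>, gives |T f|^4 \<le> <f, T f>
  <T f, T T f>, and the last factor is at most R |T f|^2. No square root of \<open>T\<close> is
  taken.\<close>

lemma L2_norm_square_le_op_norm_form:
  assumes T: "L2_bounded_operator M T" and herm: "L2_hermitian M T" and pos: "L2_positive M T"
    and f: "f \<in> L2_space M"
  shows "(L2_norm M (T f))\<^sup>2 \<le> L2_op_norm M T * Re (L2_inner M f (T f))"
proof (cases "L2_norm M (T f) = 0")
  case True
  then show ?thesis using L2_op_norm_nonneg[OF T] L2_positiveD(1)[OF pos f] by simp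
next
  case False
  define n R q where "n = L2_norm M (T f)" and "R = L2_op_norm M T" and "q = Re (L2_inner M f (T f))"
  have n: "n > 0" unfolding n_def using False L2_norm_nonneg[of M "T f"] by linarith
  have Tf: "T f \<in> L2_space M" and TTf: "T (T f) \<in> L2_space M"
    using T f unfolding L2_bounded_operator_def by blast+
  have "L2_inner M f (T (T f)) = of_real (n\<^sup>2)"
    using herm f Tf unfolding L2_hermitian_def n_def L2_inner_self[symmetric] by blast
  then have "(n\<^sup>2)\<^sup>2 = (cmod (L2_inner M f (T (T f))))\<^sup>2" by (simp add: norm_power)
  also have "\<dots> \<le> q * Re (L2_inner M (T f) (T (T f)))"
    unfolding q_def by (intro L2_positive_form_Cauchy_Schwarz T herm pos f Tf)
  also have "Re (L2_inner M (T f) (T (T f))) \<le> n * (R * n)"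
  proof -
    have "Re (L2_inner M (T f) (T (T f))) \<le> n * L2_norm M (T (T f))"
      using L2_Cauchy_Schwarz[OF Tf TTf] complex_Re_le_cmod order_trans unfolding n_def by blast
    also have "\<dots> \<le> n * (R * n)"
      unfolding n_def R_def by (intro mult_left_mono L2_op_norm_bound T Tf) simp
    finally show ?thesis .
  qed
  then have "q * Re (L2_inner M (T f) (T (T f))) \<le> q * (n * (R * n))"
    using L2_positiveD(1)[OF pos f] by (intro mult_left_mono) (auto simp: q_def)
  finally have "n\<^sup>2 * n\<^sup>2 \<le> n\<^sup>2 * (R * q)" by (simp add: power2_eq_square algebra_simps)
  then have "n\<^sup>2 \<le> R * q" by (rule mult_left_le_imp_le) (use n in simp)
  then show ?thesis by (simp add: n_def R_def q_def)
qed

text \<open>If the operator norm \<open>R\<close> were not in the spectrum, \<open>T - R\<close> would be bounded below by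
  some \<open>1/C\<close>. As \<open>\<parallel>T f - R f\<parallel>\<^sup>2 \<le> R\<^sup>2 - \<parallel>T f\<parallel>\<^sup>2\<close> for unit vectors, \<open>\<parallel>T f\<parallel>\<close> would then stay away
  from \<open>R\<close>.\<close>

lemma L2_op_norm_in_spectrum:
  assumes T: "L2_bounded_operator M T" and herm: "L2_hermitian M T" and pos: "L2_positive M T"
    and R: "L2_op_norm M T > 0"
  shows "complex_of_real (L2_op_norm M T) \<in> L2_spectrum M T"
proof (rule ccontr)
  define R where "R = L2_op_norm M T"
  assume "complex_of_real (L2_op_norm M T) \<notin> L2_spectrum M T"
  then obtain S where S: "L2_bounded_operator M S"
    and inv: "\<And>f. f \<in> L2_space M \<Longrightarrow> AE x in M. S (\<lambda>y. T f y - of_real R * f y) x = f x"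
    unfolding L2_spectrum_def R_def by blast
  define C where "C = L2_op_norm M S"
  have C0: "C \<ge> 0" unfolding C_def by (rule L2_op_norm_nonneg[OF S])
  have R0: "R > 0" using R by (simp add: R_def)
  \<comment> \<open>With t = |T f|^2 the estimates combine to t \<le> q (R^2 - t). Solved for t this
    reads t \<le> R^2 q / (1 + q), a bound strictly below R^2 that is uniform in
    \<open>f\<close>.\<close>
  define q where "q = R\<^sup>2 * C\<^sup>2"
  have q0: "q \<ge> 0" by (simp add: q_def)
  have key: "(L2_norm M (T f))\<^sup>2 \<le> R\<^sup>2 * (q / (1 + q))" if f: "f \<in> L2_space M" and f1: "L2_norm M f \<le> 1" for f
  proof -
    define t where "t = (L2_norm M (T f))\<^sup>2"
    have Tf: "T f \<in> L2_space M" using T f unfolding L2_bounded_operator_def by blast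
    define h where "h y = T f y - of_real R * f y" for y
    have h: "h \<in> L2_space M" unfolding h_def[abs_def] by (intro L2_diff L2_cmult Tf f)
    have Sh: "S h \<in> L2_space M" using S h unfolding L2_bounded_operator_def by blast
    have "L2_norm M f = L2_norm M (S h)"
      using inv[OF f] unfolding h_def[abs_def, symmetric]
      by (intro L2_norm_cong_AE L2_space_measurable f Sh) auto
    also have "\<dots> \<le> C * L2_norm M h" unfolding C_def by (rule L2_op_norm_bound[OF S h])
    finally have fh: "(L2_norm M f)\<^sup>2 \<le> C\<^sup>2 * (L2_norm M h)\<^sup>2"
      by (metis power_mono power_mult_distrib L2_norm_nonneg)
    \<comment> \<open>The expansion subtracts R <f, T f> twice, each copy at least t, so that R^2 +
      t - 2 t remains.\<close>
    have "(L2_norm M h)\<^sup>2 = t + 2 * Re (- of_real R * L2_inner M (T f) f) + R\<^sup>2 * (L2_norm M f)\<^sup>2"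
      using L2_norm_add_square[OF Tf f, of "- of_real R"] by (simp add: h_def[abs_def] t_def)
    also have "Re (- of_real R * L2_inner M (T f) f) = - (R * Re (L2_inner M f (T f)))"
      using L2_inner_cnj[of M "T f" f] by simp
    also have "R\<^sup>2 * (L2_norm M f)\<^sup>2 \<le> R\<^sup>2 * 1\<^sup>2" using f1 by (intro mult_left_mono power_mono) auto
    also have "t \<le> R * Re (L2_inner M f (T f))"
      unfolding t_def R_def by (rule L2_norm_square_le_op_norm_form[OF T herm pos f])
    finally have hn: "(L2_norm M h)\<^sup>2 \<le> R\<^sup>2 - t"
      using L2_norm_square_le_op_norm_form[OF T herm pos f] by (simp add: t_def R_def)
    have "t \<le> (R * L2_norm M f)\<^sup>2"
      unfolding t_def R_def by (intro power_mono L2_op_norm_bound T f) simp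
    also have "\<dots> = R\<^sup>2 * (L2_norm M f)\<^sup>2" by (simp add: power_mult_distrib)
    also have "\<dots> \<le> R\<^sup>2 * (C\<^sup>2 * (R\<^sup>2 - t))"
      using fh mult_left_mono[OF hn, of "C\<^sup>2"] by (intro mult_left_mono) auto
    also have "\<dots> = q * R\<^sup>2 - q * t" by (simp add: q_def algebra_simps)
    finally have "t * (1 + q) \<le> R\<^sup>2 * q" by (simp add: algebra_simps)
    then show ?thesis using q0 by (simp add: t_def[symmetric] field_simps)
  qed
  \<comment> \<open>The supremum over the unit ball bounds \<open>R\<close> by a proper fraction of
    itself.\<close>
  have "R \<le> R * sqrt (q / (1 + q))"
    unfolding R_def L2_op_norm_def
  proof (rule cSUP_least)
    show "{f \<in> L2_space M. L2_norm M f \<le> 1} \<noteq> {}"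
      using L2_zero[of M] by (auto intro!: exI[of _ "\<lambda>x. 0"] simp: L2_norm_def)
    fix f assume "f \<in> {f \<in> L2_space M. L2_norm M f \<le> 1}"
    then have "(L2_norm M (T f))\<^sup>2 \<le> R\<^sup>2 * (q / (1 + q))" by (intro key) auto
    then have "sqrt ((L2_norm M (T f))\<^sup>2) \<le> sqrt (R\<^sup>2 * (q / (1 + q)))" by (rule real_sqrt_le_mono)
    then have "L2_norm M (T f) \<le> R * sqrt (q / (1 + q))"
      using R0 unfolding real_sqrt_mult by simp
    then show "L2_norm M (T f) \<le> Sup ((\<lambda>f. L2_norm M (T f)) ` {f \<in> L2_space M. L2_norm M f \<le> 1}) * sqrt (q / (1 + q))"
      by (simp only: R_def L2_op_norm_def)
  qed
  then have "1 \<le> sqrt (q / (1 + q))" using R0 by simp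
  then have "1 \<le> q / (1 + q)" by simp
  then show False using q0 by (simp add: field_simps)
qed

lemma L2_inner_mult_indicator:
  "L2_inner M f (\<lambda>x. indicator B x * g x) = L2_inner M (\<lambda>x. indicator B x * f x) g"
  unfolding L2_inner_def by (intro Bochner_Integration.integral_cong refl) (auto simp: indicator_def)

section \<open>Locally Hilbert--Schmidt kernels\<close>

lemma L2_bounded_operatorD:
  assumes "L2_bounded_operator M T"
  shows "f \<in> L2_space M \<Longrightarrow> T f \<in> L2_space M"
    "f \<in> L2_space M \<Longrightarrow> g \<in> L2_space M \<Longrightarrow>
      AE x in M. T (\<lambda>y. a * f y + b * g y) x = a * T f x + b * T g x"
  using assms unfolding L2_bounded_operator_def by auto

lemma L2_bounded_operator_sum:
  assumes T: "L2_bounded_operator M T" and g: "\<And>k. g k \<in> L2_space M"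
  shows "AE x in M. T (\<lambda>y. \<Sum>k<n::nat. c k * g k y) x = (\<Sum>k<n. c k * T (g k) x)"
proof (induction n)
  case 0
  have "AE x in M. T (\<lambda>y. 0 * g 0 y + 0 * g 0 y) x = 0 * T (g 0) x + 0 * T (g 0) x"
    by (intro L2_bounded_operatorD[OF T] g)
  then show ?case by simp
next
  case (Suc n)
  have "(\<lambda>y. \<Sum>k<n. c k * g k y) \<in> L2_space M" by (intro L2_sum L2_cmult g)
  then have "AE x in M. T (\<lambda>y. 1 * (\<Sum>k<n. c k * g k y) + c n * g n y) x =
      1 * T (\<lambda>y. \<Sum>k<n. c k * g k y) x + c n * T (g n) x"
    by (intro L2_bounded_operatorD[OF T] g)
  with Suc show ?case by eventually_elim simp
qed

lemma L2_bounded_operator_diff: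
  assumes T: "L2_bounded_operator M T" and "f \<in> L2_space M" "g \<in> L2_space M"
  shows "AE x in M. T (\<lambda>y. f y - g y) x = T f x - T g x"
proof -
  have "AE x in M. T (\<lambda>y. 1 * f y + (-1) * g y) x = 1 * T f x + (-1) * T g x"
    by (intro L2_bounded_operatorD[OF T] assms)
  then show ?thesis by simp
qed

text \<open>Dynkin's argument: the sets over which \<open>q\<close> integrates to zero contain the
  generator and are closed under complements and countable disjoint unions. Complements are handled
  through the whole space, which is why it has to belong to \<open>G\<close>.\<close>

lemma AE_eq_0_if_integral_zero_on_generator:
  fixes q :: "'a \<Rightarrow> complex"
  assumes "sigma_finite_measure M" and q: "integrable M q"
    and G: "Int_stable G" "G \<subseteq> Pow (space M)" "sets M = sigma_sets (space M) G" "space M \<in> G"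
    and zero: "\<And>C. C \<in> G \<Longrightarrow> (LINT x:C|M. q x) = 0"
  shows "AE x in M. q x = 0"
proof (rule sigma_finite_measure.density_zero[OF assms(1) q])
  fix A assume "A \<in> sets M"
  then have "A \<in> sigma_sets (space M) G" using G by simp
  with G(1,2) show "(LINT x:A|M. q x) = 0"
  proof (induction rule: sigma_sets_induct_disjoint)
    case (basic A)
    then show ?case by (rule zero)
  next
    case empty
    show ?case by (simp add: set_lebesgue_integral_def)
  next
    case (compl A)
    have A: "A \<in> sets M" using compl G by simp
    have "(LINT x:A \<union> (space M - A)|M. q x) = (LINT x:A|M. q x) + (LINT x:space M - A|M. q x)"
      using A q by (intro set_integral_Un) (auto simp: set_integrable_def intro!: integrable_mult_indicator)
    moreover have "A \<union> (space M - A) = space M" using sets.sets_into_space[OF A] by auto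
    ultimately show ?case using compl zero[OF G(4)] by simp
  next
    case (union A)
    have A: "A i \<in> sets M" for i using union G by auto
    have "(LINT x:(\<Union>i. A i)|M. q x) = (\<Sum>i. (LINT x:(A i)|M. q x))"
    proof (rule lebesgue_integral_countable_add)
      show "set_integrable M (\<Union>i. A i) q"
        using A q by (auto simp: set_integrable_def intro!: integrable_mult_indicator)
      show "i \<noteq> j \<Longrightarrow> A i \<inter> A j = {}" for i j
        using union(1) by (auto simp: disjoint_family_on_def)
    qed (rule A)
    then show ?case using union by simp
  qed
qed

text \<open>Finite intersections of a countable basis. Countability lets one null set serve all test
  sets, stability under intersection serves Dynkin's argument, and the intersection of the empty
  family supplies \<open>UNIV\<close>.\<close>

lemma countable_borel_generator:
  obtains G :: "'a::second_countable_topology set set"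
  where "countable G" "Int_stable G" "UNIV \<in> G" "sets borel = sigma_sets UNIV G"
proof -
  obtain B :: "'a set set" where B: "countable B" "topological_basis B"
    using ex_countable_basis by blast
  define G where "G = Inter ` {S. S \<subseteq> B \<and> finite S}"
  have "countable {S. S \<subseteq> B \<and> finite S}"
    using countable_Collect_finite_subset[OF B(1)] by (simp add: conj_commute)
  then have 1: "countable G" by (simp add: G_def)
  have 2: "Int_stable G"
  proof (rule Int_stableI)
    fix a b assume "a \<in> G" "b \<in> G"
    then obtain S S' where "S \<subseteq> B" "finite S" "a = \<Inter>S" "S' \<subseteq> B" "finite S'" "b = \<Inter>S'"
      by (auto simp: G_def)
    then have "a \<inter> b = \<Inter>(S \<union> S')" "S \<union> S' \<subseteq> B" "finite (S \<union> S')" by auto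
    then show "a \<inter> b \<in> G" unfolding G_def by blast
  qed
  have 3: "UNIV \<in> G" unfolding G_def by (rule image_eqI[of _ _ "{}"]) auto
  have "B \<subseteq> G"
  proof
    fix b assume "b \<in> B"
    then show "b \<in> G" unfolding G_def by (intro image_eqI[of _ _ "{b}"]) auto
  qed
  have "open g" if "g \<in> G" for g
    using that topological_basis_open[OF B(2)] by (auto simp: G_def intro!: open_Inter)
  then have "sigma_sets UNIV G \<subseteq> sets borel"
    by (intro sigma_algebra.sigma_sets_subset) (auto simp: sets.sigma_algebra_axioms[of borel, simplified])
  moreover have "sets borel = sigma_sets UNIV B"
    using borel_eq_countable_basis[OF B] by (metis Pow_UNIV sets_measure_of top_greatest)
  moreover have "sigma_sets UNIV B \<subseteq> sigma_sets UNIV G" by (rule sigma_sets_mono') fact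
  ultimately have "sets borel = sigma_sets UNIV G" by blast
  from that[OF 1 2 3 this] show ?thesis .
qed

text \<open>Only compact sets may be tested, while the set where \<open>g\<close> is negative is
  merely Borel. Inner regularity closes the gap: for the finite measure whose density is the
  negative part, that set is exhausted by compact subsets, and each of them has measure
  zero.\<close>

lemma AE_nonneg_if_compact_integrals_nonneg:
  fixes g :: "'a::euclidean_space \<Rightarrow> real"
  assumes sets: "sets M = sets borel" and fin: "\<And>B. compact B \<Longrightarrow> emeasure M B < \<infinity>"
    and g: "\<And>B. compact B \<Longrightarrow> set_integrable M B g" "g \<in> borel_measurable M"
    and pos: "\<And>B. compact B \<Longrightarrow> 0 \<le> (LINT x:B|M. g x)"
  shows "AE x in M. 0 \<le> g x"
proof -
  \<comment> \<open>Restriction to a ball makes the negative part integrable; inner regularity needs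
    a finite measure.\<close>
  have "AE x in M. x \<in> cball 0 (real n) \<longrightarrow> 0 \<le> g x" for n :: nat
  proof -
    define D where "D = cball (0::'a) (real n)"
    define h where "h x = indicator D x *\<^sub>R g x" for x
    have "compact D" by (simp add: D_def)
    have h: "integrable M h" using g(1)[OF \<open>compact D\<close>] by (simp add: set_integrable_def h_def[abs_def])
    have hm [measurable]: "h \<in> borel_measurable M" using h by auto
    define A where "A = {x \<in> D. g x < 0}"
    have Dm: "D \<in> sets M" by (simp add: D_def sets)
    have A: "A \<in> sets M"
    proof -
      have "A = {x \<in> space M. x \<in> D \<and> g x < 0}" using sets_eq_imp_space_eq[OF sets] by (auto simp: A_def)
      also have "\<dots> \<in> sets M" using Dm g(2) by measurable
      finally show ?thesis .
    qed
    \<comment> \<open>\<open>ennreal\<close> cuts negative values to zero, so this density is the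
      negative part of \<open>h\<close>.\<close>
    define N where "N = density M (\<lambda>x. ennreal (- h x))"
    have "finite_measure N"
    proof (rule finite_measureI)
      have "emeasure N (space N) = (\<integral>\<^sup>+x. ennreal (- h x) \<partial>M)"
        by (auto simp: N_def emeasure_density intro!: nn_integral_cong)
      also have "\<dots> \<noteq> \<infinity>" using h unfolding real_integrable_def by blast
      finally show "emeasure N (space N) \<noteq> \<infinity>" .
    qed
    have setsN: "sets N = sets borel" by (simp add: N_def sets)
    have "emeasure N A = (SUP C\<in>{C. C \<subseteq> A \<and> compact C}. emeasure N C)"
    proof (rule inner_regular)
      show "sets N = sets borel" by (rule setsN)
      show "emeasure N (space N) \<noteq> \<infinity>" using \<open>finite_measure N\<close> by (simp add: finite_measure.emeasure_finite)
      show "A \<in> sets borel" using A sets by simp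
    qed
    also have "\<dots> \<le> 0"
    proof (rule SUP_least)
      fix C assume "C \<in> {C. C \<subseteq> A \<and> compact C}"
      then have C: "C \<subseteq> A" "compact C" by auto
      then have Cm: "C \<in> sets M" by (simp add: sets borel_compact)
      have CD: "C \<subseteq> D" using C A_def by auto
      have gC: "integrable M (\<lambda>x. indicator C x * g x)"
        using g(1)[OF C(2)] by (simp add: set_integrable_def)
      have "emeasure N C = (\<integral>\<^sup>+x. ennreal (- h x) * indicator C x \<partial>M)"
        by (simp add: N_def emeasure_density Cm)
      also have "\<dots> = (\<integral>\<^sup>+x. ennreal (- (indicator C x * g x)) \<partial>M)"
        using CD by (intro nn_integral_cong) (auto simp: h_def indicator_def)
      also have "\<dots> = ennreal (\<integral>x. - (indicator C x * g x) \<partial>M)"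
        using C A_def gC by (intro nn_integral_eq_integral) (auto simp: indicator_def intro!: AE_I2)
      also have "(\<integral>x. - (indicator C x * g x) \<partial>M) \<le> 0"
        using pos[OF C(2)] by (simp add: set_lebesgue_integral_def)
      then have "ennreal (\<integral>x. - (indicator C x * g x) \<partial>M) \<le> 0" by (simp add: ennreal_neg)
      finally show "emeasure N C \<le> 0" .
    qed
    finally have "emeasure N A = 0" by simp
    then have "(\<integral>\<^sup>+x. ennreal (- h x) * indicator A x \<partial>M) = 0"
      by (simp add: N_def emeasure_density A)
    then have "AE x in M. ennreal (- h x) * indicator A x = 0"
      using A by (subst (asm) nn_integral_0_iff_AE) auto
    then show ?thesis
    proof eventually_elim
      case (elim x)
      show ?case
      proof
        assume "x \<in> cball 0 (real n)"
        then have "x \<in> D" by (simp add: D_def)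
        show "0 \<le> g x"
        proof (rule ccontr)
          assume "\<not> 0 \<le> g x"
          then have "x \<in> A" using \<open>x \<in> D\<close> by (simp add: A_def)
          then show False using elim \<open>x \<in> D\<close> \<open>\<not> 0 \<le> g x\<close> by (simp add: h_def ennreal_eq_0_iff)
        qed
      qed
    qed
  qed
  then have "AE x in M. \<forall>n. x \<in> cball 0 (real n) \<longrightarrow> 0 \<le> g x" unfolding AE_all_countable by blast
  then show ?thesis
  proof eventually_elim
    case (elim x)
    obtain n where "norm x \<le> real n" using real_arch_simple by blast
    then show ?case using elim by auto
  qed
qed

text \<open>Hermitian symmetry occurs twice: pointwise for the kernel, which makes |K|^2 symmetric
  and the two-point function real, and weakly for the operator, which serves the quadratic
  form.\<close>

locale positive_kernel =
  fixes M :: "'a::euclidean_space measure" and K :: "'a \<Rightarrow> 'a \<Rightarrow> complex"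
  assumes sets_M [measurable_cong]: "sets M = sets borel"
    and sigma_finite_M: "sigma_finite_measure M"
    and finite_compact: "compact B \<Longrightarrow> emeasure M B < \<infinity>"
    and kernel_herm: "K x y = cnj (K y x)"
    and bounded: "bounded_kernel M K"
    and herm: "L2_hermitian M (kernel_op M K)"
    and pos: "L2_positive M (kernel_op M K)"
    and diag: "diagonal_normalized M K"
begin

sublocale sigma_finite_measure M by (rule sigma_finite_M)

sublocale pair_sigma_finite M M ..

lemma space_M [simp]: "space M = UNIV"
  using sets_eq_imp_space_eq[OF sets_M] by simp

lemma kernel_measurable [measurable]: "(\<lambda>(x, y). K x y) \<in> borel_measurable (M \<Otimes>\<^sub>M M)"
  using bounded unfolding bounded_kernel_def
  by (simp cong: measurable_cong_sets sets_pair_measure_cong add: sets_M)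

lemma kernel_measurable2 [measurable (raw)]:
  "f \<in> N \<rightarrow>\<^sub>M M \<Longrightarrow> g \<in> N \<rightarrow>\<^sub>M M \<Longrightarrow> (\<lambda>z. K (f z) (g z)) \<in> borel_measurable N"
  using measurable_compose[OF measurable_Pair kernel_measurable, of f N g] by simp

abbreviation "T \<equiv> kernel_op M K"

abbreviation "R \<equiv> L2_op_norm M T"

lemma T: "L2_bounded_operator M T"
  using bounded unfolding bounded_kernel_def by blast

lemma R_nonneg: "0 \<le> R" by (rule L2_op_norm_nonneg[OF T])

lemma diag_integrable: "compact B \<Longrightarrow> set_integrable M B (\<lambda>x. K x x)"
  using diag unfolding diagonal_normalized_def by blast

lemma diag_real: "K x x = of_real (Re (K x x))"
  using kernel_herm[of x x] by (simp add: complex_eq_iff)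

lemma kernel_norm_sym: "cmod (K x y) = cmod (K y x)"
  using kernel_herm[of x y] by simp

lemma compact_sets: "compact B \<Longrightarrow> B \<in> sets M"
  by (simp add: sets_M borel_compact)

text \<open>The sections \<open>K x \<cdot>\<close> are not known to be square integrable. For almost every \<open>x\<close>,
  the theorem of Riesz and Fischer provides a function with the coefficients \<open>T (\<one>\<^sub>B e\<^sub>k) x\<close>; it agrees
  with the section on \<open>B\<close> because both have the same integrals over a countable generator of the
  Borel sets.\<close>

lemma kernel_nn_integral_compact:
  assumes "compact B"
  shows "(\<integral>\<^sup>+x. \<integral>\<^sup>+y. ennreal (indicator B y * (cmod (K x y))\<^sup>2) \<partial>M \<partial>M)
    \<le> ennreal (R * Re (LINT x:B|M. K x x))"
proof -
  have B [measurable]: "B \<in> sets M" by (rule compact_sets[OF assms])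
  have Bfin: "emeasure M B < \<infinity>" by (rule finite_compact[OF assms])
  define t where "t = (LINT x:B|M. K x x)"
  obtain e where e: "L2_orthonormal_basis M e"
    and tr: "(\<lambda>k. L2_inner M (e k) (L2_compress B T (e k))) sums t"
    using diag assms unfolding diagonal_normalized_def L2_has_trace_def t_def by blast
  note eD = L2_orthonormal_basisD[OF e]
  define b where "b k y = indicator B y * e k y" for k y
  have b: "b k \<in> L2_space M" for k
    unfolding b_def[abs_def] by (rule L2_mult_indicator[OF eD(1) B])
  define u where "u k = T (b k)" for k
  have u: "u k \<in> L2_space M" for k
    unfolding u_def by (rule L2_bounded_operatorD[OF T b])
  note [measurable] = L2_space_measurable[OF u] L2_space_measurable[OF eD(1)] L2_space_measurable[OF b]
  \<comment> \<open>Both indicators of the compression move onto the basis functions, so the trace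
    series becomes a sum of values of the form at the \<open>b k\<close>.\<close>
  have form: "L2_inner M (e k) (L2_compress B T (e k)) = L2_inner M (b k) (T (b k))" for k
    unfolding L2_compress_def b_def[abs_def] L2_inner_mult_indicator ..
  \<comment> \<open>Summing |T b|^2 \<le> R <b, T b> over the basis bounds the squared
    Hilbert-Schmidt norm of T 1_B by R times the trace of 1_B T 1_B.\<close>
  have total: "(\<integral>\<^sup>+x. (\<Sum>k. ennreal ((cmod (u k x))\<^sup>2)) \<partial>M) \<le> ennreal (R * Re t)"
  proof -
    have "(\<lambda>k. Re (L2_inner M (b k) (T (b k)))) sums Re t"
      using tr unfolding form by (rule sums_Re)
    then have s: "(\<lambda>k. R * Re (L2_inner M (b k) (T (b k)))) sums (R * Re t)" by (rule sums_mult)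
    have "(\<integral>\<^sup>+x. (\<Sum>k. ennreal ((cmod (u k x))\<^sup>2)) \<partial>M) = (\<Sum>k. \<integral>\<^sup>+x. ennreal ((cmod (u k x))\<^sup>2) \<partial>M)"
      by (rule nn_integral_suminf) measurable
    also have "\<dots> = (\<Sum>k. ennreal ((L2_norm M (u k))\<^sup>2))"
      by (simp add: nn_integral_L2_norm u)
    also have "\<dots> \<le> (\<Sum>k. ennreal (R * Re (L2_inner M (b k) (T (b k)))))"
      unfolding u_def by (intro suminf_le ennreal_leI L2_norm_square_le_op_norm_form T herm pos b) auto
    also have "\<dots> = ennreal (R * Re t)"
      using s R_nonneg L2_positiveD(1)[OF pos b]
      by (subst suminf_ennreal2) (auto simp: sums_iff)
    finally show ?thesis .
  qed
  then have "(\<integral>\<^sup>+x. (\<Sum>k. ennreal ((cmod (u k x))\<^sup>2)) \<partial>M) < \<infinity>" by (rule le_less_trans) simp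
  then have "AE x in M. (\<Sum>k. ennreal ((cmod (u k x))\<^sup>2)) \<noteq> \<infinity>"
    by (intro nn_integral_noteq_infinite) auto
  then have summ: "AE x in M. summable (\<lambda>k. (cmod (u k x))\<^sup>2)"
    by eventually_elim (auto intro: summable_suminf_not_top)
  have int: "AE x in M. integrable M (\<lambda>y. K x y * indicator B y)"
    using bounded L2_indicator[OF B Bfin] unfolding bounded_kernel_def by blast
  obtain G :: "'a set set" where G: "countable G" "Int_stable G" "UNIV \<in> G" "sets borel = sigma_sets UNIV G"
    by (rule countable_borel_generator)
  have Gm: "C \<in> sets M" if "C \<in> G" for C
    using that G(4) by (auto simp: sets_M)
  have fL: "indicator (B \<inter> C) \<in> L2_space M" if "C \<in> G" for C
  proof (rule L2_indicator)
    show "B \<inter> C \<in> sets M" using Gm[OF that] by measurable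
    show "emeasure M (B \<inter> C) < \<infinity>" using Bfin
      by (rule le_less_trans[rotated]) (auto intro: emeasure_mono)
  qed
  \<comment> \<open>For a fixed set, the series converges to \<open>T\<close> of the indicator in
    norm and, by square summability of both coefficient sequences, also pointwise almost everywhere;
    the two limits agree.\<close>
  have expand: "AE x in M. (\<Sum>k. L2_inner M (e k) (indicator (B \<inter> C)) * u k x) =
      (\<integral>y. K x y * indicator (B \<inter> C) y \<partial>M)" if C: "C \<in> G" for C
  proof -
    define f :: "'a \<Rightarrow> complex" where "f = indicator (B \<inter> C)"
    have f: "f \<in> L2_space M" unfolding f_def by (rule fL[OF C])
    define c where "c k = L2_inner M (e k) f" for k
    define S where "S n x = (\<Sum>k<n. c k * u k x)" for n :: nat and x
    define D where "D n x = (\<Sum>k<n. c k * e k x) - f x" for n :: nat and x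
    have D: "D n \<in> L2_space M" for n
      unfolding D_def[abs_def] by (intro L2_diff L2_sum L2_cmult eD f)
    have BD: "(\<lambda>y. indicator B y * D n y) \<in> L2_space M" for n by (intro L2_mult_indicator D B)
    have S: "S n \<in> L2_space M" for n unfolding S_def[abs_def] by (intro L2_sum L2_cmult u)
    have Tf: "T f \<in> L2_space M" by (rule L2_bounded_operatorD[OF T f])
    have eq: "AE x in M. T (\<lambda>y. indicator B y * D n y) x = S n x - T f x" for n
    proof -
      \<comment> \<open>Truncation to \<open>B\<close> turns \<open>e k\<close> into
        \<open>b k\<close> and leaves \<open>f\<close> unchanged, because \<open>f\<close> vanishes
        off \<open>B\<close>.\<close>
      have 1: "(\<lambda>y. indicator B y * D n y) = (\<lambda>y. (\<Sum>k<n. c k * b k y) - f y)"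
        by (auto simp: D_def b_def f_def fun_eq_iff indicator_def)
      have "AE x in M. T (\<lambda>y. (\<Sum>k<n. c k * b k y) - f y) x = T (\<lambda>y. \<Sum>k<n. c k * b k y) x - T f x"
        by (intro L2_bounded_operator_diff T L2_sum L2_cmult b f)
      moreover have "AE x in M. T (\<lambda>y. \<Sum>k<n. c k * b k y) x = (\<Sum>k<n. c k * T (b k) x)"
        by (intro L2_bounded_operator_sum T b)
      ultimately show ?thesis unfolding 1 by eventually_elim (simp add: S_def u_def)
    qed
    have "(\<lambda>n. L2_norm M (\<lambda>x. S n x - T f x)) \<longlonglongrightarrow> 0"
    proof (rule Lim_null_comparison)
      have "L2_norm M (\<lambda>x. S n x - T f x) \<le> R * L2_norm M (D n)" for n
      proof -
        have "L2_norm M (\<lambda>x. S n x - T f x) = L2_norm M (T (\<lambda>y. indicator B y * D n y))"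
          using eq[of n] by (intro L2_norm_cong_AE L2_space_measurable L2_diff S Tf L2_bounded_operatorD[OF T] BD) auto
        also have "\<dots> \<le> R * L2_norm M (\<lambda>y. indicator B y * D n y)"
          by (rule L2_op_norm_bound[OF T BD])
        also have "\<dots> \<le> R * L2_norm M (D n)"
        proof (rule mult_left_mono[OF _ R_nonneg])
          show "L2_norm M (\<lambda>y. indicator B y * D n y) \<le> L2_norm M (D n)"
            unfolding L2_norm_def
            using L2_space_integrable[OF BD] L2_space_integrable[OF D]
            by (intro real_sqrt_le_mono integral_mono) (auto simp: indicator_def)
        qed
        finally show ?thesis .
      qed
      then show "\<forall>\<^sub>F n in sequentially. norm (L2_norm M (\<lambda>x. S n x - T f x)) \<le> R * L2_norm M (D n)"
        by (intro always_eventually) simp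
      show "(\<lambda>n. R * L2_norm M (D n)) \<longlonglongrightarrow> 0"
        using tendsto_mult_left[OF L2_expansion[OF e f], of R] by (simp add: D_def[abs_def] c_def)
    qed
    moreover have "AE x in M. (\<lambda>n. S n x) \<longlonglongrightarrow> (\<Sum>k. c k * u k x)"
      using summ
    proof eventually_elim
      case (elim x)
      have "summable (\<lambda>k. c k * u k x)"
        using summable_mult_of_square_summable[OF L2_coefficients_summable[OF e f] elim]
        unfolding c_def by (rule summable_norm_cancel)
      then show ?case unfolding S_def by (simp add: summable_LIMSEQ)
    qed
    ultimately have "AE x in M. (\<Sum>k. c k * u k x) = T f x"
      by (intro L2_limit_unique_AE[of "T f" M S] Tf S)
    then show ?thesis unfolding c_def f_def kernel_op_def .
  qed
  have "AE x in M. \<forall>C\<in>G. (\<Sum>k. L2_inner M (e k) (indicator (B \<inter> C)) * u k x) =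
      (\<integral>y. K x y * indicator (B \<inter> C) y \<partial>M)"
    using expand by (simp add: AE_ball_countable G(1))
  with summ int have "AE x in M. (\<integral>\<^sup>+y. ennreal (indicator B y * (cmod (K x y))\<^sup>2) \<partial>M)
      \<le> (\<Sum>k. ennreal ((cmod (u k x))\<^sup>2))"
  proof eventually_elim
    case (elim x)
    \<comment> \<open>The conjugated coefficients are prescribed because <g, e k> is then
      \<open>u k x\<close>, the factor in the expansion above.\<close>
    have "summable (\<lambda>k. (cmod (cnj (u k x)))\<^sup>2)" using elim(1) by simp
    from L2_Riesz_Fischer[OF eD(1,2) this] obtain g where g: "g \<in> L2_space M"
      and gk: "\<And>k. L2_inner M (e k) g = cnj (u k x)" by blast
    note [measurable] = L2_space_measurable[OF g]
    define q where "q y = cnj (g y) * indicator B y - K x y * indicator B y" for y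
    have gB: "integrable M (\<lambda>y. cnj (g y) * indicator B y)"
      by (rule integrable_L2_inner[OF g L2_indicator[OF B Bfin]])
    have qi: "integrable M q"
      unfolding q_def[abs_def] by (intro Bochner_Integration.integrable_diff gB elim(2))
    have "AE y in M. q y = 0"
    proof (rule AE_eq_0_if_integral_zero_on_generator[OF sigma_finite_M qi G(2)])
      fix C assume C: "C \<in> G"
      note [measurable] = Gm[OF C]
      have gC: "integrable M (\<lambda>y. cnj (g y) * indicator (B \<inter> C) y)"
        by (rule integrable_L2_inner[OF g fL[OF C]])
      have KC: "integrable M (\<lambda>y. K x y * indicator (B \<inter> C) y)"
        using integrable_mult_indicator[OF Gm[OF C] elim(2)]
        by (rule Bochner_Integration.integrable_cong[THEN iffD1, rotated 2]) (auto simp: indicator_def)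
      have "(\<lambda>k. L2_inner M g (e k) * L2_inner M (e k) (indicator (B \<inter> C))) sums L2_inner M g (indicator (B \<inter> C))"
        by (rule L2_Parseval_inner[OF e fL[OF C] g])
      moreover have "L2_inner M g (e k) = u k x" for k
        using gk[of k] L2_inner_cnj[of M g "e k"] by simp
      ultimately have "L2_inner M g (indicator (B \<inter> C)) = (\<Sum>k. L2_inner M (e k) (indicator (B \<inter> C)) * u k x)"
        by (simp add: sums_iff mult.commute)
      also have "\<dots> = (\<integral>y. K x y * indicator (B \<inter> C) y \<partial>M)" using elim(3) C by blast
      finally have eq: "(\<integral>y. cnj (g y) * indicator (B \<inter> C) y \<partial>M) = (\<integral>y. K x y * indicator (B \<inter> C) y \<partial>M)"
        unfolding L2_inner_def .
      have "(LINT y:C|M. q y) = (\<integral>y. cnj (g y) * indicator (B \<inter> C) y - K x y * indicator (B \<inter> C) y \<partial>M)"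
        unfolding set_lebesgue_integral_def q_def
        by (intro Bochner_Integration.integral_cong refl) (auto simp: indicator_def)
      also have "\<dots> = 0" using gC KC eq by simp
      finally show "(LINT y:C|M. q y) = 0" .
    next
      show "G \<subseteq> Pow (space M)" by simp
      show "sets M = sigma_sets (space M) G" using G(4) by (simp add: sets_M)
      show "space M \<in> G" using G(3) by simp
    qed
    then have "(\<integral>\<^sup>+y. ennreal (indicator B y * (cmod (K x y))\<^sup>2) \<partial>M) \<le> (\<integral>\<^sup>+y. ennreal ((cmod (g y))\<^sup>2) \<partial>M)"
    proof (intro nn_integral_mono_AE, eventually_elim)
      case (elim y)
      show ?case
      proof (cases "y \<in> B")
        case True
        then have "K x y = cnj (g y)" using elim by (simp add: q_def)
        then show ?thesis using True by simp
      qed simp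
    qed
    also have "\<dots> = ennreal ((L2_norm M g)\<^sup>2)" by (rule nn_integral_L2_norm[OF g])
    also have "(L2_norm M g)\<^sup>2 = (\<Sum>k. (cmod (u k x))\<^sup>2)"
      using L2_Parseval[OF e g] by (simp add: gk sums_iff)
    also have "ennreal \<dots> = (\<Sum>k. ennreal ((cmod (u k x))\<^sup>2))"
      using elim(1) by (subst suminf_ennreal2) auto
    finally show ?case .
  qed
  then have "(\<integral>\<^sup>+x. \<integral>\<^sup>+y. ennreal (indicator B y * (cmod (K x y))\<^sup>2) \<partial>M \<partial>M)
      \<le> (\<integral>\<^sup>+x. (\<Sum>k. ennreal ((cmod (u k x))\<^sup>2)) \<partial>M)"
    by (rule nn_integral_mono_AE)
  also note total
  finally show ?thesis by (simp add: t_def)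
qed

text \<open>Symmetry of |K|^2 moves the truncation from the second variable to the first, so the
  trace inequality becomes one between integrals over every compact set of first variables, and
  hence holds pointwise. The second conjunct is recorded because \<open>ennreal\<close> would hide a
  negative right-hand side.\<close>

lemma AE_kernel_square_le:
  "AE x in M. (\<integral>\<^sup>+y. ennreal ((cmod (K x y))\<^sup>2) \<partial>M) \<le> ennreal (R * Re (K x x)) \<and> 0 \<le> R * Re (K x x)"
proof -
  \<comment> \<open>In this proof \<open>k\<close> is the squared norm of a section, not the
    diagonal of the kernel.\<close>
  define k where "k x = (\<integral>\<^sup>+y. ennreal ((cmod (K x y))\<^sup>2) \<partial>M)" for x
  have k [measurable]: "k \<in> borel_measurable M" unfolding k_def[abs_def] by measurable
  have bound: "(\<integral>\<^sup>+x. k x * indicator B x \<partial>M) \<le> ennreal (R * Re (LINT x:B|M. K x x))" if "compact B" for B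
  proof -
    have [measurable]: "B \<in> sets M" by (rule compact_sets[OF that])
    have "(\<integral>\<^sup>+x. k x * indicator B x \<partial>M) = (\<integral>\<^sup>+x. \<integral>\<^sup>+y. ennreal (indicator B x * (cmod (K x y))\<^sup>2) \<partial>M \<partial>M)"
      unfolding k_def
      by (intro nn_integral_cong) (auto simp: indicator_def)
    also have "\<dots> = (\<integral>\<^sup>+y. \<integral>\<^sup>+x. ennreal (indicator B x * (cmod (K x y))\<^sup>2) \<partial>M \<partial>M)"
      by (rule Fubini') measurable
    also have "\<dots> = (\<integral>\<^sup>+y. \<integral>\<^sup>+x. ennreal (indicator B x * (cmod (K y x))\<^sup>2) \<partial>M \<partial>M)"
      by (subst kernel_norm_sym) simp
    also have "\<dots> \<le> ennreal (R * Re (LINT x:B|M. K x x))"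
      by (rule kernel_nn_integral_compact[OF that])
    finally show ?thesis .
  qed
  have fin: "AE x in M. k x \<noteq> \<infinity>"
  proof -
    have "AE x in M. \<forall>n::nat. k x * indicator (cball 0 (real n)) x \<noteq> \<infinity>"
      unfolding AE_all_countable
    proof
      fix n :: nat
      have [measurable]: "cball 0 (real n) \<in> sets M" by (simp add: sets_M)
      show "AE x in M. k x * indicator (cball 0 (real n)) x \<noteq> \<infinity>"
        using bound[of "cball 0 (real n)"]
        by (intro nn_integral_noteq_infinite) (auto simp: top_unique)
    qed
    then show ?thesis
    proof eventually_elim
      case (elim x)
      obtain n where "norm x \<le> real n" using real_arch_simple by blast
      then show ?case using elim by (auto dest!: spec[of _ n])
    qed
  qed
  have pos: "AE x in M. 0 \<le> R * Re (K x x) - enn2real (k x)"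
  proof (rule AE_nonneg_if_compact_integrals_nonneg[OF sets_M finite_compact])
    fix B :: "'a set" assume B: "compact B"
    have [measurable]: "B \<in> sets M" by (rule compact_sets[OF B])
    have ki: "(\<integral>\<^sup>+x. ennreal (indicator B x * enn2real (k x)) \<partial>M) = (\<integral>\<^sup>+x. k x * indicator B x \<partial>M)"
      using fin by (intro nn_integral_cong_AE) (auto elim!: eventually_mono simp: indicator_def less_top)
    have i1: "integrable M (\<lambda>x. indicator B x * enn2real (k x))"
      using bound[OF B] ki by (intro integrableI_nonneg) (auto simp: le_less_trans)
    have i2: "integrable M (\<lambda>x. indicator B x *\<^sub>R K x x)"
      using diag_integrable[OF B] unfolding set_integrable_def .
    have i3: "integrable M (\<lambda>x. indicator B x * (R * Re (K x x)))"
      using integrable_mult_right[OF integrable_Re[OF i2], of R] by (simp add: mult.left_commute)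
    show "set_integrable M B (\<lambda>x. R * Re (K x x) - enn2real (k x))"
      unfolding set_integrable_def using Bochner_Integration.integrable_diff[OF i3 i1] by (simp add: algebra_simps)
    have "ennreal (\<integral>x. indicator B x * enn2real (k x) \<partial>M) \<le> ennreal (R * Re (LINT x:B|M. K x x))"
      using bound[OF B] unfolding ki[symmetric] by (subst nn_integral_eq_integral[OF i1, symmetric]) auto
    \<comment> \<open>Dropping \<open>ennreal\<close> requires a nonnegative right-hand side; the
      trace series of a positive operator provides it.\<close>
    moreover have "0 \<le> R * Re (LINT x:B|M. K x x)"
    proof -
      obtain e where e: "L2_orthonormal_basis M e"
        and tr: "(\<lambda>k. L2_inner M (e k) (L2_compress B T (e k))) sums (LINT x:B|M. K x x)"
        using diag B unfolding diagonal_normalized_def L2_has_trace_def by blast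
      have "0 \<le> Re (L2_inner M (e k) (L2_compress B T (e k)))" for k
        unfolding L2_compress_def L2_inner_mult_indicator
        by (intro L2_positiveD[OF pos] L2_mult_indicator L2_orthonormal_basisD[OF e]) measurable
      then have "0 \<le> Re (LINT x:B|M. K x x)"
        using sums_le[OF _ sums_zero sums_Re[OF tr]] by auto
      then show ?thesis using R_nonneg by simp
    qed
    ultimately have "(\<integral>x. indicator B x * enn2real (k x) \<partial>M) \<le> R * Re (LINT x:B|M. K x x)" by simp
    also have "\<dots> = (\<integral>x. indicator B x * (R * Re (K x x)) \<partial>M)"
      unfolding set_lebesgue_integral_def using i2
      by (subst integral_Re[symmetric], simp)
        (simp add: mult.left_commute integral_mult_right_zero[symmetric] del: integral_mult_right_zero)
    finally show "0 \<le> (LINT x:B|M. R * Re (K x x) - enn2real (k x))"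
      unfolding set_lebesgue_integral_def using i1 i3 by (simp add: right_diff_distrib)
  qed measurable
  from fin pos show ?thesis
  proof eventually_elim
    case (elim x)
    then have "k x = ennreal (enn2real (k x))" by (simp add: less_top)
    also have "\<dots> \<le> ennreal (R * Re (K x x))" using elim(2) by (intro ennreal_leI) simp
    finally have "k x \<le> ennreal (R * Re (K x x))" .
    moreover have "0 \<le> R * Re (K x x)" using elim(2) enn2real_nonneg[of "k x"] by linarith
    ultimately show ?case by (simp add: k_def)
  qed
qed

end

section \<open>Schur products and tensor bases\<close>

text \<open>The hermitian relation is asked of all indices and the form only of those below
  \<open>n\<close>, so that eliminating rows can use symmetry without index conditions.\<close>

definition psd_matrix :: "nat \<Rightarrow> (nat \<Rightarrow> nat \<Rightarrow> complex) \<Rightarrow> bool" where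
  "psd_matrix n A \<longleftrightarrow> (\<forall>j k. A k j = cnj (A j k)) \<and>
     (\<forall>v. 0 \<le> Re (\<Sum>j<n. \<Sum>k<n. cnj (v j) * A j k * v k))"

lemma psd_matrix_cnj: "psd_matrix n A \<Longrightarrow> A k j = cnj (A j k)"
  unfolding psd_matrix_def by (drule conjunct1) (elim allE)

lemma psd_matrix_form_nonneg:
  "psd_matrix n A \<Longrightarrow> 0 \<le> Re (\<Sum>j<n. \<Sum>k<n. cnj (v j) * A j k * v k)"
  unfolding psd_matrix_def by (drule conjunct2) (elim allE)

lemma psd_matrix_Suc_form:
  "(\<Sum>j<Suc n. \<Sum>k<Suc n. cnj (v j) * A j k * v k) =
    (\<Sum>j<n. \<Sum>k<n. cnj (v j) * A j k * v k) + (\<Sum>j<n. cnj (v j) * A j n) * v n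
      + cnj (v n) * (\<Sum>k<n. A n k * v k) + cnj (v n) * A n n * v n" for v :: "nat \<Rightarrow> complex"
  by (simp add: sum.distrib sum_distrib_left sum_distrib_right algebra_simps)

lemma psd_matrix_SucD:
  assumes "psd_matrix (Suc n) A"
  shows "psd_matrix n A"
  unfolding psd_matrix_def
proof (intro conjI allI)
  fix v :: "nat \<Rightarrow> complex"
  have "(\<Sum>j<Suc n. \<Sum>k<Suc n. cnj ((v(n := 0)) j) * A j k * (v(n := 0)) k) =
      (\<Sum>j<n. \<Sum>k<n. cnj (v j) * A j k * v k)"
    unfolding psd_matrix_Suc_form by simp
  from this[symmetric] show "0 \<le> Re (\<Sum>j<n. \<Sum>k<n. cnj (v j) * A j k * v k)"
    using psd_matrix_form_nonneg[OF assms, of "v(n := 0)"] by (simp only:)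
qed (rule psd_matrix_cnj[OF assms])

text \<open>Test vectors supported at \<open>n\<close>, or at \<open>j\<close> and \<open>n\<close>,
  give the sign of the corner and the two-by-two minor. The minor makes a zero pivot annihilate its
  whole column.\<close>

lemma psd_matrix_corner:
  assumes "psd_matrix (Suc n) A"
  shows "A n n = of_real (Re (A n n))" "0 \<le> Re (A n n)"
    "j < n \<Longrightarrow> (cmod (A j n))\<^sup>2 \<le> Re (A j j) * Re (A n n)"
proof -
  note herm = psd_matrix_cnj[OF assms] and pos = psd_matrix_form_nonneg[OF assms]
  show nn: "A n n = of_real (Re (A n n))"
    by (rule complex_eqI) (use arg_cong[OF herm[of n n], of Im] in simp_all)
  show "0 \<le> Re (A n n)"
    using pos[of "\<lambda>i. if i = n then 1 else 0"] unfolding psd_matrix_Suc_form by simp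
  assume j: "j < n"
  show "(cmod (A j n))\<^sup>2 \<le> Re (A j j) * Re (A n n)"
  proof (rule cmod_square_le_if_quadratic_nonneg)
    fix z
    define v :: "nat \<Rightarrow> complex" where "v i = (if i = n then z else if i = j then 1 else 0)" for i
    have pick: "(\<Sum>i<n. cnj (v i) * F i) = F j" "(\<Sum>i<n. F i * v i) = F j" for F
    proof -
      have v0: "v i = 0" if "i \<in> {..<n} - {j}" for i using that by (simp add: v_def)
      have vj: "v j = 1" using j by (simp add: v_def)
      have "(\<Sum>i<n. cnj (v i) * F i) = (\<Sum>i\<in>{j}. cnj (v i) * F i)"
        by (rule sum.mono_neutral_right) (use j v0 in auto)
      then show "(\<Sum>i<n. cnj (v i) * F i) = F j" by (simp add: vj)
      have "(\<Sum>i<n. F i * v i) = (\<Sum>i\<in>{j}. F i * v i)"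
        by (rule sum.mono_neutral_right) (use j v0 in auto)
      then show "(\<Sum>i<n. F i * v i) = F j" by (simp add: vj)
    qed
    have vn: "v n = z" by (simp add: v_def)
    have e1: "(\<Sum>j<Suc n. \<Sum>k<Suc n. cnj (v j) * A j k * v k) = A j j + A j n * z + cnj z * A n j + cnj z * A n n * z"
      unfolding psd_matrix_Suc_form pick vn ..
    have "cnj z * A n n * z = cnj z * of_real (Re (A n n)) * z" using nn by (rule arg_cong)
    also have "\<dots> = of_real ((cmod z)\<^sup>2) * of_real (Re (A n n))"
      unfolding complex_norm_square by (simp only: mult_ac)
    finally have e2: "cnj z * A n n * z = of_real ((cmod z)\<^sup>2 * Re (A n n))" by (simp only: of_real_mult)
    have e3: "cnj z * A n j = cnj (A j n * z)" using herm[of n j] by simp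
    have "0 \<le> Re (A j j + A j n * z + cnj (A j n * z) + of_real ((cmod z)\<^sup>2 * Re (A n n)))"
      using pos[of v] unfolding e1 e2 e3 .
    then show "0 \<le> Re (A j j) + 2 * Re (z * A j n) + (cmod z)\<^sup>2 * Re (A n n)"
      unfolding mult.commute[of z "A j n"] by (simp only: plus_complex.sel cnj.sel Re_complex_of_real)
  qed
qed

text \<open>Fejer's theorem, by successive elimination of the last row and column (Schur complements).\<close>

lemma psd_matrix_Frobenius_nonneg:
  assumes "psd_matrix n A" "psd_matrix n B"
  shows "0 \<le> Re (\<Sum>j<n. \<Sum>k<n. cnj (A j k) * B j k)"
  using assms
proof (induction n arbitrary: A)
  case (Suc n)
  have Bn: "psd_matrix n B" by (rule psd_matrix_SucD) fact
  note herm = psd_matrix_cnj[OF Suc.prems(1)]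
  define a where "a = Re (A n n)"
  have a: "A n n = of_real a" "0 \<le> a" using psd_matrix_corner[OF Suc.prems(1)] by (auto simp: a_def)
  show ?case
  proof (cases "a = 0")
    case True
    have col: "A j n = 0" if "j < Suc n" for j
    proof (cases "j = n")
      case False
      then have "(cmod (A j n))\<^sup>2 \<le> Re (A j j) * a"
        using psd_matrix_corner(3)[OF Suc.prems(1), of j] that by (simp add: a_def)
      then show ?thesis using True by simp
    qed (use a True in simp)
    have row: "A n j = 0" if "j < Suc n" for j using herm[of n j] col[OF that] by simp
    have "(\<Sum>j<Suc n. \<Sum>k<Suc n. cnj (A j k) * B j k) = (\<Sum>j<n. \<Sum>k<n. cnj (A j k) * B j k)"
      unfolding sum.lessThan_Suc using col row by simp
    then show ?thesis using Suc.IH[OF psd_matrix_SucD[OF Suc.prems(1)] Bn] by (simp only:)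
  next
    case False
    then have a0: "a > 0" using a by simp
    \<comment> \<open>The Schur complement: the rank one part through row and column
      \<open>n\<close> is split off, and \<open>A'\<close> vanishes in that row and column.\<close>
    define A' where "A' j k = A j k - A j n * A n k / of_real a" for j k
    have "psd_matrix n A'"
      unfolding psd_matrix_def
    proof (intro conjI allI)
      fix j k show "A' k j = cnj (A' j k)"
        unfolding A'_def using herm[of k j] herm[of k n] herm[of n j] by (simp add: mult.commute)
    next
      fix v :: "nat \<Rightarrow> complex"
      define s where "s = (\<Sum>k<n. A n k * v k)"
      have s': "(\<Sum>j<n. cnj (v j) * A j n) = cnj s"
        unfolding s_def cnj_sum complex_cnj_mult herm[of _ n, symmetric] by (simp add: mult.commute)
      \<comment> \<open>The last entry minimises the form of \<open>A\<close> over all extensions of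
        \<open>v\<close>; the minimum is the form of \<open>A'\<close> at \<open>v\<close>.\<close>
      define w where "w = v(n := - s / of_real a)"
      have "(\<Sum>j<Suc n. \<Sum>k<Suc n. cnj (w j) * A j k * w k) =
          (\<Sum>j<n. \<Sum>k<n. cnj (v j) * A j k * v k) - cnj s * s / of_real a"
      proof -
        have w: "w n = - s / of_real a" "\<And>i. i < n \<Longrightarrow> w i = v i" by (auto simp: w_def)
        have e1: "(\<Sum>j<n. \<Sum>k<n. cnj (w j) * A j k * w k) = (\<Sum>j<n. \<Sum>k<n. cnj (v j) * A j k * v k)"
          and e2: "(\<Sum>j<n. cnj (w j) * A j n) = cnj s" and e3: "(\<Sum>k<n. A n k * w k) = s"
          using s' by (simp_all add: w s_def)
        show ?thesis
          unfolding psd_matrix_Suc_form e1 e2 e3 w(1) a(1) using a0 by (simp add: field_simps)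
      qed
      also have "\<dots> = (\<Sum>j<n. \<Sum>k<n. cnj (v j) * A' j k * v k)"
      proof -
        have "cnj s * s / of_real a = (\<Sum>j<n. \<Sum>k<n. cnj (v j) * (A j n * A n k / of_real a) * v k)"
          unfolding s'[symmetric] unfolding s_def sum_product sum_divide_distrib
          by (intro sum.cong refl) (simp add: algebra_simps)
        then show ?thesis
          by (simp only: A'_def left_diff_distrib right_diff_distrib sum_subtractf)
      qed
      finally have eq: "(\<Sum>j<Suc n. \<Sum>k<Suc n. cnj (w j) * A j k * w k) = (\<Sum>j<n. \<Sum>k<n. cnj (v j) * A' j k * v k)" .
      show "0 \<le> Re (\<Sum>j<n. \<Sum>k<n. cnj (v j) * A' j k * v k)"
        unfolding eq[symmetric] by (rule psd_matrix_form_nonneg[OF Suc.prems(1)])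
    qed
    then have 1: "0 \<le> Re (\<Sum>j<n. \<Sum>k<n. cnj (A' j k) * B j k)" using Bn by (rule Suc.IH)
    \<comment> \<open>Pairing the rank one part with \<open>B\<close> gives the form of
      \<open>B\<close> at the last column of \<open>A\<close>, divided by the pivot.\<close>
    define D where "D j k = cnj (A j n) * B j k * A k n / of_real a" for j k
    have split: "cnj (A j k) * B j k = cnj (A' j k) * B j k + D j k" for j k
      unfolding A'_def D_def complex_cnj_diff complex_cnj_divide complex_cnj_mult complex_cnj_complex_of_real
        herm[of n k] complex_cnj_cnj by (simp add: algebra_simps)
    have A'0: "A' j n = 0" "A' n k = 0" for j k
      unfolding A'_def using a(1) a0 by simp_all
    have "(\<Sum>j<Suc n. \<Sum>k<Suc n. cnj (A j k) * B j k) =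
        (\<Sum>j<Suc n. \<Sum>k<Suc n. cnj (A' j k) * B j k) + (\<Sum>j<Suc n. \<Sum>k<Suc n. D j k)"
      unfolding split sum.distrib ..
    also have "(\<Sum>j<Suc n. \<Sum>k<Suc n. cnj (A' j k) * B j k) = (\<Sum>j<n. \<Sum>k<n. cnj (A' j k) * B j k)"
      unfolding sum.lessThan_Suc by (simp add: A'0)
    also have "(\<Sum>j<Suc n. \<Sum>k<Suc n. D j k) =
        (\<Sum>j<Suc n. \<Sum>k<Suc n. cnj (A j n) * B j k * A k n) / of_real a"
      unfolding D_def sum_divide_distrib ..
    finally have eq: "Re (\<Sum>j<Suc n. \<Sum>k<Suc n. cnj (A j k) * B j k) =
        Re (\<Sum>j<n. \<Sum>k<n. cnj (A' j k) * B j k) + Re (\<Sum>j<Suc n. \<Sum>k<Suc n. cnj (A j n) * B j k * A k n) / a"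
      by (simp only: plus_complex.sel Re_divide_of_real)
    have "0 \<le> Re (\<Sum>j<Suc n. \<Sum>k<Suc n. cnj (A j n) * B j k * A k n)"
      using psd_matrix_form_nonneg[OF Suc.prems(2), of "\<lambda>k. A k n"] .
    then show ?thesis unfolding eq using 1 a0 by (intro add_nonneg_nonneg divide_nonneg_pos) auto
  qed
qed simp

section \<open>Tensor products of orthonormal bases\<close>

context sigma_finite_measure
begin

interpretation P: pair_sigma_finite M M ..

text \<open>The second factor is conjugated because f(x) cnj (g(y)) is the kernel of the rank one
  operator sending h to <g, h> f; pairing it with a kernel \<open>H\<close> then gives <f, H
  g>.\<close>

lemma L2_tensor:
  assumes f: "f \<in> L2_space M" and g: "g \<in> L2_space M"
  shows "(\<lambda>(x, y). f x * cnj (g y)) \<in> L2_space (M \<Otimes>\<^sub>M M)"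
proof (rule L2_spaceI)
  note [measurable] = L2_space_measurable[OF f] L2_space_measurable[OF g]
  show "(\<lambda>(x, y). f x * cnj (g y)) \<in> borel_measurable (M \<Otimes>\<^sub>M M)" by measurable
  have "integrable (M \<Otimes>\<^sub>M M) (\<lambda>(x, y). (cmod (f x))\<^sup>2 * (cmod (g y))\<^sup>2)"
  proof (rule P.Fubini_integrable)
    show "integrable M (\<lambda>x. \<integral>y. norm (case (x, y) of (x, y) \<Rightarrow> (cmod (f x))\<^sup>2 * (cmod (g y))\<^sup>2) \<partial>M)"
      using L2_space_integrable[OF f] by simp
    show "AE x in M. integrable M (\<lambda>y. case (x, y) of (x, y) \<Rightarrow> (cmod (f x))\<^sup>2 * (cmod (g y))\<^sup>2)"
      using L2_space_integrable[OF g] by simp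
  qed measurable
  then show "integrable (M \<Otimes>\<^sub>M M) (\<lambda>x. (cmod (case x of (x, y) \<Rightarrow> f x * cnj (g y)))\<^sup>2)"
    by (simp add: case_prod_unfold norm_mult power_mult_distrib)
qed

lemma L2_inner_tensor:
  assumes f: "f \<in> L2_space M" and g: "g \<in> L2_space M" and H: "H \<in> L2_space (M \<Otimes>\<^sub>M M)"
  shows "L2_inner (M \<Otimes>\<^sub>M M) (\<lambda>(x, y). f x * cnj (g y)) H = L2_inner M f (\<lambda>x. \<integral>y. H (x, y) * g y \<partial>M)"
proof -
  have "L2_inner (M \<Otimes>\<^sub>M M) (\<lambda>(x, y). f x * cnj (g y)) H =
      (\<integral>x. \<integral>y. cnj (f x * cnj (g y)) * H (x, y) \<partial>M \<partial>M)"
    unfolding L2_inner_def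
    using P.integral_fst'[OF integrable_L2_inner[OF L2_tensor[OF f g] H]] by simp
  also have "\<dots> = (\<integral>x. cnj (f x) * (\<integral>y. H (x, y) * g y \<partial>M) \<partial>M)"
    by (simp add: mult.assoc integral_mult_right_zero[symmetric] mult.commute[of "g _"] del: integral_mult_right_zero)
  finally show ?thesis by (simp add: L2_inner_def)
qed

lemma L2_section:
  assumes H: "H \<in> L2_space (M \<Otimes>\<^sub>M M)"
  shows "AE x in M. (\<lambda>y. H (x, y)) \<in> L2_space M"
proof -
  note [measurable] = L2_space_measurable[OF H]
  have "AE x in M. integrable M (\<lambda>y. (cmod (H (x, y)))\<^sup>2)"
    using P.AE_integrable_fst'[OF L2_space_integrable[OF H]] by simp
  then show ?thesis
  proof (rule AE_mp, intro AE_I2 impI)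
    fix x assume "x \<in> space M" "integrable M (\<lambda>y. (cmod (H (x, y)))\<^sup>2)"
    moreover from this(1) have "(\<lambda>y. H (x, y)) \<in> borel_measurable M" by measurable
    ultimately show "(\<lambda>y. H (x, y)) \<in> L2_space M" by (intro L2_spaceI)
  qed
qed

text \<open>Cauchy-Schwarz on almost every section: a square integrable kernel acts as a
  Hilbert-Schmidt operator.\<close>

lemma L2_tensor_apply:
  assumes H: "H \<in> L2_space (M \<Otimes>\<^sub>M M)" and g: "g \<in> L2_space M"
  shows "(\<lambda>x. \<integral>y. H (x, y) * g y \<partial>M) \<in> L2_space M"
proof (rule L2_spaceI)
  note [measurable] = L2_space_measurable[OF H] L2_space_measurable[OF g]
  show "(\<lambda>x. \<integral>y. H (x, y) * g y \<partial>M) \<in> borel_measurable M" by measurable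
  show "integrable M (\<lambda>x. (cmod (\<integral>y. H (x, y) * g y \<partial>M))\<^sup>2)"
  proof (rule Bochner_Integration.integrable_bound)
    show "integrable M (\<lambda>x. (L2_norm M g)\<^sup>2 * (\<integral>y. (cmod (H (x, y)))\<^sup>2 \<partial>M))"
      using P.integrable_fst'[OF L2_space_integrable[OF H]] by simp
    show "AE x in M. norm ((cmod (\<integral>y. H (x, y) * g y \<partial>M))\<^sup>2) \<le>
        norm ((L2_norm M g)\<^sup>2 * (\<integral>y. (cmod (H (x, y)))\<^sup>2 \<partial>M))"
      using L2_section[OF H]
    proof eventually_elim
      case (elim x)
      have "(\<integral>y. H (x, y) * g y \<partial>M) = L2_inner M (\<lambda>y. cnj (H (x, y))) g" by (simp add: L2_inner_def)
      then have "(cmod (\<integral>y. H (x, y) * g y \<partial>M))\<^sup>2 \<le> (L2_norm M (\<lambda>y. cnj (H (x, y))) * L2_norm M g)\<^sup>2"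
        using L2_Cauchy_Schwarz[OF L2_cnj[OF elim] g] by (intro power_mono) auto
      also have "\<dots> = (L2_norm M g)\<^sup>2 * (\<integral>y. (cmod (H (x, y)))\<^sup>2 \<partial>M)"
        unfolding power_mult_distrib L2_norm_power2[of M "\<lambda>y. cnj (H (x, y))"] by simp
      finally show ?case by simp
    qed
  qed measurable
qed

text \<open>Totality is shown one variable at a time. For each k the integral of H(x, y) e_k(y) over
  y is, as a function of x, orthogonal to every e_j, hence zero almost everywhere; for the countably
  many k together, almost every conjugated section is orthogonal to the basis.
  \<open>prod_decode\<close> enumerates the index pairs.\<close>

lemma L2_orthonormal_basis_tensor:
  assumes e: "L2_orthonormal_basis M e"
  shows "L2_orthonormal_basis (M \<Otimes>\<^sub>M M) (\<lambda>n (x, y). e (fst (prod_decode n)) x * cnj (e (snd (prod_decode n)) y))"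
    (is "L2_orthonormal_basis _ ?E")
  unfolding L2_orthonormal_basis_def
proof (intro conjI allI ballI impI)
  note eD = L2_orthonormal_basisD[OF e]
  show EL: "?E n \<in> L2_space (M \<Otimes>\<^sub>M M)" for n by (rule L2_tensor[OF eD(1) eD(1)])
  fix m n
  obtain j k j' k' where d: "prod_decode m = (j, k)" "prod_decode n = (j', k')" by (metis surj_pair)
  have "L2_inner (M \<Otimes>\<^sub>M M) (?E m) (?E n) = L2_inner M (e j) (\<lambda>x. \<integral>y. (e j' x * cnj (e k' y)) * e k y \<partial>M)"
    using L2_inner_tensor[OF eD(1)[of j] eD(1)[of k] EL[of n]] by (simp add: d)
  also have "\<dots> = L2_inner M (e j) (\<lambda>x. L2_inner M (e k') (e k) * e j' x)"
    unfolding L2_inner_def[of M "e k'"] mult.assoc integral_mult_right_zero by (simp only: mult.commute)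
  also have "\<dots> = (if m = n then 1 else 0)"
    unfolding L2_inner_cmult_right eD using d by (metis mult_1 mult_zero_left prod.inject prod_decode_inverse)
  finally show "L2_inner (M \<Otimes>\<^sub>M M) (?E m) (?E n) = (if m = n then 1 else 0)" .
next
  note eD = L2_orthonormal_basisD[OF e]
  fix H assume H: "H \<in> L2_space (M \<Otimes>\<^sub>M M)" and zero: "\<forall>n. L2_inner (M \<Otimes>\<^sub>M M) (?E n) H = 0"
  note [measurable] = L2_space_measurable[OF H]
  have "AE x in M. (\<integral>y. H (x, y) * e k y \<partial>M) = 0" for k
  proof (rule eD(3)[OF L2_tensor_apply[OF H eD(1)]])
    fix j
    show "L2_inner M (e j) (\<lambda>x. \<integral>y. H (x, y) * e k y \<partial>M) = 0"
      using zero[rule_format, of "prod_encode (j, k)"] L2_inner_tensor[OF eD(1)[of j] eD(1)[of k] H] by simp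
  qed
  then have "AE x in M. \<forall>k. (\<integral>y. H (x, y) * e k y \<partial>M) = 0" unfolding AE_all_countable by blast
  with L2_section[OF H] have "AE x in M. AE y in M. H (x, y) = 0"
  proof eventually_elim
    case (elim x)
    have "AE y in M. cnj (H (x, y)) = 0"
    proof (rule eD(3)[OF L2_cnj[OF elim(1)]])
      fix k
      have "L2_inner M (e k) (\<lambda>y. cnj (H (x, y))) = cnj (\<integral>y. H (x, y) * e k y \<partial>M)"
        unfolding L2_inner_def Bochner_Integration.integral_cnj[symmetric] complex_cnj_mult by (simp only: mult.commute)
      then show "L2_inner M (e k) (\<lambda>y. cnj (H (x, y))) = 0" using elim(2) by simp
    qed
    then show ?case by simp
  qed
  then show "AE z in M \<Otimes>\<^sub>M M. H z = 0" by (intro P.AE_pair_measure) measurable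
qed

end

section \<open>Positivity of the form with kernel |K|^2\<close>

context positive_kernel
begin

text \<open>By the trace bound, cutting off the second variable alone already gives a
  Hilbert-Schmidt kernel, and the factors \<phi> are bounded.\<close>

lemma L2_section_product:
  assumes "\<phi> \<in> borel_measurable borel" "\<And>x. \<bar>\<phi> x\<bar> \<le> C" "compact B" "\<And>x. x \<notin> B \<Longrightarrow> \<phi> x = 0"
  shows "(\<lambda>(x, y). of_real (\<phi> x) * K x y * of_real (\<phi> y)) \<in> L2_space (M \<Otimes>\<^sub>M M)"
    (is "?H \<in> _")
proof -
  have [measurable]: "\<phi> \<in> borel_measurable M" "B \<in> sets M"
    using assms(1) compact_sets[OF assms(3)] by (auto cong: measurable_cong_sets simp: sets_M)
  define F where "F = (\<lambda>(x, y). K x y * indicator B y)"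
  have F: "F \<in> L2_space (M \<Otimes>\<^sub>M M)"
  proof (rule L2_spaceI)
    show "F \<in> borel_measurable (M \<Otimes>\<^sub>M M)" unfolding F_def by measurable
    have "(\<integral>\<^sup>+z. ennreal ((cmod (F z))\<^sup>2) \<partial>(M \<Otimes>\<^sub>M M)) =
        (\<integral>\<^sup>+x. \<integral>\<^sup>+y. ennreal (indicator B y * (cmod (K x y))\<^sup>2) \<partial>M \<partial>M)"
      unfolding F_def
      by (subst sigma_finite_measure.nn_integral_fst[OF sigma_finite_M, symmetric], measurable)
        (auto intro!: nn_integral_cong simp: indicator_def)
    also have "\<dots> < \<infinity>"
      by (rule le_less_trans[OF kernel_nn_integral_compact[OF assms(3)]]) simp
    finally show "integrable (M \<Otimes>\<^sub>M M) (\<lambda>z. (cmod (F z))\<^sup>2)"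
      by (intro integrableI_nonneg) (auto simp: F_def)
  qed
  have C: "0 \<le> C" using assms(2)[of undefined] by linarith
  show ?thesis
  proof (rule L2_space_dominated[OF F, where C = "C * C"])
    show "?H \<in> borel_measurable (M \<Otimes>\<^sub>M M)" by measurable
    have "cmod (?H (x, y)) \<le> C * C * cmod (F (x, y))" for x y
    proof (cases "y \<in> B")
      case True
      have "\<bar>\<phi> x\<bar> * \<bar>\<phi> y\<bar> \<le> C * C" by (intro mult_mono assms C) auto
      then have "(\<bar>\<phi> x\<bar> * \<bar>\<phi> y\<bar>) * cmod (K x y) \<le> C * C * cmod (K x y)" by (rule mult_right_mono) simp
      then show ?thesis using True by (simp add: F_def norm_mult mult_ac)
    qed (simp add: assms F_def)
    then show "AE z in M \<Otimes>\<^sub>M M. cmod (?H z) \<le> C * C * cmod (F z)" by (auto intro!: AE_I2)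
  qed
qed

lemma kernel_form_eq_tensor:
  assumes \<phi>: "\<phi> \<in> borel_measurable borel" "\<And>x. \<bar>\<phi> x\<bar> \<le> C" and f: "f \<in> L2_space M" and g: "g \<in> L2_space M"
    and H: "(\<lambda>(x, y). of_real (\<phi> x) * K x y * of_real (\<phi> y)) \<in> L2_space (M \<Otimes>\<^sub>M M)" (is "?H \<in> _")
  shows "L2_inner (M \<Otimes>\<^sub>M M) (\<lambda>(x, y). f x * cnj (g y)) ?H =
    L2_inner M (\<lambda>x. of_real (\<phi> x) * f x) (T (\<lambda>x. of_real (\<phi> x) * g x))"
proof -
  have "L2_inner (M \<Otimes>\<^sub>M M) (\<lambda>(x, y). f x * cnj (g y)) ?H =
      (\<integral>x. cnj (f x) * (\<integral>y. of_real (\<phi> x) * K x y * of_real (\<phi> y) * g y \<partial>M) \<partial>M)"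
    unfolding sigma_finite_measure.L2_inner_tensor[OF sigma_finite_M f g H] L2_inner_def[of M] by simp
  also have "\<dots> = (\<integral>x. cnj (of_real (\<phi> x) * f x) * (\<integral>y. K x y * (of_real (\<phi> y) * g y) \<partial>M) \<partial>M)"
    by (simp add: mult.assoc) (simp add: mult.left_commute)
  finally show ?thesis by (simp add: L2_inner_def kernel_op_def)
qed

lemma psd_matrix_form:
  assumes "\<And>k. b k \<in> L2_space M"
  shows "psd_matrix n (\<lambda>j k. L2_inner M (b j) (T (b k)))"
  unfolding psd_matrix_def
proof (intro conjI allI)
  fix j k
  have "L2_inner M (b k) (T (b j)) = L2_inner M (T (b k)) (b j)"
    using herm assms unfolding L2_hermitian_def by blast
  also have "\<dots> = cnj (L2_inner M (b j) (T (b k)))" by (rule L2_inner_cnj)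
  finally show "L2_inner M (b k) (T (b j)) = cnj (L2_inner M (b j) (T (b k)))" .
next
  have Tb: "T (b k) \<in> L2_space M" for k by (intro L2_bounded_operatorD[OF T] assms)
  fix v
  define s where "s x = (\<Sum>k<n. v k * b k x)" for x
  have s: "s \<in> L2_space M" unfolding s_def[abs_def] by (intro L2_sum L2_cmult assms)
  have "AE x in M. T s x = (\<Sum>k<n. v k * T (b k) x)"
    unfolding s_def[abs_def] by (rule L2_bounded_operator_sum[OF T assms])
  then have "L2_inner M s (T s) = L2_inner M s (\<lambda>x. \<Sum>k<n. v k * T (b k) x)"
    by (intro L2_inner_cong_AE L2_space_measurable s L2_bounded_operatorD[OF T] L2_sum L2_cmult Tb)
  also have "\<dots> = (\<Sum>k<n. v k * (\<Sum>j<n. cnj (v j) * L2_inner M (b j) (T (b k))))"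
    by (simp add: L2_inner_sum_right s L2_cmult Tb L2_inner_cmult_right)
      (simp add: s_def[abs_def] L2_inner_sum_left L2_cmult assms Tb L2_inner_cmult_left)
  also have "\<dots> = (\<Sum>j<n. \<Sum>k<n. cnj (v j) * L2_inner M (b j) (T (b k)) * v k)"
    unfolding sum_distrib_left by (subst sum.swap) (simp add: mult_ac)
  finally show "0 \<le> Re (\<Sum>j<n. \<Sum>k<n. cnj (v j) * L2_inner M (b j) (T (b k)) * v k)"
    using L2_positiveD(1)[OF pos s] by simp
qed

text \<open>In the tensor basis, the partial sums over squares of indices of the Parseval series are
  Frobenius products of two positive semidefinite matrices.\<close>

lemma kernel_square_form_nonneg:
  assumes \<phi>: "\<phi> \<in> borel_measurable borel" "\<And>x. \<bar>\<phi> x\<bar> \<le> C" "compact B" "\<And>x. x \<notin> B \<Longrightarrow> \<phi> x = 0"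
  shows "0 \<le> (\<integral>z. \<phi> (fst z) * \<phi> (snd z) * (cmod (K (fst z) (snd z)))\<^sup>2 \<partial>(M \<Otimes>\<^sub>M M))"
proof -
  obtain e where e: "L2_orthonormal_basis M e"
    using diag compact_empty unfolding diagonal_normalized_def L2_has_trace_def by blast
  note eD = L2_orthonormal_basisD[OF e]
  define E where "E = (\<lambda>n (x, y). e (fst (prod_decode n)) x * cnj (e (snd (prod_decode n)) y))"
  have E: "L2_orthonormal_basis (M \<Otimes>\<^sub>M M) E"
    unfolding E_def by (rule sigma_finite_measure.L2_orthonormal_basis_tensor[OF sigma_finite_M e])
  have [measurable]: "B \<in> sets M" "B \<in> sets borel" "\<phi> \<in> borel_measurable M"
    using \<phi>(1,3) by (simp_all add: compact_sets borel_compact measurable_cong_sets[OF sets_M refl])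
  \<comment> \<open>Pairing the kernel truncated by \<open>u\<close> with the one weighted by \<phi>
    reproduces \<phi>(x) \<phi>(y) |K(x, y)|^2, and the coefficients of both are values of the form
    of \<open>T\<close>. The truncation secures square integrability.\<close>
  define u :: "'a \<Rightarrow> real" where "u = indicator B"
  have u: "u \<in> borel_measurable borel" "\<And>x. \<bar>u x\<bar> \<le> 1" "\<And>x. x \<notin> B \<Longrightarrow> u x = 0"
    by (auto simp: u_def indicator_def)
  define F where "F = (\<lambda>(x, y). of_real (u x) * K x y * of_real (u y))"
  define H where "H = (\<lambda>(x, y). of_real (\<phi> x) * K x y * of_real (\<phi> y))"
  have F: "F \<in> L2_space (M \<Otimes>\<^sub>M M)" unfolding F_def by (rule L2_section_product[OF u(1,2) \<phi>(3) u(3)])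
  have H: "H \<in> L2_space (M \<Otimes>\<^sub>M M)" unfolding H_def by (rule L2_section_product[OF \<phi>])
  define b where "b k x = of_real (u x) * e k x" for k x
  define d where "d k x = of_real (\<phi> x) * e k x" for k x
  have b: "b k \<in> L2_space M" for k
    unfolding b_def[abs_def] using u(1,2)
    by (intro L2_mult_bounded[where C = 1] eD) (simp_all add: measurable_cong_sets[OF sets_M refl])
  have d: "d k \<in> L2_space M" for k
    unfolding d_def[abs_def] using \<phi>(1,2)
    by (intro L2_mult_bounded[where C = C] eD) (simp_all add: measurable_cong_sets[OF sets_M refl])
  define A where "A j k = L2_inner M (b j) (T (b k))" for j k
  define D where "D j k = L2_inner M (d j) (T (d k))" for j k
  have EF: "L2_inner (M \<Otimes>\<^sub>M M) (E n) F = A (fst (prod_decode n)) (snd (prod_decode n))" for n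
    unfolding E_def F_def A_def b_def[abs_def]
    by (rule kernel_form_eq_tensor[OF u(1,2) eD(1) eD(1) F[unfolded F_def]])
  have EH: "L2_inner (M \<Otimes>\<^sub>M M) (E n) H = D (fst (prod_decode n)) (snd (prod_decode n))" for n
    unfolding E_def H_def D_def d_def[abs_def]
    by (rule kernel_form_eq_tensor[OF \<phi>(1,2) eD(1) eD(1) H[unfolded H_def]])
  have FE: "L2_inner (M \<Otimes>\<^sub>M M) F (E n) = cnj (A (fst (prod_decode n)) (snd (prod_decode n)))" for n
    unfolding EF[symmetric] by (rule L2_inner_cnj)
  define a where "a n = cnj (A (fst (prod_decode n)) (snd (prod_decode n))) * D (fst (prod_decode n)) (snd (prod_decode n))" for n
  have "a sums L2_inner (M \<Otimes>\<^sub>M M) F H"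
    using L2_Parseval_inner[OF E H F] unfolding FE EH a_def .
  moreover have "summable (\<lambda>n. norm (a n))"
    unfolding a_def EF[symmetric] EH[symmetric]
    by (rule summable_mult_of_square_summable)
      (simp_all add: L2_coefficients_summable[OF E F] L2_coefficients_summable[OF E H])
  \<comment> \<open>Unordered summation frees the series from the enumeration: initial segments
    under \<open>prod_decode\<close> need not be squares of indices, but every finite index set lies
    in a square.\<close>
  ultimately have hs: "(a has_sum L2_inner (M \<Otimes>\<^sub>M M) F H) UNIV"
    by (intro norm_summable_imp_has_sum)
  have nonneg: "0 \<le> Re (L2_inner (M \<Otimes>\<^sub>M M) F H)"
  proof (rule ccontr)
    assume "\<not> ?thesis"
    then have "- Re (L2_inner (M \<Otimes>\<^sub>M M) F H) > 0" by simp
    from tendstoD[OF hs[unfolded has_sum_def] this] obtain X where X: "finite X"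
      and "\<forall>Y. finite Y \<and> X \<subseteq> Y \<and> Y \<subseteq> UNIV \<longrightarrow>
        dist (sum a Y) (L2_inner (M \<Otimes>\<^sub>M M) F H) < - Re (L2_inner (M \<Otimes>\<^sub>M M) F H)"
      unfolding eventually_finite_subsets_at_top by (elim exE conjE)
    then have XY: "\<And>Y. finite Y \<Longrightarrow> X \<subseteq> Y \<Longrightarrow>
        dist (sum a Y) (L2_inner (M \<Otimes>\<^sub>M M) F H) < - Re (L2_inner (M \<Otimes>\<^sub>M M) F H)"
      by simp
    define N where "N = Suc (\<Sum>n\<in>X. fst (prod_decode n) + snd (prod_decode n))"
    define Y where "Y = prod_encode ` ({..<N} \<times> {..<N})"
    have "X \<subseteq> Y"
    proof
      fix n assume "n \<in> X"
      then have "fst (prod_decode n) + snd (prod_decode n) < N"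
        using member_le_sum[of n X "\<lambda>n. fst (prod_decode n) + snd (prod_decode n)"] X by (simp add: N_def)
      then have "prod_decode n \<in> {..<N} \<times> {..<N}" unfolding mem_Times_iff by simp
      then show "n \<in> Y" unfolding Y_def by (intro image_eqI[of n prod_encode "prod_decode n"]) simp
    qed
    then have "dist (sum a Y) (L2_inner (M \<Otimes>\<^sub>M M) F H) < - Re (L2_inner (M \<Otimes>\<^sub>M M) F H)"
      by (intro XY) (auto simp: Y_def)
    then have "Re (sum a Y) < 0"
      using abs_Re_le_cmod[of "sum a Y - L2_inner (M \<Otimes>\<^sub>M M) F H"] unfolding dist_norm minus_complex.sel by linarith
    moreover have "sum a Y = (\<Sum>j<N. \<Sum>k<N. cnj (A j k) * D j k)"
      unfolding Y_def
      unfolding sum.reindex[OF inj_on_subset[OF inj_prod_encode subset_UNIV]] sum.cartesian_product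
      by (intro sum.cong refl) (simp add: a_def case_prod_beta)
    moreover have "0 \<le> Re (\<Sum>j<N. \<Sum>k<N. cnj (A j k) * D j k)"
      unfolding A_def D_def by (intro psd_matrix_Frobenius_nonneg psd_matrix_form b d)
    ultimately show False by simp
  qed
  have "L2_inner (M \<Otimes>\<^sub>M M) F H = (\<integral>z. complex_of_real (\<phi> (fst z) * \<phi> (snd z) * (cmod (K (fst z) (snd z)))\<^sup>2) \<partial>(M \<Otimes>\<^sub>M M))"
    unfolding L2_inner_def
  proof (intro Bochner_Integration.integral_cong refl)
    fix z :: "'a \<times> 'a"
    obtain x y where z: "z = (x, y)" by (cases z)
    have "u x * \<phi> x = \<phi> x" for x using \<phi>(4)[of x] by (auto simp: u_def indicator_def)
    then have "complex_of_real (u x) * of_real (\<phi> x) = of_real (\<phi> x)" for x by (simp only: of_real_mult[symmetric])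
    then have *: "cnj (of_real (u x) * K x y * of_real (u y)) * (of_real (\<phi> x) * K x y * of_real (\<phi> y)) =
      of_real (\<phi> x) * of_real (\<phi> y) * (K x y * cnj (K x y))"
    proof -
      have "cnj (of_real (u x) * K x y * of_real (u y)) * (of_real (\<phi> x) * K x y * of_real (\<phi> y)) =
        (of_real (u x) * of_real (\<phi> x)) * (of_real (u y) * of_real (\<phi> y)) * (K x y * cnj (K x y))"
        by (simp only: complex_cnj_mult complex_cnj_complex_of_real mult_ac)
      then show ?thesis unfolding \<open>\<And>x. complex_of_real (u x) * of_real (\<phi> x) = of_real (\<phi> x)\<close> .
    qed
    show "cnj (F z) * H z = complex_of_real (\<phi> (fst z) * \<phi> (snd z) * (cmod (K (fst z) (snd z)))\<^sup>2)"
      using * unfolding complex_norm_square[symmetric] by (simp add: z F_def H_def)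
  qed
  then show ?thesis using nonneg unfolding integral_complex_of_real by (simp only: Re_complex_of_real)
qed

end

section \<open>The variance of linear statistics\<close>

lemma alpha_det_1: "alpha_det \<alpha> 1 A = A 0 0"
proof -
  have "{\<sigma>. \<sigma> permutes {..<1::nat}} = {id}"
    using permutes_sing[of _ "0::nat"] by (auto simp: lessThan_Suc)
  then show ?thesis by (simp add: alpha_det_def num_cycles_def lessThan_Suc)
qed

text \<open>The identity has two cycles and the transposition one, so \<alpha> enters with exponents
  0 and 1.\<close>

lemma alpha_det_2: "alpha_det \<alpha> 2 A = A 0 0 * A 1 1 + of_real \<alpha> * (A 0 1 * A 1 0)"
proof -
  have s: "{..<2::nat} = {0, 1}" by auto
  let ?t = "Transposition.transpose (0::nat) 1"
  have p: "{\<sigma>. \<sigma> permutes {..<2::nat}} = {id, ?t}"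
    unfolding s by (auto simp: permutes_doubleton_iff)
  have neq: "id \<noteq> ?t" by (metis id_apply transpose_apply_first zero_neq_one)
  have o1: "orbit id x = {x}" for x :: nat
  proof -
    have "orbit id x \<subseteq> {x}" by (rule subsetI) (erule orbit.induct, auto)
    moreover have "x \<in> orbit id x" using orbit.base[of id x] by simp
    ultimately show ?thesis by auto
  qed
  have "orbit ?t 0 = {0, 1}" "orbit ?t 1 = {0, 1}"
  proof -
    have "orbit ?t x \<subseteq> {0, 1}" if "x \<in> {0, 1}" for x
      using that by (intro subsetI) (erule orbit.induct, auto)
    moreover have "{0, 1} \<subseteq> orbit ?t x" if "x \<in> {0, 1}" for x
      using that orbit.base[of ?t x] orbit.step[of "?t x" ?t x] by auto
    ultimately show "orbit ?t 0 = {0, 1}" "orbit ?t 1 = {0, 1}" by blast+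
  qed
  then have "num_cycles 2 ?t = 1" unfolding num_cycles_def s by simp
  moreover have "num_cycles 2 id = 2"
    unfolding num_cycles_def s by (simp add: o1)
  ultimately show ?thesis
    unfolding alpha_det_def p using neq by (simp add: s)
qed

section \<open>Correlation identities for one and two points\<close>

lemma correlation_functionD:
  assumes "correlation_function P X M n \<rho>"
  shows "AE t in Pi\<^sub>M {..<n} (\<lambda>_. M). \<rho> t \<in> \<real>\<^sub>\<ge>\<^sub>0"
    and "h \<in> borel_measurable (Pi\<^sub>M {..<n} (\<lambda>_. M)) \<Longrightarrow>
      (\<integral>\<^sup>+\<omega>. (\<integral>\<^sup>+t. h t \<partial>count_space {t \<in> {..<n} \<rightarrow>\<^sub>E X \<omega>. inj_on t {..<n}}) \<partial>P) =
        (\<integral>\<^sup>+t. h t * ennreal (Re (\<rho> t)) \<partial>Pi\<^sub>M {..<n} (\<lambda>_. M))"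
proof -
  note c = assms[unfolded correlation_function_def]
  show "AE t in Pi\<^sub>M {..<n} (\<lambda>_. M). \<rho> t \<in> \<real>\<^sub>\<ge>\<^sub>0"
    by (rule c[THEN conjunct2, THEN conjunct1])
  show "h \<in> borel_measurable (Pi\<^sub>M {..<n} (\<lambda>_. M)) \<Longrightarrow>
      (\<integral>\<^sup>+\<omega>. (\<integral>\<^sup>+t. h t \<partial>count_space {t \<in> {..<n} \<rightarrow>\<^sub>E X \<omega>. inj_on t {..<n}}) \<partial>P) =
        (\<integral>\<^sup>+t. h t * ennreal (Re (\<rho> t)) \<partial>Pi\<^sub>M {..<n} (\<lambda>_. M))"
    by (rule c[THEN conjunct2, THEN conjunct2, THEN bspec])
qed

text \<open>Translates the injective maps on \<open>{..<2}\<close> from the factorial moment formula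
  into ordered pairs of distinct points, where the binary product measure is available.\<close>

lemma bij_betw_distinct_pairs:
  "bij_betw (\<lambda>z. \<lambda>i\<in>{..<2::nat}. if i = 0 then fst z else snd z) {z \<in> Y \<times> Y. fst z \<noteq> snd z}
    {t \<in> {..<2} \<rightarrow>\<^sub>E Y. inj_on t {..<2}}"
proof (rule bij_betwI[where g = "\<lambda>t. (t 0, t 1)"])
  let ?f = "\<lambda>z::'a \<times> 'a. \<lambda>i\<in>{..<2::nat}. if i = 0 then fst z else snd z"
  show "?f \<in> {z \<in> Y \<times> Y. fst z \<noteq> snd z} \<rightarrow> {t \<in> {..<2} \<rightarrow>\<^sub>E Y. inj_on t {..<2}}"
  proof (rule Pi_I)
    fix z assume "z \<in> {z \<in> Y \<times> Y. fst z \<noteq> snd z}"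
    then have z: "fst z \<in> Y" "snd z \<in> Y" "fst z \<noteq> snd z" unfolding mem_Collect_eq mem_Times_iff by blast+
    have "?f z \<in> {..<2} \<rightarrow>\<^sub>E Y"
      using z unfolding restrict_PiE_iff by simp
    moreover have "inj_on (?f z) {..<2}"
    proof (rule inj_onI)
      fix i j assume ij: "i \<in> {..<2}" "j \<in> {..<2}" "?f z i = ?f z j"
      then have "(if i = 0 then fst z else snd z) = (if j = 0 then fst z else snd z)"
        by (simp only: restrict_apply if_True)
      with z(3) have "i = 0 \<longleftrightarrow> j = 0" by presburger
      then show "i = j" using ij(1,2) unfolding lessThan_iff by presburger
    qed
    ultimately show "?f z \<in> {t \<in> {..<2} \<rightarrow>\<^sub>E Y. inj_on t {..<2}}" unfolding mem_Collect_eq by (rule conjI)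
  qed
  show "(\<lambda>t. (t 0, t 1)) \<in> {t \<in> {..<2} \<rightarrow>\<^sub>E Y. inj_on t {..<2::nat}} \<rightarrow> {z \<in> Y \<times> Y. fst z \<noteq> snd z}"
  proof (rule Pi_I)
    fix t assume "t \<in> {t \<in> {..<2::nat} \<rightarrow>\<^sub>E Y. inj_on t {..<2}}"
    then have t: "t \<in> {..<2::nat} \<rightarrow>\<^sub>E Y" "inj_on t {..<2}" by (simp_all only: mem_Collect_eq)
    have "t 0 \<in> Y" "t 1 \<in> Y" by (rule PiE_mem[OF t(1)], simp)+
    moreover have "t 0 \<noteq> t 1" using inj_on_eq_iff[OF t(2), of 0 1] by simp
    ultimately show "(t 0, t 1) \<in> {z \<in> Y \<times> Y. fst z \<noteq> snd z}" by simp
  qed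
  show "(?f z 0, ?f z 1) = z" for z by simp
  show "?f (t 0, t 1) = t" if "t \<in> {t \<in> {..<2} \<rightarrow>\<^sub>E Y. inj_on t {..<2}}" for t
  proof
    fix i :: nat
    have ext: "t \<in> extensional {..<2}" using that by (simp only: mem_Collect_eq PiE_iff)
    have "t i = undefined" if "\<not> i < 2"
      by (rule extensional_arb[OF ext]) (use that in simp)
    moreover have "i = 0 \<or> i = 1 \<or> \<not> i < 2" by linarith
    ultimately show "?f (t 0, t 1) i = t i" by (elim disjE) simp_all
  qed
qed
locale alpha_process = positive_kernel M K
  for M :: "'a::euclidean_space measure" and K :: "'a \<Rightarrow> 'a \<Rightarrow> complex" +
  fixes P :: "'w measure" and X :: "'w \<Rightarrow> 'a set" and \<alpha> :: real
  assumes process: "alpha_determinantal_process P X \<alpha> K M"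
begin

sublocale prob: prob_space P
  using process unfolding alpha_determinantal_process_def by blast

interpretation prod: product_sigma_finite "\<lambda>_::nat. M"
  by (rule product_sigma_finite.intro) (rule sigma_finite_M)

definition k :: "'a \<Rightarrow> real" where "k x = Re (K x x)"

definition w :: "'a \<Rightarrow> 'a \<Rightarrow> real" where "w x y = (cmod (K x y))\<^sup>2"

text \<open>The two-point correlation function in real form: its terms come from the identity and
  the transposition in the \<alpha>-determinant of order two.\<close>

definition \<rho> :: "'a \<Rightarrow> 'a \<Rightarrow> real" where "\<rho> x y = k x * k y + \<alpha> * w x y"

lemma k_measurable [measurable]: "k \<in> borel_measurable M"
  unfolding k_def[abs_def] by measurable

lemma w_measurable [measurable]: "(\<lambda>(x, y). w x y) \<in> borel_measurable (M \<Otimes>\<^sub>M M)"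
  unfolding w_def by measurable

lemma w_measurable2 [measurable (raw)]:
  "f \<in> N \<rightarrow>\<^sub>M M \<Longrightarrow> g \<in> N \<rightarrow>\<^sub>M M \<Longrightarrow> (\<lambda>z. w (f z) (g z)) \<in> borel_measurable N"
  using measurable_compose[OF measurable_Pair w_measurable, of f N g] by simp

lemma w_nonneg [simp]: "0 \<le> w x y" by (simp add: w_def)

lemma w_commute: "w x y = w y x" unfolding w_def by (subst kernel_norm_sym) simp

lemma rho_measurable2 [measurable (raw)]:
  "f \<in> N \<rightarrow>\<^sub>M M \<Longrightarrow> g \<in> N \<rightarrow>\<^sub>M M \<Longrightarrow> (\<lambda>z. \<rho> (f z) (g z)) \<in> borel_measurable N"
  unfolding \<rho>_def
  by (intro borel_measurable_add borel_measurable_times borel_measurable_const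
      measurable_compose[OF _ k_measurable] w_measurable2)

lemma alpha_det_kernel_2:
  "Re (alpha_det \<alpha> 2 (\<lambda>i j. K (t i) (t j))) = \<rho> (t 0) (t 1)"
proof -
  have "K (t 0) (t 1) * K (t 1) (t 0) = of_real (w (t 0) (t 1))"
    unfolding w_def complex_norm_square by (subst kernel_herm[of "t 1"]) simp
  moreover have "K (t 0) (t 0) * K (t 1) (t 1) = of_real (k (t 0) * k (t 1))"
    unfolding k_def of_real_mult by (subst (1 2) diag_real) simp
  ultimately show ?thesis unfolding alpha_det_2 \<rho>_def by simp
qed

lemma correlation: "1 \<le> n \<Longrightarrow> correlation_function P X M n (\<lambda>t. alpha_det \<alpha> n (\<lambda>i j. K (t i) (t j)))"
  using process unfolding alpha_determinantal_process_def by (elim conjE allE[of _ n]) (erule mp)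

lemma correlation_1:
  assumes [measurable]: "g \<in> borel_measurable M"
  shows "(\<integral>\<^sup>+\<omega>. (\<integral>\<^sup>+x. g x \<partial>count_space (X \<omega>)) \<partial>P) = (\<integral>\<^sup>+x. g x * ennreal (k x) \<partial>M)"
proof -
  have s: "{..<1::nat} = {0}" by auto
  have gm: "(\<lambda>t. g (t 0)) \<in> borel_measurable (Pi\<^sub>M {..<1::nat} (\<lambda>_. M))"
    unfolding s by measurable
  have "(\<integral>\<^sup>+t. g (t 0) \<partial>count_space {t \<in> {..<1::nat} \<rightarrow>\<^sub>E Y. inj_on t {..<1}}) =
      (\<integral>\<^sup>+x. g x \<partial>count_space Y)" for Y
  proof -
    have "bij_betw (\<lambda>x. \<lambda>i\<in>{..<1::nat}. x) Y {t \<in> {..<1::nat} \<rightarrow>\<^sub>E Y. inj_on t {..<1}}"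
    proof (rule bij_betwI[where g = "\<lambda>t. t 0"])
      fix t assume "t \<in> {t \<in> {..<1::nat} \<rightarrow>\<^sub>E Y. inj_on t {..<1}}"
      then show "(\<lambda>i\<in>{..<1}. t 0) = t" by (auto simp: fun_eq_iff PiE_def extensional_def)
    qed (auto simp: inj_on_def less_Suc_eq PiE_def extensional_def)
    from nn_integral_bij_count_space[OF this, of "\<lambda>t. g (t 0)"] show ?thesis by simp
  qed
  then have "(\<integral>\<^sup>+\<omega>. (\<integral>\<^sup>+x. g x \<partial>count_space (X \<omega>)) \<partial>P) =
      (\<integral>\<^sup>+\<omega>. (\<integral>\<^sup>+t. g (t 0) \<partial>count_space {t \<in> {..<1::nat} \<rightarrow>\<^sub>E X \<omega>. inj_on t {..<1}}) \<partial>P)"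
    by simp
  also have "\<dots> = (\<integral>\<^sup>+t. g (t 0) * ennreal (k (t 0)) \<partial>Pi\<^sub>M {..<1::nat} (\<lambda>_. M))"
    using correlation_functionD(2)[OF correlation gm] unfolding alpha_det_1 k_def by simp
  also have "\<dots> = (\<integral>\<^sup>+x. g x * ennreal (k x) \<partial>M)"
    unfolding s by (rule prod.product_nn_integral_singleton) measurable
  finally show ?thesis .
qed

lemma correlation_2:
  assumes [measurable]: "(\<lambda>(x, y). g x y) \<in> borel_measurable (M \<Otimes>\<^sub>M M)"
  shows "(\<integral>\<^sup>+\<omega>. (\<integral>\<^sup>+z. g (fst z) (snd z) \<partial>count_space {z \<in> X \<omega> \<times> X \<omega>. fst z \<noteq> snd z}) \<partial>P) =
    (\<integral>\<^sup>+z. g (fst z) (snd z) * ennreal (\<rho> (fst z) (snd z)) \<partial>(M \<Otimes>\<^sub>M M))"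
proof -
  have s: "{..<2::nat} = {0, 1}" by auto
  have gm: "(\<lambda>t. g (t 0) (t 1)) \<in> borel_measurable (Pi\<^sub>M {..<2::nat} (\<lambda>_. M))"
  proof -
    have "(\<lambda>t. (t 0, t 1)) \<in> Pi\<^sub>M {..<2::nat} (\<lambda>_. M) \<rightarrow>\<^sub>M M \<Otimes>\<^sub>M M"
      by (intro measurable_Pair measurable_component_singleton) auto
    from measurable_compose[OF this assms] show ?thesis by (simp only: prod.case)
  qed
  have "(\<integral>\<^sup>+t. g (t 0) (t 1) \<partial>count_space {t \<in> {..<2::nat} \<rightarrow>\<^sub>E Y. inj_on t {..<2}}) =
      (\<integral>\<^sup>+z. g (fst z) (snd z) \<partial>count_space {z \<in> Y \<times> Y. fst z \<noteq> snd z})" for Y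
    using nn_integral_bij_count_space[OF bij_betw_distinct_pairs, of Y "\<lambda>t. g (t 0) (t 1)"] by simp
  then have "(\<integral>\<^sup>+\<omega>. (\<integral>\<^sup>+z. g (fst z) (snd z) \<partial>count_space {z \<in> X \<omega> \<times> X \<omega>. fst z \<noteq> snd z}) \<partial>P) =
      (\<integral>\<^sup>+\<omega>. (\<integral>\<^sup>+t. g (t 0) (t 1) \<partial>count_space {t \<in> {..<2::nat} \<rightarrow>\<^sub>E X \<omega>. inj_on t {..<2}}) \<partial>P)"
    by simp
  also have "\<dots> = (\<integral>\<^sup>+t. g (t 0) (t 1) * ennreal (\<rho> (t 0) (t 1)) \<partial>Pi\<^sub>M {..<2::nat} (\<lambda>_. M))"
    using correlation_functionD(2)[OF correlation gm] unfolding alpha_det_kernel_2 by simp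
  also have "\<dots> = (\<integral>\<^sup>+z. g (fst z) (snd z) * ennreal (\<rho> (fst z) (snd z)) \<partial>(M \<Otimes>\<^sub>M M))"
    unfolding s by (rule prod.product_nn_integral_pair) measurable
  finally show ?thesis .
qed

text \<open>Nonnegativity is given on the product indexed by \<open>{..<2}\<close>; integrating the
  indicator of the negative set carries it over to the measure on pairs.\<close>

lemma AE_rho_nonneg: "AE z in M \<Otimes>\<^sub>M M. 0 \<le> \<rho> (fst z) (snd z)"
proof -
  have s: "{..<2::nat} = {0, 1}" by auto
  define g :: "'a \<Rightarrow> 'a \<Rightarrow> ennreal" where "g x y = (if \<rho> x y < 0 then 1 else 0)" for x y
  have gm [measurable]: "(\<lambda>(x, y). g x y) \<in> borel_measurable (M \<Otimes>\<^sub>M M)"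
    unfolding g_def by measurable
  have "AE t in Pi\<^sub>M {..<2} (\<lambda>_. M). alpha_det \<alpha> 2 (\<lambda>i j. K (t i) (t j)) \<in> \<real>\<^sub>\<ge>\<^sub>0"
    by (rule correlation_functionD(1)[OF correlation]) simp
  then have "AE t in Pi\<^sub>M {..<2::nat} (\<lambda>_. M). g (t 0) (t 1) = 0"
  proof eventually_elim
    case (elim t)
    then have "0 \<le> \<rho> (t 0) (t 1)" unfolding alpha_det_kernel_2[symmetric] nonneg_Reals_def by auto
    then show ?case by (simp add: g_def)
  qed
  then have "(\<integral>\<^sup>+t. g (t 0) (t 1) \<partial>Pi\<^sub>M {..<2::nat} (\<lambda>_. M)) = (\<integral>\<^sup>+t. 0 \<partial>Pi\<^sub>M {..<2::nat} (\<lambda>_. M))"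
    by (intro nn_integral_cong_AE)
  moreover have "(\<integral>\<^sup>+t. g (t 0) (t 1) \<partial>Pi\<^sub>M {..<2::nat} (\<lambda>_. M)) = (\<integral>\<^sup>+z. g (fst z) (snd z) \<partial>(M \<Otimes>\<^sub>M M))"
    unfolding s by (rule prod.product_nn_integral_pair) measurable
  ultimately have "(\<integral>\<^sup>+z. g (fst z) (snd z) \<partial>(M \<Otimes>\<^sub>M M)) = 0" by simp
  then have "AE z in M \<Otimes>\<^sub>M M. g (fst z) (snd z) = 0"
    by (subst (asm) nn_integral_0_iff_AE) (auto simp: case_prod_beta[symmetric])
  then show ?thesis by eventually_elim (auto simp: g_def split: if_splits)
qed

section \<open>Linear statistics as random variables\<close>

abbreviation "S \<phi> \<omega> \<equiv> linear_statistic \<phi> (X \<omega>)"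

lemma finite_points: "\<omega> \<in> space P \<Longrightarrow> compact B \<Longrightarrow> finite (X \<omega> \<inter> B)"
  using process unfolding alpha_determinantal_process_def random_locally_finite_set_def by blast

lemma S_eq_sum:
  assumes "\<omega> \<in> space P" "compact B" "\<And>x. x \<notin> B \<Longrightarrow> \<phi> x = 0"
  shows "S \<phi> \<omega> = (\<Sum>x\<in>X \<omega> \<inter> B. \<phi> x)"
proof -
  have "S \<phi> \<omega> = infsum \<phi> (X \<omega> \<inter> B)"
    unfolding linear_statistic_def by (rule infsum_cong_neutral) (use assms(3) in auto)
  then show ?thesis using finite_points[OF assms(1,2)] by simp
qed

text \<open>What is known to be measurable are the counts of points in bounded Borel sets. The
  statistic of a simple function cut off to \<open>B\<close> is a finite combination of such counts,
  and for each outcome the sum is finite and commutes with the pointwise limit.\<close>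

lemma S_measurable:
  assumes \<phi>: "\<phi> \<in> borel_measurable borel" and B: "compact B" "\<And>x. x \<notin> B \<Longrightarrow> \<phi> x = 0"
  shows "S \<phi> \<in> borel_measurable P"
proof -
  obtain s where s: "\<And>i. simple_function borel (s i)" "\<And>x. (\<lambda>i. s i x) \<longlonglongrightarrow> \<phi> x"
    using borel_measurable_implies_sequence_metric[OF \<phi>, of 0] by auto
  have Bm [measurable]: "B \<in> sets borel" using B by (simp add: borel_compact)
  have count: "(\<lambda>\<omega>. real (card (X \<omega> \<inter> D))) \<in> borel_measurable P" if "D \<in> sets borel" "bounded D" for D
  proof -
    have "(\<lambda>\<omega>. card (X \<omega> \<inter> D)) \<in> measurable P (count_space UNIV)"
      using that process unfolding alpha_determinantal_process_def random_locally_finite_set_def by blast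
    then show ?thesis by measurable
  qed
  have meas: "(\<lambda>\<omega>. \<Sum>x\<in>X \<omega> \<inter> B. s i x) \<in> borel_measurable P" for i
  proof -
    have fin: "finite (range (s i))" using s(1)[of i] by (simp add: simple_function_def)
    have lev: "s i -` {y} \<in> sets borel" if "y \<in> range (s i)" for y
      using s(1)[of i] that by (auto simp: simple_function_def)
    have "(\<Sum>x\<in>X \<omega> \<inter> B. s i x) = (\<Sum>y\<in>range (s i). y * real (card (X \<omega> \<inter> (B \<inter> s i -` {y}))))"
      if "\<omega> \<in> space P" for \<omega>
    proof -
      have finX: "finite (X \<omega> \<inter> B)" by (rule finite_points[OF that B(1)])
      have "(\<Sum>x\<in>X \<omega> \<inter> B. s i x) = (\<Sum>y\<in>range (s i). \<Sum>x | x \<in> X \<omega> \<inter> B \<and> s i x = y. s i x)"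
        by (rule sum.group[symmetric]) (use finX fin in auto)
      also have "\<dots> = (\<Sum>y\<in>range (s i). y * real (card (X \<omega> \<inter> (B \<inter> s i -` {y}))))"
      proof (rule sum.cong[OF refl])
        fix y
        have "{x. x \<in> X \<omega> \<inter> B \<and> s i x = y} = X \<omega> \<inter> (B \<inter> s i -` {y})" by auto
        moreover have "(\<Sum>x\<in>X \<omega> \<inter> (B \<inter> s i -` {y}). s i x) = (\<Sum>x\<in>X \<omega> \<inter> (B \<inter> s i -` {y}). y)"
          by (rule sum.cong) auto
        ultimately show "(\<Sum>x | x \<in> X \<omega> \<inter> B \<and> s i x = y. s i x) = y * real (card (X \<omega> \<inter> (B \<inter> s i -` {y})))"
          by simp
      qed
      finally show ?thesis .
    qed
    moreover have "(\<lambda>\<omega>. \<Sum>y\<in>range (s i). y * real (card (X \<omega> \<inter> (B \<inter> s i -` {y})))) \<in> borel_measurable P"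
      using lev Bm compact_imp_bounded[OF B(1)]
      by (intro borel_measurable_sum borel_measurable_times count) (auto intro: bounded_subset)
    ultimately show ?thesis by (subst measurable_cong)
  qed
  have "(\<lambda>\<omega>. \<Sum>x\<in>X \<omega> \<inter> B. \<phi> x) \<in> borel_measurable P"
    by (rule borel_measurable_LIMSEQ_metric[where f = "\<lambda>i \<omega>. \<Sum>x\<in>X \<omega> \<inter> B. s i x"])
      (rule meas, intro tendsto_sum s(2))
  then show ?thesis using S_eq_sum[OF _ B] by (subst measurable_cong)
qed

end

section \<open>Test functions and the exact variance\<close>

context alpha_process
begin

lemma borel_M: "f \<in> borel_measurable borel \<Longrightarrow> f \<in> borel_measurable M"
  by (simp add: measurable_cong_sets[OF sets_M refl])

lemma AE_k_nonneg: "AE x in M. 0 \<le> k x"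
proof -
  interpret prod: product_sigma_finite "\<lambda>_::nat. M"
    by (rule product_sigma_finite.intro) (rule sigma_finite_M)
  have s: "{..<1::nat} = {0}" by auto
  define g :: "'a \<Rightarrow> ennreal" where "g x = (if k x < 0 then 1 else 0)" for x
  have gm [measurable]: "g \<in> borel_measurable M" unfolding g_def by measurable
  have "AE t in Pi\<^sub>M {..<1} (\<lambda>_. M). alpha_det \<alpha> 1 (\<lambda>i j. K (t i) (t j)) \<in> \<real>\<^sub>\<ge>\<^sub>0"
    by (rule correlation_functionD(1)[OF correlation]) simp
  then have "AE t in Pi\<^sub>M {..<1::nat} (\<lambda>_. M). g (t 0) = 0"
  proof eventually_elim
    case (elim t)
    then have "0 \<le> k (t 0)" unfolding alpha_det_1 k_def nonneg_Reals_def by auto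
    then show ?case by (simp add: g_def)
  qed
  then have "(\<integral>\<^sup>+t. g (t 0) \<partial>Pi\<^sub>M {..<1::nat} (\<lambda>_. M)) = (\<integral>\<^sup>+t. 0 \<partial>Pi\<^sub>M {..<1::nat} (\<lambda>_. M))"
    by (intro nn_integral_cong_AE)
  moreover have "(\<integral>\<^sup>+t. g (t 0) \<partial>Pi\<^sub>M {..<1::nat} (\<lambda>_. M)) = (\<integral>\<^sup>+x. g x \<partial>M)"
    unfolding s by (rule prod.product_nn_integral_singleton) measurable
  ultimately have "(\<integral>\<^sup>+x. g x \<partial>M) = 0" by simp
  then have "AE x in M. g x = 0" by (subst (asm) nn_integral_0_iff_AE) auto
  then show ?thesis by eventually_elim (auto simp: g_def split: if_splits)
qed

text \<open>This class is closed under products and under positive and negative parts, the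
  operations that second moments call for.\<close>

definition test_function :: "('a \<Rightarrow> real) \<Rightarrow> bool" where
  "test_function \<phi> \<longleftrightarrow> \<phi> \<in> borel_measurable borel \<and> bounded (range \<phi>) \<and> (\<exists>B. compact B \<and> (\<forall>x. x \<notin> B \<longrightarrow> \<phi> x = 0))"

lemma test_functionE:
  assumes "test_function \<phi>"
  obtains C B where "\<phi> \<in> borel_measurable borel" "\<phi> \<in> borel_measurable M" "C \<ge> 0" "\<And>x. \<bar>\<phi> x\<bar> \<le> C"
    "compact B" "\<And>x. x \<notin> B \<Longrightarrow> \<phi> x = 0"
proof -
  obtain C where C: "\<And>x. norm (\<phi> x) \<le> C" using assms unfolding test_function_def bounded_iff by auto
  moreover have "C \<ge> 0" using C[of undefined] norm_ge_zero order_trans by blast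
  moreover obtain B where "compact B" "\<And>x. x \<notin> B \<Longrightarrow> \<phi> x = 0" using assms unfolding test_function_def by auto
  ultimately show ?thesis using that[of C B] assms borel_M unfolding test_function_def by auto
qed

lemma test_functionI:
  "\<phi> \<in> borel_measurable borel \<Longrightarrow> (\<And>x. \<bar>\<phi> x\<bar> \<le> C) \<Longrightarrow> compact B \<Longrightarrow> (\<And>x. x \<notin> B \<Longrightarrow> \<phi> x = 0) \<Longrightarrow> test_function \<phi>"
  unfolding test_function_def bounded_iff by auto

lemma test_function_mult:
  assumes "test_function a" "test_function b"
  shows "test_function (\<lambda>x. a x * b x)"
proof -
  obtain C B where a: "a \<in> borel_measurable borel" "a \<in> borel_measurable M" "C \<ge> 0" "\<And>x. \<bar>a x\<bar> \<le> C" "compact B" "\<And>x. x \<notin> B \<Longrightarrow> a x = 0"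
    using test_functionE[OF assms(1)] by blast
  obtain C' B' where b: "b \<in> borel_measurable borel" "b \<in> borel_measurable M" "C' \<ge> 0" "\<And>x. \<bar>b x\<bar> \<le> C'" "compact B'" "\<And>x. x \<notin> B' \<Longrightarrow> b x = 0"
    using test_functionE[OF assms(2)] by blast
  show ?thesis
    by (rule test_functionI[where C = "C * C'" and B = B])
      (use a b in \<open>auto simp: abs_mult intro!: mult_mono\<close>)
qed

lemma test_function_pos_part:
  assumes "test_function \<phi>"
  shows "test_function (\<lambda>x. max (\<phi> x) 0)" "test_function (\<lambda>x. max (- \<phi> x) 0)"
proof -
  obtain C B where a: "\<phi> \<in> borel_measurable borel" "\<phi> \<in> borel_measurable M" "C \<ge> 0" "\<And>x. \<bar>\<phi> x\<bar> \<le> C" "compact B" "\<And>x. x \<notin> B \<Longrightarrow> \<phi> x = 0"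
    using test_functionE[OF assms] by blast
  have "\<bar>max (\<phi> x) 0\<bar> \<le> C" "\<bar>max (- \<phi> x) 0\<bar> \<le> C" for x using a(4)[of x] by auto
  then show "test_function (\<lambda>x. max (\<phi> x) 0)" "test_function (\<lambda>x. max (- \<phi> x) 0)"
    using a by (auto intro!: test_functionI[where C = C and B = B])
qed

lemma S_test_measurable: "test_function \<phi> \<Longrightarrow> S \<phi> \<in> borel_measurable P"
  by (erule test_functionE) (rule S_measurable)

lemma k_integrable:
  assumes "test_function a"
  shows "integrable M (\<lambda>x. a x * k x)"
proof -
  obtain C B where a: "a \<in> borel_measurable borel" "a \<in> borel_measurable M" "C \<ge> 0" "\<And>x. \<bar>a x\<bar> \<le> C" "compact B" "\<And>x. x \<notin> B \<Longrightarrow> a x = 0"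
    using test_functionE[OF assms] by blast
  note [measurable] = a(2)
  have "integrable M (\<lambda>x. indicator B x *\<^sub>R K x x)"
    using diag_integrable[OF a(5)] unfolding set_integrable_def .
  then have "integrable M (\<lambda>x. C * Re (indicator B x *\<^sub>R K x x))" by (intro integrable_mult_right integrable_Re)
  then show ?thesis
  proof (rule Bochner_Integration.integrable_bound)
    have "norm (a x * k x) \<le> norm (C * Re (indicator B x *\<^sub>R K x x))" for x
      using a(3) a(4)[of x] a(6)[of x] by (cases "x \<in> B") (auto simp: k_def abs_mult intro!: mult_right_mono)
    then show "AE x in M. norm (a x * k x) \<le> norm (C * Re (indicator B x *\<^sub>R K x x))" by simp
  qed measurable
qed

lemma integrable_fst_mult_snd:
  fixes f g :: "'a \<Rightarrow> real"
  assumes f: "integrable M f" and g: "integrable M g"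
  shows "integrable (M \<Otimes>\<^sub>M M) (\<lambda>z. f (fst z) * g (snd z))"
    "(\<integral>z. f (fst z) * g (snd z) \<partial>(M \<Otimes>\<^sub>M M)) = (\<integral>x. f x \<partial>M) * (\<integral>x. g x \<partial>M)"
proof -
  note [measurable] = borel_measurable_integrable[OF f] borel_measurable_integrable[OF g]
  show *: "integrable (M \<Otimes>\<^sub>M M) (\<lambda>z. f (fst z) * g (snd z))"
    by (rule Fubini_integrable) (use f g in \<open>auto simp: abs_mult\<close>)
  show "(\<integral>z. f (fst z) * g (snd z) \<partial>(M \<Otimes>\<^sub>M M)) = (\<integral>x. f x \<partial>M) * (\<integral>x. g x \<partial>M)"
    using integral_fst'[OF *] by simp
qed

lemma w_integrable:
  assumes "test_function a" "test_function b"
  shows "integrable (M \<Otimes>\<^sub>M M) (\<lambda>z. a (fst z) * b (snd z) * w (fst z) (snd z))"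
proof -
  obtain C B where a: "a \<in> borel_measurable borel" "a \<in> borel_measurable M" "C \<ge> 0" "\<And>x. \<bar>a x\<bar> \<le> C" "compact B" "\<And>x. x \<notin> B \<Longrightarrow> a x = 0"
    using test_functionE[OF assms(1)] by blast
  obtain C' B' where b: "b \<in> borel_measurable borel" "b \<in> borel_measurable M" "C' \<ge> 0" "\<And>x. \<bar>b x\<bar> \<le> C'" "compact B'" "\<And>x. x \<notin> B' \<Longrightarrow> b x = 0"
    using test_functionE[OF assms(2)] by blast
  note [measurable] = a(2) b(2)
  define D where "D = B \<union> B'"
  define u :: "'a \<Rightarrow> real" where "u = indicator D"
  have D: "compact D" using a b by (simp add: D_def compact_Un)
  have "D \<in> sets borel" using D by (simp add: borel_compact)
  then have u: "u \<in> borel_measurable borel" "\<And>x. \<bar>u x\<bar> \<le> 1" "\<And>x. x \<notin> D \<Longrightarrow> u x = 0"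
    by (auto simp: u_def indicator_def)
  have "(\<lambda>(x, y). of_real (u x) * K x y * of_real (u y)) \<in> L2_space (M \<Otimes>\<^sub>M M)"
    by (rule L2_section_product[OF u(1,2) D u(3)])
  from L2_space_integrable[OF this]
  have "integrable (M \<Otimes>\<^sub>M M) (\<lambda>z. C * C' * (cmod (case z of (x, y) \<Rightarrow> of_real (u x) * K x y * of_real (u y)))\<^sup>2)"
    by (rule integrable_mult_right)
  then show ?thesis
  proof (rule Bochner_Integration.integrable_bound)
    have "\<bar>a x * b y * w x y\<bar> \<le> \<bar>C * C' * (cmod (of_real (u x) * K x y * of_real (u y)))\<^sup>2\<bar>" for x y
    proof (cases "x \<in> D \<and> y \<in> D")
      case True
      have "\<bar>a x * b y\<bar> \<le> C * C'" unfolding abs_mult by (intro mult_mono a b) auto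
      then have "\<bar>a x * b y\<bar> * w x y \<le> C * C' * w x y" by (rule mult_right_mono) simp
      then show ?thesis using True a(3) b(3) by (simp add: u_def w_def abs_mult)
    next
      case False
      then have "a x * b y * w x y = 0" using a(6)[of x] b(6)[of y] by (auto simp: D_def)
      then show ?thesis by (simp only: abs_zero abs_ge_zero)
    qed
    then show "AE z in M \<Otimes>\<^sub>M M. norm (a (fst z) * b (snd z) * w (fst z) (snd z)) \<le>
        norm (C * C' * (cmod (case z of (x, y) \<Rightarrow> of_real (u x) * K x y * of_real (u y)))\<^sup>2)"
      by (simp add: case_prod_beta)
  qed measurable
qed

lemma rho_integral:
  assumes "test_function a" "test_function b"
  shows "integrable (M \<Otimes>\<^sub>M M) (\<lambda>z. a (fst z) * b (snd z) * \<rho> (fst z) (snd z))"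
    "(\<integral>z. a (fst z) * b (snd z) * \<rho> (fst z) (snd z) \<partial>(M \<Otimes>\<^sub>M M)) =
      (\<integral>x. a x * k x \<partial>M) * (\<integral>x. b x * k x \<partial>M) + \<alpha> * (\<integral>z. a (fst z) * b (snd z) * w (fst z) (snd z) \<partial>(M \<Otimes>\<^sub>M M))"
proof -
  have eq: "a (fst z) * b (snd z) * \<rho> (fst z) (snd z) = (a (fst z) * k (fst z)) * (b (snd z) * k (snd z))
      + \<alpha> * (a (fst z) * b (snd z) * w (fst z) (snd z))" for z
    by (simp add: \<rho>_def algebra_simps)
  note 1 = integrable_fst_mult_snd[OF k_integrable[OF assms(1)] k_integrable[OF assms(2)]]
  note 2 = integrable_mult_right[OF w_integrable[OF assms], of \<alpha>]
  show "integrable (M \<Otimes>\<^sub>M M) (\<lambda>z. a (fst z) * b (snd z) * \<rho> (fst z) (snd z))"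
    unfolding eq using 1(1) 2 by (intro Bochner_Integration.integrable_add)
  show "(\<integral>z. a (fst z) * b (snd z) * \<rho> (fst z) (snd z) \<partial>(M \<Otimes>\<^sub>M M)) =
      (\<integral>x. a x * k x \<partial>M) * (\<integral>x. b x * k x \<partial>M) + \<alpha> * (\<integral>z. a (fst z) * b (snd z) * w (fst z) (snd z) \<partial>(M \<Otimes>\<^sub>M M))"
    unfolding eq Bochner_Integration.integral_add[OF 1(1) 2] 1(2) by simp
qed

text \<open>The correlation identity is one between \<open>ennreal\<close> integrals, hence the
  restriction to nonnegative \<open>a\<close>; finiteness of its right-hand side turns it into
  integrability of the statistic.\<close>

lemma S_mean_nonneg:
  assumes "test_function a" "\<And>x. 0 \<le> a x"
  shows "integrable P (S a) \<and> (\<integral>\<omega>. S a \<omega> \<partial>P) = (\<integral>x. a x * k x \<partial>M)"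
proof -
  obtain C B where a: "a \<in> borel_measurable borel" "a \<in> borel_measurable M" "C \<ge> 0" "\<And>x. \<bar>a x\<bar> \<le> C" "compact B" "\<And>x. x \<notin> B \<Longrightarrow> a x = 0"
    using test_functionE[OF assms(1)] by blast
  note [measurable] = a(2)
  have "(\<integral>\<^sup>+\<omega>. ennreal (S a \<omega>) \<partial>P) = (\<integral>\<^sup>+\<omega>. (\<integral>\<^sup>+x. ennreal (a x) \<partial>count_space (X \<omega>)) \<partial>P)"
  proof (rule nn_integral_cong)
    fix \<omega> assume \<omega>: "\<omega> \<in> space P"
    have "(\<integral>\<^sup>+x. ennreal (a x) \<partial>count_space (X \<omega>)) = (\<Sum>x\<in>X \<omega> \<inter> B. ennreal (a x))"
      using finite_points[OF \<omega> a(5)] a(6) by (intro nn_integral_count_space') auto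
    then show "ennreal (S a \<omega>) = (\<integral>\<^sup>+x. ennreal (a x) \<partial>count_space (X \<omega>))"
      using S_eq_sum[OF \<omega> a(5,6)] assms(2) by (simp add: sum_ennreal)
  qed
  also have "\<dots> = (\<integral>\<^sup>+x. ennreal (a x) * ennreal (k x) \<partial>M)" by (rule correlation_1) measurable
  also have "\<dots> = (\<integral>\<^sup>+x. ennreal (a x * k x) \<partial>M)"
    using assms(2) by (intro nn_integral_cong) (simp add: ennreal_mult')
  also have "\<dots> = ennreal (\<integral>x. a x * k x \<partial>M)"
    using AE_k_nonneg assms(2) by (intro nn_integral_eq_integral k_integrable assms) (auto elim!: eventually_mono)
  finally have eq: "(\<integral>\<^sup>+\<omega>. ennreal (S a \<omega>) \<partial>P) = ennreal (\<integral>x. a x * k x \<partial>M)" .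
  have nn: "AE \<omega> in P. 0 \<le> S a \<omega>"
    using S_eq_sum[OF _ a(5,6)] assms(2) by (intro AE_I2) (simp add: sum_nonneg)
  have "0 \<le> (\<integral>x. a x * k x \<partial>M)"
    using AE_k_nonneg assms(2) by (intro integral_nonneg_AE) (auto elim!: eventually_mono)
  then show ?thesis
    using eq nn S_test_measurable[OF assms(1)] by (subst (asm) nn_integral_eq_integrable) auto
qed

text \<open>For test functions this is the sum of a(x) b(y) over ordered pairs of distinct points:
  the product of the two statistics without its diagonal.\<close>

definition Q :: "('a \<Rightarrow> real) \<Rightarrow> ('a \<Rightarrow> real) \<Rightarrow> 'w \<Rightarrow> real" where
  "Q a b \<omega> = S a \<omega> * S b \<omega> - S (\<lambda>x. a x * b x) \<omega>"

lemma Q_mean_nonneg: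
  assumes "test_function a" "test_function b" "\<And>x. 0 \<le> a x" "\<And>x. 0 \<le> b x"
  shows "integrable P (Q a b) \<and>
    (\<integral>\<omega>. Q a b \<omega> \<partial>P) = (\<integral>z. a (fst z) * b (snd z) * \<rho> (fst z) (snd z) \<partial>(M \<Otimes>\<^sub>M M))"
proof -
  obtain C B1 where a: "a \<in> borel_measurable borel" "a \<in> borel_measurable M" "C \<ge> 0" "\<And>x. \<bar>a x\<bar> \<le> C" "compact B1" "\<And>x. x \<notin> B1 \<Longrightarrow> a x = 0"
    using test_functionE[OF assms(1)] by blast
  obtain C' B' where b: "b \<in> borel_measurable borel" "b \<in> borel_measurable M" "C' \<ge> 0" "\<And>x. \<bar>b x\<bar> \<le> C'" "compact B'" "\<And>x. x \<notin> B' \<Longrightarrow> b x = 0"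
    using test_functionE[OF assms(2)] by blast
  note [measurable] = a(2) b(2)
  define B where "B = B1 \<union> B'"
  have B: "compact B" using a b by (simp add: B_def compact_Un)
  have aB: "a x = 0" and bB: "b x = 0" if "x \<notin> B" for x using that a(6) b(6) by (auto simp: B_def)
  have Qsum: "Q a b \<omega> = (\<Sum>z | z \<in> (X \<omega> \<inter> B) \<times> (X \<omega> \<inter> B) \<and> fst z \<noteq> snd z. a (fst z) * b (snd z))"
    if \<omega>: "\<omega> \<in> space P" for \<omega>
  proof -
    define Y where "Y = X \<omega> \<inter> B"
    have Y: "finite Y" unfolding Y_def by (rule finite_points[OF \<omega> B])
    have "S a \<omega> * S b \<omega> = (\<Sum>z\<in>Y \<times> Y. a (fst z) * b (snd z))"
      using S_eq_sum[of \<omega> B a] S_eq_sum[of \<omega> B b] \<omega> B aB bB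
      by (simp add: Y_def sum_product sum.cartesian_product case_prod_beta)
    also have "\<dots> = (\<Sum>z | z \<in> Y \<times> Y \<and> fst z \<noteq> snd z. a (fst z) * b (snd z)) + (\<Sum>z | z \<in> Y \<times> Y \<and> fst z = snd z. a (fst z) * b (snd z))"
      using Y by (subst sum.union_disjoint[symmetric]) (auto intro!: sum.cong)
    also have "(\<Sum>z | z \<in> Y \<times> Y \<and> fst z = snd z. a (fst z) * b (snd z)) = (\<Sum>x\<in>Y. a x * b x)"
      by (rule sum.reindex_bij_witness[of _ "\<lambda>x. (x, x)" fst]) auto
    also have "\<dots> = S (\<lambda>x. a x * b x) \<omega>"
      using S_eq_sum[of \<omega> B "\<lambda>x. a x * b x"] \<omega> B aB by (simp add: Y_def)
    finally show ?thesis by (simp add: Q_def Y_def)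
  qed
  have gm: "(\<lambda>(x, y). ennreal (a x * b y)) \<in> borel_measurable (M \<Otimes>\<^sub>M M)" by measurable
  have "(\<integral>\<^sup>+\<omega>. ennreal (Q a b \<omega>) \<partial>P) =
      (\<integral>\<^sup>+\<omega>. (\<integral>\<^sup>+z. ennreal (a (fst z) * b (snd z)) \<partial>count_space {z \<in> X \<omega> \<times> X \<omega>. fst z \<noteq> snd z}) \<partial>P)"
  proof (rule nn_integral_cong)
    fix \<omega> assume \<omega>: "\<omega> \<in> space P"
    have "finite ((X \<omega> \<inter> B) \<times> (X \<omega> \<inter> B))" using finite_points[OF \<omega> B] by simp
    then have "finite {z. z \<in> (X \<omega> \<inter> B) \<times> (X \<omega> \<inter> B) \<and> fst z \<noteq> snd z}"
      by (rule rev_finite_subset) auto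
    then have "(\<integral>\<^sup>+z. ennreal (a (fst z) * b (snd z)) \<partial>count_space {z \<in> X \<omega> \<times> X \<omega>. fst z \<noteq> snd z}) =
        (\<Sum>z | z \<in> (X \<omega> \<inter> B) \<times> (X \<omega> \<inter> B) \<and> fst z \<noteq> snd z. ennreal (a (fst z) * b (snd z)))"
    proof (rule nn_integral_count_space')
      fix z assume "z \<in> {z \<in> X \<omega> \<times> X \<omega>. fst z \<noteq> snd z}"
        "z \<notin> {z. z \<in> (X \<omega> \<inter> B) \<times> (X \<omega> \<inter> B) \<and> fst z \<noteq> snd z}"
      then have "fst z \<notin> B \<or> snd z \<notin> B" by auto
      then show "ennreal (a (fst z) * b (snd z)) = 0" using aB bB by auto
    qed auto
    then show "ennreal (Q a b \<omega>) =
        (\<integral>\<^sup>+z. ennreal (a (fst z) * b (snd z)) \<partial>count_space {z \<in> X \<omega> \<times> X \<omega>. fst z \<noteq> snd z})"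
      using Qsum[OF \<omega>] assms(3,4) by (simp add: sum_ennreal)
  qed
  also have "\<dots> = (\<integral>\<^sup>+z. ennreal (a (fst z) * b (snd z)) * ennreal (\<rho> (fst z) (snd z)) \<partial>(M \<Otimes>\<^sub>M M))"
    by (rule correlation_2[OF gm])
  also have "\<dots> = (\<integral>\<^sup>+z. ennreal (a (fst z) * b (snd z) * \<rho> (fst z) (snd z)) \<partial>(M \<Otimes>\<^sub>M M))"
    using assms(3,4) by (intro nn_integral_cong) (simp add: ennreal_mult')
  also have "\<dots> = ennreal (\<integral>z. a (fst z) * b (snd z) * \<rho> (fst z) (snd z) \<partial>(M \<Otimes>\<^sub>M M))"
    using AE_rho_nonneg assms(3,4)
    by (intro nn_integral_eq_integral rho_integral assms) (auto elim!: eventually_mono)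
  finally have eq: "(\<integral>\<^sup>+\<omega>. ennreal (Q a b \<omega>) \<partial>P) =
    ennreal (\<integral>z. a (fst z) * b (snd z) * \<rho> (fst z) (snd z) \<partial>(M \<Otimes>\<^sub>M M))" .
  have Qm: "Q a b \<in> borel_measurable P"
    unfolding Q_def[abs_def]
    by (intro borel_measurable_diff borel_measurable_times S_test_measurable test_function_mult assms)
  have nn: "AE \<omega> in P. 0 \<le> Q a b \<omega>"
    using Qsum assms(3,4) by (intro AE_I2) (simp add: sum_nonneg)
  have "0 \<le> (\<integral>z. a (fst z) * b (snd z) * \<rho> (fst z) (snd z) \<partial>(M \<Otimes>\<^sub>M M))"
    using AE_rho_nonneg assms(3,4) by (intro integral_nonneg_AE) (auto elim!: eventually_mono)
  then show ?thesis
    using eq nn Qm by (subst (asm) nn_integral_eq_integrable) auto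
qed

text \<open>The correlation identities need nonnegative functions, so \<phi> is split into positive
  and negative parts. The product k(x) k(y) inside \<rho> contributes the square of the mean, which
  the variance subtracts.\<close>

lemma variance_formula:
  assumes \<phi>: "test_function \<phi>"
  shows "prob_space.variance P (S \<phi>) =
    (\<integral>x. (\<phi> x)\<^sup>2 * k x \<partial>M) + \<alpha> * (\<integral>z. \<phi> (fst z) * \<phi> (snd z) * w (fst z) (snd z) \<partial>(M \<Otimes>\<^sub>M M))"
proof -
  define a where "a x = max (\<phi> x) 0" for x
  define b where "b x = max (- \<phi> x) 0" for x
  have ab: "\<phi> x = a x - b x" for x by (simp add: a_def b_def)
  have t: "test_function a" "test_function b" unfolding a_def[abs_def] b_def[abs_def] by (rule test_function_pos_part[OF \<phi>])+
  have nn: "0 \<le> a x" "0 \<le> b x" for x by (auto simp: a_def b_def)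
  obtain C B where p: "\<phi> \<in> borel_measurable borel" "\<phi> \<in> borel_measurable M" "C \<ge> 0" "\<And>x. \<bar>\<phi> x\<bar> \<le> C" "compact B" "\<And>x. x \<notin> B \<Longrightarrow> \<phi> x = 0"
    using test_functionE[OF \<phi>] by blast
  have aB: "a x = 0" and bB: "b x = 0" if "x \<notin> B" for x using that p(6)[of x] by (auto simp: a_def b_def)
  have S1: "S \<phi> \<omega> = S a \<omega> - S b \<omega>" if "\<omega> \<in> space P" for \<omega>
    using S_eq_sum[OF that p(5), of \<phi>] S_eq_sum[OF that p(5), of a] S_eq_sum[OF that p(5), of b] p(6) aB bB
    by (simp add: ab sum_subtractf)
  have S2: "(S \<phi> \<omega>)\<^sup>2 = S (\<lambda>x. \<phi> x * \<phi> x) \<omega> + (Q a a \<omega> - Q a b \<omega> - Q b a \<omega> + Q b b \<omega>)"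
    if "\<omega> \<in> space P" for \<omega>
  proof -
    have "S (\<lambda>x. \<phi> x * \<phi> x) \<omega> = S (\<lambda>x. a x * a x) \<omega> - S (\<lambda>x. a x * b x) \<omega> - S (\<lambda>x. b x * a x) \<omega> + S (\<lambda>x. b x * b x) \<omega>"
      using S_eq_sum[OF that p(5), of "\<lambda>x. \<phi> x * \<phi> x"] S_eq_sum[OF that p(5), of "\<lambda>x. a x * a x"]
        S_eq_sum[OF that p(5), of "\<lambda>x. a x * b x"] S_eq_sum[OF that p(5), of "\<lambda>x. b x * a x"]
        S_eq_sum[OF that p(5), of "\<lambda>x. b x * b x"] p(6) aB bB
      by (simp add: ab sum_subtractf[symmetric] sum.distrib[symmetric] algebra_simps)
    then show ?thesis unfolding S1[OF that] Q_def by (simp add: power2_eq_square algebra_simps)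
  qed
  note Sa = S_mean_nonneg[OF t(1) nn(1)] and Sb = S_mean_nonneg[OF t(2) nn(2)]
  note S\<phi> = S_mean_nonneg[OF test_function_mult[OF \<phi> \<phi>] zero_le_square]
  note Qaa = Q_mean_nonneg[OF t(1) t(1) nn(1) nn(1)] and Qab = Q_mean_nonneg[OF t(1) t(2) nn(1) nn(2)]
    and Qba = Q_mean_nonneg[OF t(2) t(1) nn(2) nn(1)] and Qbb = Q_mean_nonneg[OF t(2) t(2) nn(2) nn(2)]
  have i1: "integrable P (S \<phi>)"
    using Sa Sb by (subst Bochner_Integration.integrable_cong[OF refl S1]) auto
  have i2: "integrable P (\<lambda>\<omega>. (S \<phi> \<omega>)\<^sup>2)"
    using S\<phi> Qaa Qab Qba Qbb by (subst Bochner_Integration.integrable_cong[OF refl S2]) auto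
  have m1: "(\<integral>\<omega>. S \<phi> \<omega> \<partial>P) = (\<integral>x. \<phi> x * k x \<partial>M)"
  proof -
    have "(\<integral>\<omega>. S \<phi> \<omega> \<partial>P) = (\<integral>x. a x * k x \<partial>M) - (\<integral>x. b x * k x \<partial>M)"
      using Sa Sb by (subst Bochner_Integration.integral_cong[OF refl S1]) auto
    also have "\<dots> = (\<integral>x. \<phi> x * k x \<partial>M)"
      using k_integrable[OF t(1)] k_integrable[OF t(2)]
      by (subst Bochner_Integration.integral_diff[symmetric]) (auto simp: ab left_diff_distrib)
    finally show ?thesis .
  qed
  have m2: "(\<integral>\<omega>. (S \<phi> \<omega>)\<^sup>2 \<partial>P) = (\<integral>x. (\<phi> x)\<^sup>2 * k x \<partial>M) + (\<integral>z. \<phi> (fst z) * \<phi> (snd z) * \<rho> (fst z) (snd z) \<partial>(M \<Otimes>\<^sub>M M))"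
  proof -
    define I where "I f g = (\<integral>z. f (fst z) * g (snd z) * \<rho> (fst z) (snd z) \<partial>(M \<Otimes>\<^sub>M M))" for f g :: "'a \<Rightarrow> real"
    have "(\<integral>\<omega>. (S \<phi> \<omega>)\<^sup>2 \<partial>P) = (\<integral>x. (\<phi> x * \<phi> x) * k x \<partial>M) + (I a a - I a b - I b a + I b b)"
      using S\<phi> Qaa Qab Qba Qbb unfolding I_def by (subst Bochner_Integration.integral_cong[OF refl S2]) auto
    also have "I a a - I a b - I b a + I b b = I \<phi> \<phi>"
    proof -
      have "I \<phi> \<phi> = (\<integral>z. a (fst z) * a (snd z) * \<rho> (fst z) (snd z) - a (fst z) * b (snd z) * \<rho> (fst z) (snd z)
          - b (fst z) * a (snd z) * \<rho> (fst z) (snd z) + b (fst z) * b (snd z) * \<rho> (fst z) (snd z) \<partial>(M \<Otimes>\<^sub>M M))"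
        unfolding I_def by (intro Bochner_Integration.integral_cong refl) (simp add: ab algebra_simps)
      then show ?thesis
        unfolding I_def
        by (simp add: rho_integral(1)[OF t(1) t(1)] rho_integral(1)[OF t(1) t(2)] rho_integral(1)[OF t(2) t(1)]
            rho_integral(1)[OF t(2) t(2)])
    qed
    finally show ?thesis by (simp add: I_def power2_eq_square)
  qed
  have "prob.variance (S \<phi>) = (\<integral>\<omega>. (S \<phi> \<omega>)\<^sup>2 \<partial>P) - (\<integral>\<omega>. S \<phi> \<omega> \<partial>P)\<^sup>2"
    by (rule prob.variance_eq[OF i1 i2])
  also have "\<dots> = (\<integral>x. (\<phi> x)\<^sup>2 * k x \<partial>M) + \<alpha> * (\<integral>z. \<phi> (fst z) * \<phi> (snd z) * w (fst z) (snd z) \<partial>(M \<Otimes>\<^sub>M M))"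
    unfolding m1 m2 rho_integral(2)[OF \<phi> \<phi>] by (simp add: power2_eq_square)
  finally show ?thesis .
qed

end

section \<open>Lower bounds for the variance by sign of \<alpha>\<close>

context alpha_process
begin

lemma op_norm_le_spectrum_bound:
  assumes "\<alpha> < 0" "L2_spectrum M T \<subseteq> complex_of_real ` {0 .. - 1 / \<alpha>}"
  shows "R \<le> - 1 / \<alpha>"
proof (cases "R > 0")
  case True
  then have "complex_of_real R \<in> complex_of_real ` {0 .. - 1 / \<alpha>}"
    using L2_op_norm_in_spectrum[OF T herm pos] assms(2) by blast
  then show ?thesis by auto
next
  case False
  have "0 \<le> - 1 / \<alpha>" using assms(1) by (simp add: divide_nonpos_neg)
  then show ?thesis using False by linarith
qed

lemma variance_ge_pos:
  assumes "\<alpha> > 0" and \<phi>: "test_function \<phi>"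
  shows "(\<integral>x. (\<phi> x)\<^sup>2 * k x \<partial>M) \<le> prob.variance (S \<phi>)"
proof -
  obtain C B where p: "\<phi> \<in> borel_measurable borel" "\<phi> \<in> borel_measurable M" "C \<ge> 0" "\<And>x. \<bar>\<phi> x\<bar> \<le> C" "compact B" "\<And>x. x \<notin> B \<Longrightarrow> \<phi> x = 0"
    using test_functionE[OF \<phi>] by blast
  have "0 \<le> (\<integral>z. \<phi> (fst z) * \<phi> (snd z) * w (fst z) (snd z) \<partial>(M \<Otimes>\<^sub>M M))"
    using kernel_square_form_nonneg[OF p(1,4,5,6)] unfolding w_def .
  then show ?thesis unfolding variance_formula[OF \<phi>] using assms(1) by simp
qed

text \<open>The almost everywhere bound on the squared norms of the sections, integrated against
  \<phi>^2.\<close>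

lemma square_w_integrable:
  assumes \<phi>: "test_function \<phi>"
  shows "integrable (M \<Otimes>\<^sub>M M) (\<lambda>z. (\<phi> (fst z))\<^sup>2 * w (fst z) (snd z))"
    "(\<integral>z. (\<phi> (fst z))\<^sup>2 * w (fst z) (snd z) \<partial>(M \<Otimes>\<^sub>M M)) \<le> R * (\<integral>x. (\<phi> x)\<^sup>2 * k x \<partial>M)"
proof -
  obtain C B where p: "\<phi> \<in> borel_measurable borel" "\<phi> \<in> borel_measurable M" "C \<ge> 0" "\<And>x. \<bar>\<phi> x\<bar> \<le> C" "compact B" "\<And>x. x \<notin> B \<Longrightarrow> \<phi> x = 0"
    using test_functionE[OF \<phi>] by blast
  note [measurable] = p(2)
  have ki: "integrable M (\<lambda>x. R * ((\<phi> x)\<^sup>2 * k x))"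
    using k_integrable[OF test_function_mult[OF \<phi> \<phi>]] by (simp add: power2_eq_square)
  have "(\<integral>\<^sup>+z. ennreal ((\<phi> (fst z))\<^sup>2 * w (fst z) (snd z)) \<partial>(M \<Otimes>\<^sub>M M)) =
      (\<integral>\<^sup>+x. \<integral>\<^sup>+y. ennreal ((\<phi> x)\<^sup>2 * w x y) \<partial>M \<partial>M)"
    by (subst sigma_finite_measure.nn_integral_fst[OF sigma_finite_M, symmetric], measurable)
  also have "\<dots> = (\<integral>\<^sup>+x. ennreal ((\<phi> x)\<^sup>2) * (\<integral>\<^sup>+y. ennreal (w x y) \<partial>M) \<partial>M)"
    by (simp add: ennreal_mult nn_integral_cmult)
  also have "\<dots> \<le> (\<integral>\<^sup>+x. ennreal (R * ((\<phi> x)\<^sup>2 * k x)) \<partial>M)"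
  proof (rule nn_integral_mono_AE)
    show "AE x in M. ennreal ((\<phi> x)\<^sup>2) * (\<integral>\<^sup>+y. ennreal (w x y) \<partial>M) \<le> ennreal (R * ((\<phi> x)\<^sup>2 * k x))"
      using AE_kernel_square_le
    proof eventually_elim
      case (elim x)
      have "ennreal ((\<phi> x)\<^sup>2) * (\<integral>\<^sup>+y. ennreal (w x y) \<partial>M) \<le> ennreal ((\<phi> x)\<^sup>2) * ennreal (R * k x)"
        using elim unfolding w_def k_def by (intro mult_left_mono) auto
      also have "\<dots> = ennreal (R * ((\<phi> x)\<^sup>2 * k x))"
        using elim unfolding k_def by (subst ennreal_mult[symmetric]) (auto simp: mult_ac)
      finally show ?case .
    qed
  qed
  also have "\<dots> = ennreal (\<integral>x. R * ((\<phi> x)\<^sup>2 * k x) \<partial>M)"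
    using AE_k_nonneg R_nonneg by (intro nn_integral_eq_integral ki) (auto elim!: eventually_mono)
  also have "\<dots> = ennreal (R * (\<integral>x. (\<phi> x)\<^sup>2 * k x \<partial>M))" by simp
  finally have le: "(\<integral>\<^sup>+z. ennreal ((\<phi> (fst z))\<^sup>2 * w (fst z) (snd z)) \<partial>(M \<Otimes>\<^sub>M M)) \<le> ennreal (R * (\<integral>x. (\<phi> x)\<^sup>2 * k x \<partial>M))" .
  show i: "integrable (M \<Otimes>\<^sub>M M) (\<lambda>z. (\<phi> (fst z))\<^sup>2 * w (fst z) (snd z))"
    using le by (intro integrableI_nonneg) (auto intro: le_less_trans)
  have "0 \<le> (\<integral>x. (\<phi> x)\<^sup>2 * k x \<partial>M)"
    using AE_k_nonneg by (intro integral_nonneg_AE) (auto elim!: eventually_mono)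
  then show "(\<integral>z. (\<phi> (fst z))\<^sup>2 * w (fst z) (snd z) \<partial>(M \<Otimes>\<^sub>M M)) \<le> R * (\<integral>x. (\<phi> x)\<^sup>2 * k x \<partial>M)"
    using le R_nonneg by (subst (asm) nn_integral_eq_integral[OF i]) auto
qed

lemma variance_ge_neg:
  assumes "\<alpha> < 0" and \<phi>: "test_function \<phi>"
  shows "integrable (M \<Otimes>\<^sub>M M) (\<lambda>z. (\<phi> (fst z) - \<phi> (snd z))\<^sup>2 * w (fst z) (snd z))"
    "(1 + \<alpha> * R) * (\<integral>x. (\<phi> x)\<^sup>2 * k x \<partial>M)
      - \<alpha> / 2 * (\<integral>z. (\<phi> (fst z) - \<phi> (snd z))\<^sup>2 * w (fst z) (snd z) \<partial>(M \<Otimes>\<^sub>M M)) \<le> prob.variance (S \<phi>)"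
proof -
  note 1 = square_w_integrable[OF \<phi>] and 2 = w_integrable[OF \<phi> \<phi>]
  define I where "I = (\<integral>z. (\<phi> (fst z))\<^sup>2 * w (fst z) (snd z) \<partial>(M \<Otimes>\<^sub>M M))"
  define J where "J = (\<integral>z. \<phi> (fst z) * \<phi> (snd z) * w (fst z) (snd z) \<partial>(M \<Otimes>\<^sub>M M))"
  \<comment> \<open>Exchanging the variables gives both squares the same integral, as
    \<open>w\<close> is symmetric.\<close>
  have 3: "integrable (M \<Otimes>\<^sub>M M) (\<lambda>z. (\<phi> (snd z))\<^sup>2 * w (fst z) (snd z))"
    using integrable_product_swap[OF 1(1)] by (simp add: case_prod_unfold w_commute)
  have 4: "(\<integral>z. (\<phi> (snd z))\<^sup>2 * w (fst z) (snd z) \<partial>(M \<Otimes>\<^sub>M M)) = I"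
    unfolding I_def using integral_product_swap[OF borel_measurable_integrable[OF 1(1)]]
    by (simp add: case_prod_unfold w_commute)
  have eq: "(\<phi> (fst z) - \<phi> (snd z))\<^sup>2 * w (fst z) (snd z) = (\<phi> (fst z))\<^sup>2 * w (fst z) (snd z)
      + (\<phi> (snd z))\<^sup>2 * w (fst z) (snd z) - 2 * (\<phi> (fst z) * \<phi> (snd z) * w (fst z) (snd z))" for z
    by (simp add: power2_eq_square algebra_simps)
  show "integrable (M \<Otimes>\<^sub>M M) (\<lambda>z. (\<phi> (fst z) - \<phi> (snd z))\<^sup>2 * w (fst z) (snd z))"
    unfolding eq by (intro Bochner_Integration.integrable_diff Bochner_Integration.integrable_add integrable_mult_right 1(1) 2 3)
  have D: "(\<integral>z. (\<phi> (fst z) - \<phi> (snd z))\<^sup>2 * w (fst z) (snd z) \<partial>(M \<Otimes>\<^sub>M M)) = 2 * I - 2 * J"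
    unfolding eq using 1(1) 2 3 4 by (simp add: I_def J_def)
  \<comment> \<open>The negative factor \<alpha> reverses the upper bound on \<open>I\<close>, which
    is what makes it useful from below.\<close>
  have "\<alpha> * (R * (\<integral>x. (\<phi> x)\<^sup>2 * k x \<partial>M)) \<le> \<alpha> * I"
    using 1(2) assms(1) unfolding I_def by (intro mult_left_mono_neg) auto
  then show "(1 + \<alpha> * R) * (\<integral>x. (\<phi> x)\<^sup>2 * k x \<partial>M)
      - \<alpha> / 2 * (\<integral>z. (\<phi> (fst z) - \<phi> (snd z))\<^sup>2 * w (fst z) (snd z) \<partial>(M \<Otimes>\<^sub>M M)) \<le> prob.variance (S \<phi>)"
    unfolding D variance_formula[OF \<phi>] J_def[symmetric] by (simp add: algebra_simps)
qed

text \<open>Stated in \<open>ennreal\<close> to be chained with the passage from Lebesgue measure to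
  \<open>M\<close>. The constant is 1 for positive \<alpha> and the inverse 1 / (1 + \<alpha> R) of
  the gap otherwise.\<close>

lemma diagonal_integral_le_variance:
  assumes "\<alpha> > 0 \<or> \<alpha> < 0 \<and> - \<alpha> * R < 1"
  obtains \<kappa> where "\<kappa> > 0"
    "\<And>\<phi>. test_function \<phi> \<Longrightarrow> (\<integral>\<^sup>+x. ennreal ((\<phi> x)\<^sup>2 * k x) \<partial>M) \<le> ennreal (\<kappa> * prob.variance (S \<phi>))"
proof -
  define \<kappa> where "\<kappa> = (if \<alpha> > 0 then 1 else 1 / (1 + \<alpha> * R))"
  have \<kappa>: "\<kappa> > 0" using assms by (auto simp: \<kappa>_def)
  have "(\<integral>\<^sup>+x. ennreal ((\<phi> x)\<^sup>2 * k x) \<partial>M) \<le> ennreal (\<kappa> * prob.variance (S \<phi>))" if \<phi>: "test_function \<phi>" for \<phi>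
  proof -
    have ki: "integrable M (\<lambda>x. (\<phi> x)\<^sup>2 * k x)"
      using k_integrable[OF test_function_mult[OF \<phi> \<phi>]] by (simp add: power2_eq_square)
    have eq: "(\<integral>\<^sup>+x. ennreal ((\<phi> x)\<^sup>2 * k x) \<partial>M) = ennreal (\<integral>x. (\<phi> x)\<^sup>2 * k x \<partial>M)"
      using AE_k_nonneg by (intro nn_integral_eq_integral ki) (auto elim!: eventually_mono)
    have "(\<integral>x. (\<phi> x)\<^sup>2 * k x \<partial>M) \<le> \<kappa> * prob.variance (S \<phi>)"
    proof (cases "\<alpha> > 0")
      case True
      then show ?thesis using variance_ge_pos[OF True \<phi>] by (simp add: \<kappa>_def)
    next
      case False
      then have neg: "\<alpha> < 0" "1 + \<alpha> * R > 0" using assms by auto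
      have "0 \<le> (\<integral>z. (\<phi> (fst z) - \<phi> (snd z))\<^sup>2 * w (fst z) (snd z) \<partial>(M \<Otimes>\<^sub>M M))" by simp
      then have "0 \<le> - \<alpha> / 2 * (\<integral>z. (\<phi> (fst z) - \<phi> (snd z))\<^sup>2 * w (fst z) (snd z) \<partial>(M \<Otimes>\<^sub>M M))"
        using neg by (intro mult_nonneg_nonneg) auto
      then have "(1 + \<alpha> * R) * (\<integral>x. (\<phi> x)\<^sup>2 * k x \<partial>M) \<le> prob.variance (S \<phi>)"
        using variance_ge_neg(2)[OF neg(1) \<phi>] by linarith
      then show ?thesis using False neg(2) by (simp add: \<kappa>_def field_simps)
    qed
    then show ?thesis unfolding eq by (rule ennreal_leI)
  qed
  with \<kappa> show ?thesis by (rule that)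
qed

lemma increments_le_variance:
  assumes "\<alpha> < 0" "R \<le> - 1 / \<alpha>" and \<phi>: "test_function \<phi>"
  shows "(\<integral>\<^sup>+x. \<integral>\<^sup>+y. ennreal ((\<phi> x - \<phi> y)\<^sup>2 * w x y) \<partial>M \<partial>M) \<le> ennreal (2 / (- \<alpha>) * prob.variance (S \<phi>))"
proof -
  obtain C B where p: "\<phi> \<in> borel_measurable borel" "\<phi> \<in> borel_measurable M" "C \<ge> 0" "\<And>x. \<bar>\<phi> x\<bar> \<le> C" "compact B" "\<And>x. x \<notin> B \<Longrightarrow> \<phi> x = 0"
    using test_functionE[OF \<phi>] by blast
  note [measurable] = p(2)
  define D where "D = (\<integral>z. (\<phi> (fst z) - \<phi> (snd z))\<^sup>2 * w (fst z) (snd z) \<partial>(M \<Otimes>\<^sub>M M))"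
  have "(\<integral>\<^sup>+x. \<integral>\<^sup>+y. ennreal ((\<phi> x - \<phi> y)\<^sup>2 * w x y) \<partial>M \<partial>M) =
      (\<integral>\<^sup>+z. ennreal ((\<phi> (fst z) - \<phi> (snd z))\<^sup>2 * w (fst z) (snd z)) \<partial>(M \<Otimes>\<^sub>M M))"
    by (subst sigma_finite_measure.nn_integral_fst[OF sigma_finite_M, symmetric], measurable)
  also have "\<dots> = ennreal D"
    unfolding D_def by (intro nn_integral_eq_integral variance_ge_neg assms) auto
  also have "D \<le> 2 / (- \<alpha>) * prob.variance (S \<phi>)"
  proof -
    have "0 \<le> (\<integral>x. (\<phi> x)\<^sup>2 * k x \<partial>M)"
      using AE_k_nonneg by (intro integral_nonneg_AE) (auto elim!: eventually_mono)
    moreover have "0 \<le> 1 + \<alpha> * R" using assms(1,2) by (simp add: field_simps)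
    ultimately have "0 \<le> (1 + \<alpha> * R) * (\<integral>x. (\<phi> x)\<^sup>2 * k x \<partial>M)" by (rule mult_nonneg_nonneg[rotated])
    then have "- \<alpha> / 2 * D \<le> prob.variance (S \<phi>)"
      using variance_ge_neg(2)[OF assms(1) \<phi>] unfolding D_def by linarith
    then show ?thesis using assms(1) by (simp add: field_simps)
  qed
  finally show ?thesis by (simp add: ennreal_leI)
qed

end

section \<open>Geometric lower bounds\<close>

lemma nn_integral_lborel_affine:
  fixes g :: "'a::euclidean_space \<Rightarrow> ennreal"
  assumes [measurable]: "g \<in> borel_measurable borel" and c: "c \<noteq> 0"
  shows "(\<integral>\<^sup>+x. g x \<partial>lborel) = ennreal (\<bar>c\<bar> ^ DIM('a)) * (\<integral>\<^sup>+x. g (t + c *\<^sub>R x) \<partial>lborel)"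
  by (subst lborel_affine[OF c, of t])
    (simp add: nn_integral_density nn_integral_distr nn_integral_cmult)

lemma nn_integral_lborel_shift:
  fixes g :: "'a::euclidean_space \<Rightarrow> ennreal"
  assumes "g \<in> borel_measurable borel"
  shows "(\<integral>\<^sup>+x. g (x + t) \<partial>lborel) = (\<integral>\<^sup>+x. g x \<partial>lborel)"
  using nn_integral_lborel_affine[OF assms, of 1 t] by (simp add: add.commute)

lemma nn_integral_lborel_scale:
  fixes g :: "'a::euclidean_space \<Rightarrow> ennreal"
  assumes "g \<in> borel_measurable borel" and L: "L > 0"
  shows "(\<integral>\<^sup>+x. g (x /\<^sub>R L) \<partial>lborel) = ennreal (L ^ DIM('a)) * (\<integral>\<^sup>+x. g x \<partial>lborel)"
proof -
  have "ennreal (L ^ DIM('a)) * (\<integral>\<^sup>+x. g x \<partial>lborel) =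
      ennreal (L ^ DIM('a)) * (ennreal (inverse L ^ DIM('a)) * (\<integral>\<^sup>+x. g (x /\<^sub>R L) \<partial>lborel))"
    using nn_integral_lborel_affine[OF assms(1), of "inverse L" 0] L by simp
  also have "\<dots> = ennreal (L ^ DIM('a) * inverse L ^ DIM('a)) * (\<integral>\<^sup>+x. g (x /\<^sub>R L) \<partial>lborel)"
    using L by (subst ennreal_mult) (auto simp: mult.assoc)
  also have "L ^ DIM('a) * inverse L ^ DIM('a) = 1" using L by (simp add: power_mult_distrib[symmetric])
  finally show ?thesis by simp
qed

text \<open>The test function in quantitative form: a bound \<open>C\<close>, a support radius and
  the squared norm \<open>s\<close>. From here on \<rho> is this radius, not the two-point
  function.\<close>

locale bump =
  fixes \<phi> :: "'a::euclidean_space \<Rightarrow> real" and C \<rho> s :: real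
  assumes \<phi>_meas [measurable]: "\<phi> \<in> borel_measurable borel"
    and C: "C > 0" "\<And>x. \<bar>\<phi> x\<bar> \<le> C"
    and \<rho>: "\<rho> > 0" "\<And>x. norm x > \<rho> \<Longrightarrow> \<phi> x = 0"
    and s: "s > 0" "(\<integral>\<^sup>+x. ennreal ((\<phi> x)\<^sup>2) \<partial>lborel) = ennreal s"
begin

definition scaled :: "real \<Rightarrow> 'a \<Rightarrow> real" where "scaled L x = \<phi> (x /\<^sub>R L)"

lemma scaled_meas [measurable]: "scaled L \<in> borel_measurable borel"
  unfolding scaled_def[abs_def] by measurable

lemma scaled_bound: "\<bar>scaled L x\<bar> \<le> C" by (simp add: scaled_def C)

lemma scaled_zero: "L > 0 \<Longrightarrow> norm x > \<rho> * L \<Longrightarrow> scaled L x = 0"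
  unfolding scaled_def by (rule \<rho>) (simp add: field_simps)

lemma scaled_norm:
  assumes "L > 0" shows "(\<integral>\<^sup>+x. ennreal ((scaled L x)\<^sup>2) \<partial>lborel) = ennreal (L ^ DIM('a) * s)"
  unfolding scaled_def
  using nn_integral_lborel_scale[of "\<lambda>x. ennreal ((\<phi> x)\<^sup>2)" L] assms s by (simp add: ennreal_mult)

end

section \<open>Case (i): averaging over cubes\<close>

lemma mem_cube_iff: "y \<in> cube x r \<longleftrightarrow> (\<forall>b\<in>Basis. \<bar>(y - x) \<bullet> b\<bar> \<le> r / 2)"
  unfolding cube_def mem_box
proof (intro ball_cong refl iffI)
  fix b :: 'a assume b: "b \<in> Basis"
  have e: "(x - (r / 2) *\<^sub>R One) \<bullet> b = x \<bullet> b - r / 2" "(x + (r / 2) *\<^sub>R One) \<bullet> b = x \<bullet> b + r / 2"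
    using b by (simp_all add: inner_simps)
  show "\<bar>(y - x) \<bullet> b\<bar> \<le> r / 2"
    if "(x - (r / 2) *\<^sub>R One) \<bullet> b \<le> y \<bullet> b \<and> y \<bullet> b \<le> (x + (r / 2) *\<^sub>R One) \<bullet> b"
    using conjunct1[OF that] conjunct2[OF that] inner_diff_left[of y x b] unfolding e by linarith
  show "(x - (r / 2) *\<^sub>R One) \<bullet> b \<le> y \<bullet> b \<and> y \<bullet> b \<le> (x + (r / 2) *\<^sub>R One) \<bullet> b"
    if "\<bar>(y - x) \<bullet> b\<bar> \<le> r / 2"
    unfolding e using that inner_diff_left[of y x b] by (intro conjI) linarith+
qed

lemma cube_sym: "y \<in> cube x r \<longleftrightarrow> x \<in> cube y r"
  unfolding mem_cube_iff by (simp add: inner_diff_left abs_minus_commute)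

lemma measure_cube: "r \<ge> 0 \<Longrightarrow> emeasure lborel (cube (x::'a::euclidean_space) r) = ennreal (r ^ DIM('a))"
  unfolding cube_def
  by (subst emeasure_lborel_cbox) (auto simp: inner_simps)

lemma cube_measurable [measurable]: "cube x r \<in> sets borel"
  by (simp add: cube_def)

text \<open>Averaging over the centre of the cubes replaces a covering argument.\<close>

lemma (in bump) thick_diagonal_bound:
  fixes k :: "'a \<Rightarrow> real"
  assumes [measurable]: "k \<in> borel_measurable borel"
    and thick: "\<And>\<delta>. \<delta> > 0 \<Longrightarrow> \<exists>m>0. \<exists>r>0. \<forall>x.
        measure lborel {y \<in> cube x r. k y \<ge> m} \<ge> (1 - \<delta>) * measure lborel (cube x r)"
  shows "\<exists>c0>0. \<exists>L0>0. \<forall>L\<ge>L0. ennreal (c0 * L ^ DIM('a)) \<le> (\<integral>\<^sup>+x. ennreal ((scaled L x)\<^sup>2 * k x) \<partial>lborel)"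
proof -
  \<comment> \<open>Chosen so that C^2 times the volume bound \<delta> ((2 \<rho> + 1) L)^d for the
    bad part of the support equals half of the squared norm s L^d of the scaled function.\<close>
  define \<delta> where "\<delta> = s / (2 * C\<^sup>2 * (2 * \<rho> + 1) ^ DIM('a))"
  have \<delta>: "\<delta> > 0" using s C \<rho> by (simp add: \<delta>_def)
  obtain m r where m: "m > 0" and r: "r > 0" and
    mr: "\<And>x. measure lborel {y \<in> cube x r. k y \<ge> m} \<ge> (1 - \<delta>) * measure lborel (cube x r)"
    using thick[OF \<delta>] by blast
  define E where "E = {y. k y < m}"
  have Em [measurable]: "E \<in> sets borel" unfolding E_def by measurable
  have Ecube: "emeasure lborel (E \<inter> cube x r) \<le> ennreal (\<delta> * r ^ DIM('a))" for x
  proof -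
    have fin: "emeasure lborel (cube x r) < \<infinity>" using measure_cube[of r x] r by simp
    have sub: "{y \<in> cube x r. k y \<ge> m} \<subseteq> cube x r" by auto
    have Km [measurable]: "{y \<in> cube x r. k y \<ge> m} \<in> sets borel"
    proof -
      have "{y \<in> cube x r. k y \<ge> m} = cube x r \<inter> {y. k y \<ge> m}" by auto
      also have "\<dots> \<in> sets borel" by measurable
      finally show ?thesis .
    qed
    have mc: "measure lborel (cube x r) = r ^ DIM('a)"
      using measure_cube[of r x] r by (simp add: measure_def)
    have "E \<inter> cube x r = cube x r - {y \<in> cube x r. k y \<ge> m}" by (auto simp: E_def)
    then have "measure lborel (E \<inter> cube x r) = measure lborel (cube x r) - measure lborel {y \<in> cube x r. k y \<ge> m}"
      using fin sub by (simp add: measure_Diff)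
    also have "\<dots> \<le> \<delta> * r ^ DIM('a)" using mr[of x] unfolding mc by (simp add: algebra_simps)
    finally have "measure lborel (E \<inter> cube x r) \<le> \<delta> * r ^ DIM('a)" .
    moreover have "emeasure lborel (E \<inter> cube x r) \<noteq> \<infinity>"
      using fin emeasure_mono[of "E \<inter> cube x r" "cube x r" lborel] by (auto simp: top_unique)
    ultimately show ?thesis by (subst emeasure_eq_ennreal_measure) (auto intro: ennreal_leI)
  qed
  have key: "ennreal (m * s / 2 * L ^ DIM('a)) \<le> (\<integral>\<^sup>+x. ennreal ((scaled L x)\<^sup>2 * k x) \<partial>lborel)" if L: "L \<ge> r" for L
  proof -
    have L0: "L > 0" using L r by simp
    define B where "B = cball (0::'a) (\<rho> * L)"
    \<comment> \<open>Contains the centre of every cube of side \<open>r\<close> that meets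
      \<open>B\<close>.\<close>
    define Z where "Z = cube (0::'a) (2 * \<rho> * L + r)"
    have [measurable]: "B \<in> sets borel" "Z \<in> sets borel" by (auto simp: B_def Z_def)
    have cm [measurable]: "Measurable.pred (lborel \<Otimes>\<^sub>M lborel) (\<lambda>z. snd z \<in> cube (fst z :: 'a) r)"
      unfolding mem_cube_iff by measurable
    \<comment> \<open>Double counting of pairs formed by a bad point y and a cube containing it: the
      centres of such cubes fill a cube of volume r^d, whereas each single cube holds bad points of
      volume at most \<delta> r^d.\<close>
    have "emeasure lborel (E \<inter> B) * ennreal (r ^ DIM('a)) = (\<integral>\<^sup>+y. indicator (E \<inter> B) y * emeasure lborel (cube y r) \<partial>lborel)"
      using r by (simp add: measure_cube nn_integral_multc)
    also have "\<dots> \<le> (\<integral>\<^sup>+y. indicator E y * (\<integral>\<^sup>+x. indicator Z x * indicator (cube x r) y \<partial>lborel) \<partial>lborel)"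
    proof (rule nn_integral_mono)
      fix y :: 'a
      have "emeasure lborel (cube y r) \<le> (\<integral>\<^sup>+x. indicator Z x * indicator (cube x r) y \<partial>lborel)" if "y \<in> B"
      proof -
        have "emeasure lborel (cube y r) = (\<integral>\<^sup>+x. indicator (cube y r) x \<partial>lborel)" by simp
        also have "\<dots> \<le> (\<integral>\<^sup>+x. indicator Z x * indicator (cube x r) y \<partial>lborel)"
        proof (rule nn_integral_mono)
          fix x
          have "x \<in> Z" if "x \<in> cube y r"
            unfolding Z_def mem_cube_iff
          proof
            fix b :: 'a assume b: "b \<in> Basis"
            have "\<bar>(x - y) \<bullet> b\<bar> \<le> r / 2" using that b by (simp add: mem_cube_iff)
            moreover have "\<bar>y \<bullet> b\<bar> \<le> \<rho> * L"
              using Basis_le_norm[OF b, of y] \<open>y \<in> B\<close> by (simp add: B_def)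
            ultimately show "\<bar>(x - 0) \<bullet> b\<bar> \<le> (2 * \<rho> * L + r) / 2"
            proof -
              have "(2 * \<rho> * L + r) / 2 = \<rho> * L + r / 2" by (simp add: field_simps)
              then show ?thesis
                using \<open>\<bar>(x - y) \<bullet> b\<bar> \<le> r / 2\<close> \<open>\<bar>y \<bullet> b\<bar> \<le> \<rho> * L\<close> unfolding inner_diff_left inner_zero_left by linarith
            qed
          qed
          then show "indicator (cube y r) x \<le> (indicator Z x * indicator (cube x r) y :: ennreal)"
            using cube_sym[of y x r] by (auto simp: indicator_def)
        qed
        finally show ?thesis .
      qed
      then show "indicator (E \<inter> B) y * emeasure lborel (cube y r)
          \<le> indicator E y * (\<integral>\<^sup>+x. indicator Z x * indicator (cube x r) y \<partial>lborel)"
        by (auto simp: indicator_def)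
    qed
    also have "\<dots> = (\<integral>\<^sup>+y. (\<integral>\<^sup>+x. indicator Z x * (indicator E y * indicator (cube x r) y) \<partial>lborel) \<partial>lborel)"
    proof (rule nn_integral_cong)
      fix y :: 'a
      have "(\<lambda>x. indicator Z x * indicator (cube x r) y :: ennreal) = (\<lambda>x. indicator Z x * indicator (cube y r) x)"
        by (rule ext) (auto simp: indicator_def cube_sym[of y])
      then have "(\<lambda>x. indicator Z x * indicator (cube x r) y :: ennreal) \<in> borel_measurable lborel"
        by simp
      then show "indicator E y * (\<integral>\<^sup>+x. indicator Z x * indicator (cube x r) y \<partial>lborel)
          = (\<integral>\<^sup>+x. indicator Z x * (indicator E y * indicator (cube x r) y) \<partial>lborel)"
        by (subst nn_integral_cmult[symmetric]) (auto intro!: nn_integral_cong simp: mult_ac)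
    qed
    also have "\<dots> = (\<integral>\<^sup>+x. (\<integral>\<^sup>+y. indicator Z x * (indicator E y * indicator (cube x r) y) \<partial>lborel) \<partial>lborel)"
    proof (rule lborel_pair.Fubini')
      have "(\<lambda>z::'a\<times>'a. indicator Z (fst z) * (indicator E (snd z) * (if snd z \<in> cube (fst z) r then 1 else 0)) :: ennreal)
          \<in> borel_measurable (lborel \<Otimes>\<^sub>M lborel)"
        by measurable
      then show "(\<lambda>(x, y). indicator Z x * (indicator E y * indicator (cube x r) y) :: ennreal) \<in> borel_measurable (lborel \<Otimes>\<^sub>M lborel)"
        by (simp add: case_prod_unfold indicator_def of_bool_def)
    qed
    also have "\<dots> = (\<integral>\<^sup>+x. indicator Z x * emeasure lborel (E \<inter> cube x r) \<partial>lborel)"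
      by (simp add: nn_integral_cmult indicator_inter_arith[symmetric])
    also have "\<dots> \<le> (\<integral>\<^sup>+x. indicator Z x * ennreal (\<delta> * r ^ DIM('a)) \<partial>lborel)"
      by (intro nn_integral_mono mult_left_mono Ecube) simp
    also have "\<dots> = emeasure lborel Z * ennreal (\<delta> * r ^ DIM('a))"
      by (simp add: nn_integral_multc)
    also have "\<dots> = ennreal ((2 * \<rho> * L + r) ^ DIM('a) * \<delta> * r ^ DIM('a))"
      using \<rho> L0 r \<delta> unfolding Z_def by (subst measure_cube) (auto simp: ennreal_mult mult.assoc)
    also have "\<dots> = ennreal ((2 * \<rho> * L + r) ^ DIM('a) * \<delta>) * ennreal (r ^ DIM('a))"
      using \<rho> L0 r \<delta> by (subst ennreal_mult[symmetric]) auto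
    finally have "emeasure lborel (E \<inter> B) * ennreal (r ^ DIM('a)) \<le> ennreal ((2 * \<rho> * L + r) ^ DIM('a) * \<delta>) * ennreal (r ^ DIM('a))" .
    then have "emeasure lborel (E \<inter> B) \<le> ennreal ((2 * \<rho> * L + r) ^ DIM('a) * \<delta>)"
      using r by (subst (asm) ennreal_mult_le_mult_iff[of "ennreal (r ^ DIM('a))", unfolded mult.commute[of "ennreal (r ^ DIM('a))"]]) auto
    \<comment> \<open>The condition \<open>L \<ge> r\<close> absorbs the excess \<open>r\<close> in
      the side length.\<close>
    also have "\<dots> \<le> ennreal (((2 * \<rho> + 1) * L) ^ DIM('a) * \<delta>)"
      using L L0 \<rho> \<delta> r by (intro ennreal_leI mult_right_mono power_mono) (auto simp: algebra_simps)
    finally have EB: "emeasure lborel (E \<inter> B) \<le> ennreal (((2 * \<rho> + 1) * L) ^ DIM('a) * \<delta>)" .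
    have "ennreal (L ^ DIM('a) * s) = (\<integral>\<^sup>+x. ennreal ((scaled L x)\<^sup>2) \<partial>lborel)"
      by (rule scaled_norm[OF L0, symmetric])
    \<comment> \<open>Off \<open>E\<close> the diagonal is at least \<open>m\<close>; on
      \<open>E\<close> the square is at most C^2, and it vanishes outside \<open>B\<close>.\<close>
    also have "\<dots> \<le> (\<integral>\<^sup>+x. ennreal (1 / m) * ennreal ((scaled L x)\<^sup>2 * k x) + ennreal (C\<^sup>2) * indicator (E \<inter> B) x \<partial>lborel)"
    proof (rule nn_integral_mono)
      fix x
      show "ennreal ((scaled L x)\<^sup>2) \<le> ennreal (1 / m) * ennreal ((scaled L x)\<^sup>2 * k x) + ennreal (C\<^sup>2) * indicator (E \<inter> B) x"
      proof (cases "x \<in> E")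
        case True
        show ?thesis
        proof (cases "x \<in> B")
          case B: True
          have "(scaled L x)\<^sup>2 \<le> C\<^sup>2" using scaled_bound[of L x] C(1) by (simp add: abs_le_square_iff[symmetric])
          then show ?thesis using True B by (simp add: ennreal_leI add_increasing)
        next
          case False
          then have "scaled L x = 0" using scaled_zero[OF L0, of x] by (simp add: B_def)
          then show ?thesis by simp
        qed
      next
        case False
        then have "1 \<le> k x / m" using m by (simp add: E_def)
        then have "(scaled L x)\<^sup>2 * 1 \<le> (scaled L x)\<^sup>2 * (k x / m)" by (rule mult_left_mono) simp
        then have "ennreal ((scaled L x)\<^sup>2) \<le> ennreal (1 / m * ((scaled L x)\<^sup>2 * k x))" by (intro ennreal_leI) simp
        also have "\<dots> = ennreal (1 / m) * ennreal ((scaled L x)\<^sup>2 * k x)" using m by (intro ennreal_mult') simp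
        finally show ?thesis using False by simp
      qed
    qed
    also have "\<dots> = ennreal (1 / m) * (\<integral>\<^sup>+x. ennreal ((scaled L x)\<^sup>2 * k x) \<partial>lborel) + ennreal (C\<^sup>2) * emeasure lborel (E \<inter> B)"
      by (simp add: nn_integral_add nn_integral_cmult nn_integral_cmult_indicator)
    also have "\<dots> \<le> ennreal (1 / m) * (\<integral>\<^sup>+x. ennreal ((scaled L x)\<^sup>2 * k x) \<partial>lborel) + ennreal (C\<^sup>2) * ennreal (((2 * \<rho> + 1) * L) ^ DIM('a) * \<delta>)"
      by (intro add_left_mono mult_left_mono EB) simp
    also have "ennreal (C\<^sup>2) * ennreal (((2 * \<rho> + 1) * L) ^ DIM('a) * \<delta>) = ennreal (L ^ DIM('a) * s / 2)"
    proof -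
      have e: "C\<^sup>2 * (((2 * \<rho> + 1) * L) ^ DIM('a) * \<delta>) = L ^ DIM('a) * s / 2"
      proof -
        define p where "p = (2 * \<rho> + 1) ^ DIM('a)"
        have "p > 0" using \<rho> by (simp add: p_def)
        moreover have "((2 * \<rho> + 1) * L) ^ DIM('a) = p * L ^ DIM('a)" by (simp only: p_def power_mult_distrib)
        moreover have "\<delta> = s / (2 * C\<^sup>2 * p)" by (simp only: p_def \<delta>_def)
        ultimately show ?thesis using C(1) by (simp add: field_simps)
      qed
      show ?thesis unfolding e[symmetric] using \<delta> \<rho>(1) L0 by (intro ennreal_mult[symmetric]) auto
    qed
    finally have le: "ennreal (L ^ DIM('a) * s) \<le> ennreal (1 / m) * (\<integral>\<^sup>+x. ennreal ((scaled L x)\<^sup>2 * k x) \<partial>lborel) + ennreal (L ^ DIM('a) * s / 2)" .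
    show ?thesis
    proof (cases "\<integral>\<^sup>+x. ennreal ((scaled L x)\<^sup>2 * k x) \<partial>lborel")
      case (real v)
      have "ennreal (L ^ DIM('a) * s) \<le> ennreal (1 / m * v + L ^ DIM('a) * s / 2)"
        using le real m s L0 by (simp add: ennreal_mult[symmetric] ennreal_plus[symmetric] del: ennreal_plus)
      then have "L ^ DIM('a) * s \<le> 1 / m * v + L ^ DIM('a) * s / 2"
        using real m s L0 by (subst (asm) ennreal_le_iff) auto
      then show ?thesis unfolding real using m by (intro ennreal_leI) (simp add: field_simps)
    qed simp
  qed
  show ?thesis
    by (rule exI[of _ "m * s / 2"], intro conjI exI[of _ r] allI impI key) (use m s r in auto)
qed

section \<open>Case (ii.a): chaining short translations\<close>

lemma square_sum_le:
  fixes f :: "nat \<Rightarrow> real"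
  shows "(\<Sum>j<N. f j)\<^sup>2 \<le> real N * (\<Sum>j<N. (f j)\<^sup>2)"
  using Cauchy_Schwarz_ineq_sum[of "\<lambda>_. 1" f "{..<N}"] by simp

text \<open>Chaining \<open>N\<close> translates by \<open>h\<close> moves the support of \<open>\<psi>\<close> off itself.\<close>

lemma translation_increment_bound:
  fixes \<psi> :: "'a::euclidean_space \<Rightarrow> real"
  assumes [measurable]: "\<psi> \<in> borel_measurable borel"
    and supp: "\<And>x. norm x > q \<Longrightarrow> \<psi> x = 0" and N: "real N * norm h > 2 * q"
  shows "(\<integral>\<^sup>+x. ennreal ((\<psi> x)\<^sup>2) \<partial>lborel) \<le>
    ennreal ((real N)\<^sup>2) * (\<integral>\<^sup>+x. ennreal ((\<psi> (x + h) - \<psi> x)\<^sup>2) \<partial>lborel)"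
proof -
  define I where "I = (\<integral>\<^sup>+x. ennreal ((\<psi> (x + h) - \<psi> x)\<^sup>2) \<partial>lborel)"
  have "(\<integral>\<^sup>+x. ennreal ((\<psi> x)\<^sup>2) \<partial>lborel) \<le>
      (\<integral>\<^sup>+x. (\<Sum>j<N. ennreal (real N) * ennreal ((\<psi> (x + real j *\<^sub>R h + h) - \<psi> (x + real j *\<^sub>R h))\<^sup>2)) \<partial>lborel)"
  proof (rule nn_integral_mono)
    fix x
    have tele: "(\<Sum>j<N. \<psi> (x + real j *\<^sub>R h + h) - \<psi> (x + real j *\<^sub>R h)) = \<psi> (x + real N *\<^sub>R h) - \<psi> x"
      using sum_lessThan_telescope[of "\<lambda>j. \<psi> (x + real j *\<^sub>R h)" N]
      by (simp add: algebra_simps)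
    \<comment> \<open>If |x| \<le> q, then x + N h lies outside the ball of radius q and the
      difference is -\<psi>(x); otherwise the left side is zero.\<close>
    have "(\<psi> x)\<^sup>2 \<le> (\<psi> (x + real N *\<^sub>R h) - \<psi> x)\<^sup>2"
    proof (cases "norm x > q")
      case False
      have "norm (real N *\<^sub>R h) \<le> norm (x + real N *\<^sub>R h) + norm x"
        using norm_triangle_ineq4[of "x + real N *\<^sub>R h" x] by simp
      then have "norm (x + real N *\<^sub>R h) > q" using False N by simp
      then show ?thesis by (simp add: supp)
    qed (simp add: supp)
    also have "\<dots> \<le> real N * (\<Sum>j<N. (\<psi> (x + real j *\<^sub>R h + h) - \<psi> (x + real j *\<^sub>R h))\<^sup>2)"
      unfolding tele[symmetric] by (rule square_sum_le)
    finally have "ennreal ((\<psi> x)\<^sup>2) \<le> ennreal (\<Sum>j<N. real N * (\<psi> (x + real j *\<^sub>R h + h) - \<psi> (x + real j *\<^sub>R h))\<^sup>2)"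
      by (intro ennreal_leI) (simp add: sum_distrib_left)
    also have "\<dots> = (\<Sum>j<N. ennreal (real N) * ennreal ((\<psi> (x + real j *\<^sub>R h + h) - \<psi> (x + real j *\<^sub>R h))\<^sup>2))"
      by (simp add: sum_ennreal[symmetric] ennreal_mult)
    finally show "ennreal ((\<psi> x)\<^sup>2) \<le> (\<Sum>j<N. ennreal (real N) * ennreal ((\<psi> (x + real j *\<^sub>R h + h) - \<psi> (x + real j *\<^sub>R h))\<^sup>2))" .
  qed
  also have "\<dots> = (\<Sum>j<N. ennreal (real N) * (\<integral>\<^sup>+x. ennreal ((\<psi> (x + real j *\<^sub>R h + h) - \<psi> (x + real j *\<^sub>R h))\<^sup>2) \<partial>lborel))"
    by (simp add: nn_integral_sum nn_integral_cmult)
  also have "\<dots> = (\<Sum>j<N. ennreal (real N) * I)"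
  proof (intro sum.cong refl arg_cong2[where f = "(*)"])
    fix j
    show "(\<integral>\<^sup>+x. ennreal ((\<psi> (x + real j *\<^sub>R h + h) - \<psi> (x + real j *\<^sub>R h))\<^sup>2) \<partial>lborel) = I"
      unfolding I_def
      using nn_integral_lborel_shift[of "\<lambda>x. ennreal ((\<psi> (x + h) - \<psi> x)\<^sup>2)" "real j *\<^sub>R h"] by simp
  qed
  also have "\<dots> = ennreal ((real N)\<^sup>2) * I"
    by (simp add: power2_eq_square ennreal_mult mult.assoc ennreal_of_nat_eq_real_of_nat)
  finally show ?thesis by (simp add: I_def)
qed

locale bump_weight = bump \<phi> C \<rho> s for \<phi> :: "'a::euclidean_space \<Rightarrow> real" and C \<rho> s +
  fixes w :: "'a \<Rightarrow> 'a \<Rightarrow> real"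
  assumes w_meas: "(\<lambda>(x, y). w x y) \<in> borel_measurable (borel \<Otimes>\<^sub>M borel)"
    and w_nonneg: "\<And>x y. 0 \<le> w x y"
begin

lemma w_meas2 [measurable (raw)]:
  "f \<in> borel_measurable N \<Longrightarrow> g \<in> borel_measurable N \<Longrightarrow> (\<lambda>z. w (f z) (g z)) \<in> borel_measurable N"
  using measurable_compose[OF measurable_Pair w_meas, of f N g] by simp

abbreviation "energy L \<equiv> (\<integral>\<^sup>+x. \<integral>\<^sup>+y. ennreal ((scaled L x - scaled L y)\<^sup>2 * w x y) \<partial>lborel \<partial>lborel)"

text \<open>The scaled function leaves its own support after about L steps of length comparable to
  \<delta>, and chaining N steps costs N^2. So each short translation has increment energy at least
  of order L^d / L^2, and integrating over the steps gives the double integral.\<close>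

lemma energy_near_diagonal:
  assumes a: "a > 0" and \<delta>: "\<delta> > 0" and lower: "\<And>x y. norm (x - y) < \<delta> \<Longrightarrow> a \<le> w x y"
  shows "\<exists>c0>0. \<exists>L0>0. \<forall>L\<ge>L0. ennreal (c0 * (L ^ DIM('a) / L\<^sup>2)) \<le> energy L"
proof -
  \<comment> \<open>Steps are kept away from zero so that a single number \<open>N\<close> of order
    L serves all of them.\<close>
  define A where "A = {h::'a. \<delta> / 2 \<le> norm h \<and> norm h < \<delta>}"
  have Am [measurable]: "A \<in> sets borel"
  proof -
    have "A = ball 0 \<delta> - ball 0 (\<delta> / 2)" by (auto simp: A_def)
    then show ?thesis by simp
  qed
  define v where "v = measure lborel A"
  have Afin: "emeasure lborel A < \<infinity>"
  proof -
    have "emeasure lborel A \<le> emeasure lborel (ball (0::'a) \<delta>)" by (intro emeasure_mono) (auto simp: A_def)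
    also have "\<dots> < \<infinity>" by (rule emeasure_lborel_ball_finite)
    finally show ?thesis .
  qed
  have v: "v > 0"
  proof -
    obtain b :: 'a where b: "b \<in> Basis" using nonempty_Basis by blast
    \<comment> \<open>Midway in the shell, so that a ball of radius \<delta> / 4 fits around
      it.\<close>
    define h where "h = (3 * \<delta> / 4) *\<^sub>R b"
    have nh: "norm h = 3 * \<delta> / 4" using b \<delta> by (simp add: h_def)
    have "ball h (\<delta> / 4) \<subseteq> A"
    proof
      fix y assume "y \<in> ball h (\<delta> / 4)"
      then have "norm (h - y) < \<delta> / 4" by (simp add: dist_norm)
      moreover have "norm h \<le> norm (h - y) + norm y" using norm_triangle_ineq[of "h - y" y] by simp
      moreover have "norm y \<le> norm h + norm (h - y)" using norm_triangle_ineq4[of h "h - y"] by simp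
      ultimately show "y \<in> A" unfolding A_def mem_Collect_eq nh by linarith
    qed
    then have "measure lborel (ball h (\<delta> / 4)) \<le> v"
      unfolding v_def using Afin by (intro measure_mono_fmeasurable) (auto simp: fmeasurable_def)
    moreover have "0 < measure lborel (ball h (\<delta> / 4))" using \<delta> by (intro content_ball_pos) simp
    ultimately show ?thesis by linarith
  qed
  have vA: "emeasure lborel A = ennreal v" unfolding v_def using Afin by (intro emeasure_eq_ennreal_measure) auto
  \<comment> \<open>From N \<le> 4 \<rho> L / \<delta> + 2 together with L \<ge> 1.\<close>
  define C' where "C' = 4 * \<rho> / \<delta> + 2"
  have C': "C' > 0" using \<rho> \<delta> by (simp add: C'_def add_pos_pos)
  have key: "ennreal (a * v * s / C'\<^sup>2 * (L ^ DIM('a) / L\<^sup>2)) \<le> energy L" if L: "L \<ge> 1" for L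
  proof -
    have L0: "L > 0" using L by simp
    \<comment> \<open>\<open>N\<close> steps of length at least \<delta> / 2 must exceed the
      diameter 2 \<rho> L of the support; the successor makes this strict.\<close>
    define N where "N = Suc (nat \<lceil>4 * \<rho> * L / \<delta>\<rceil>)"
    have N1: "real N > 4 * \<rho> * L / \<delta>" unfolding N_def by linarith
    have "0 \<le> 4 * \<rho> * L / \<delta>" using \<rho> \<delta> L0 by simp
    then have "real N \<le> 4 * \<rho> * L / \<delta> + 2" unfolding N_def by linarith
    also have "\<dots> \<le> C' * L" using L by (simp add: C'_def algebra_simps)
    finally have N2: "real N \<le> C' * L" .
    have N0: "real N > 0" by (simp add: N_def)
    have T: "ennreal (L ^ DIM('a) * s / (C' * L)\<^sup>2) \<le> (\<integral>\<^sup>+x. ennreal ((scaled L (x + h) - scaled L x)\<^sup>2) \<partial>lborel)"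
      (is "_ \<le> ?T") if h: "h \<in> A" for h
    proof -
      have "2 * (\<rho> * L) < real N * (\<delta> / 2)" using N1 \<delta> by (simp add: field_simps)
      also have "\<dots> \<le> real N * norm h" using h by (intro mult_left_mono) (auto simp: A_def)
      finally have "ennreal (L ^ DIM('a) * s) \<le> ennreal ((real N)\<^sup>2) * ?T"
        unfolding scaled_norm[OF L0, symmetric]
        by (intro translation_increment_bound[where q = "\<rho> * L"]) (auto simp: scaled_zero[OF L0])
      also have "\<dots> \<le> ennreal ((C' * L)\<^sup>2) * ?T"
        using N2 by (intro mult_right_mono ennreal_leI power_mono) auto
      finally have le: "ennreal (L ^ DIM('a) * s) \<le> ennreal ((C' * L)\<^sup>2) * ?T" .
      show ?thesis
      proof (cases ?T)
        case (real t)
        have "ennreal (L ^ DIM('a) * s) \<le> ennreal ((C' * L)\<^sup>2 * t)"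
          using le real by (simp add: ennreal_mult)
        then have "L ^ DIM('a) * s \<le> (C' * L)\<^sup>2 * t" using real by (subst (asm) ennreal_le_iff) auto
        then show ?thesis unfolding real using C' L0 by (intro ennreal_leI) (simp add: divide_le_eq mult.commute)
      qed simp
    qed
    have "ennreal (a * v * s / C'\<^sup>2 * (L ^ DIM('a) / L\<^sup>2)) = ennreal (L ^ DIM('a) * s / (C' * L)\<^sup>2) * ennreal a * ennreal v"
      using a v s C' L0 by (simp add: ennreal_mult[symmetric] power_mult_distrib mult_ac)
    also have "\<dots> = (\<integral>\<^sup>+h. ennreal a * ennreal (L ^ DIM('a) * s / (C' * L)\<^sup>2) * indicator A h \<partial>lborel)"
      by (subst nn_integral_cmult_indicator) (simp_all add: vA mult_ac)
    also have "\<dots> \<le> (\<integral>\<^sup>+h. ennreal a * indicator A h * (\<integral>\<^sup>+x. ennreal ((scaled L (x + h) - scaled L x)\<^sup>2) \<partial>lborel) \<partial>lborel)"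
      using T by (intro nn_integral_mono) (auto simp: indicator_def intro!: mult_left_mono)
    also have "\<dots> = (\<integral>\<^sup>+h. (\<integral>\<^sup>+x. ennreal a * indicator A h * ennreal ((scaled L (x + h) - scaled L x)\<^sup>2) \<partial>lborel) \<partial>lborel)"
      by (intro nn_integral_cong nn_integral_cmult[symmetric]) measurable
    also have "\<dots> \<le> (\<integral>\<^sup>+h. (\<integral>\<^sup>+x. ennreal ((scaled L x - scaled L (x + h))\<^sup>2 * w x (x + h)) \<partial>lborel) \<partial>lborel)"
    proof (intro nn_integral_mono)
      fix h x :: 'a
      show "ennreal a * indicator A h * ennreal ((scaled L (x + h) - scaled L x)\<^sup>2) \<le>
          ennreal ((scaled L x - scaled L (x + h))\<^sup>2 * w x (x + h))"
      proof (cases "h \<in> A")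
        case True
        then have "a \<le> w x (x + h)" by (intro lower) (simp add: A_def)
        then have "a * (scaled L (x + h) - scaled L x)\<^sup>2 \<le> (scaled L x - scaled L (x + h))\<^sup>2 * w x (x + h)"
          by (subst power2_commute, subst mult.commute) (rule mult_left_mono, auto)
        then show ?thesis using True a by (simp add: ennreal_mult[symmetric] ennreal_leI)
      qed simp
    qed
    also have "\<dots> = (\<integral>\<^sup>+x. (\<integral>\<^sup>+h. ennreal ((scaled L x - scaled L (x + h))\<^sup>2 * w x (x + h)) \<partial>lborel) \<partial>lborel)"
      by (rule lborel_pair.Fubini') measurable
    also have "\<dots> = energy L"
    proof (rule nn_integral_cong)
      fix x :: 'a
      show "(\<integral>\<^sup>+h. ennreal ((scaled L x - scaled L (x + h))\<^sup>2 * w x (x + h)) \<partial>lborel) =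
          (\<integral>\<^sup>+y. ennreal ((scaled L x - scaled L y)\<^sup>2 * w x y) \<partial>lborel)"
        using nn_integral_lborel_shift[of "\<lambda>y. ennreal ((scaled L x - scaled L y)\<^sup>2 * w x y)" x]
        by (simp add: add.commute)
    qed
    finally show ?thesis .
  qed
  show ?thesis
    by (rule exI[of _ "a * v * s / C'\<^sup>2"], intro conjI exI[of _ 1] allI impI key) (use a v s C' in auto)
qed

text \<open>Partners y at distance between q and 2 q from a point x of the support ball, with q just
  above 2 \<rho> L, lie outside the support, so the increment is the full value at x. Their weight
  is at least of order q^(-2 \<beta>) on a set of volume of order q^d, and integrating over x brings
  a further L^d.\<close>

lemma energy_power_decay:
  assumes r: "r > 0" and c1: "c1 > 0" and c2: "c2 > 0" and \<beta>: "\<beta> > real DIM('a) / 2"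
    and dens: "\<And>x n. n \<ge> n0 \<Longrightarrow> c2 * measure lborel (annulus n x r) \<le>
      measure lborel ({y. c1 * norm (x - y) powr (- \<beta>) \<le> sqrt (w x y)} \<inter> annulus n x r)"
  shows "\<exists>c0>0. \<exists>L0>0. \<forall>L\<ge>L0. ennreal (c0 * L powr (2 * (real DIM('a) - \<beta>))) \<le> energy L"
proof -
  define E where "E x = {y. c1 * norm (x - y) powr (- \<beta>) \<le> sqrt (w x y)}" for x
  have Em [measurable]: "E x \<in> sets borel" for x unfolding E_def by measurable
  define V where "V = unit_ball_vol (real DIM('a))"
  have V: "V > 0" by (simp add: V_def)
  have ball: "measure lborel (cball x (real n * r)) = V * (real n * r) ^ DIM('a)" for x :: 'a and n
    unfolding V_def using r by (intro content_cball) simp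
  have fin: "cball x t \<inter> F \<in> fmeasurable lborel" if "F \<in> sets borel" for x :: 'a and t F
    using that emeasure_lborel_cball_finite[of x t] emeasure_mono[of "cball x t \<inter> F" "cball x t" lborel]
    by (intro fmeasurableI) (auto intro: le_less_trans)
  have finE: "emeasure lborel (cball x t \<inter> E x) \<noteq> \<infinity>" for x t
    using fin[OF Em, of x t x] unfolding fmeasurable_def by auto
  \<comment> \<open>Neighbouring closed annuli overlap in spheres, which are null sets; differences
    of balls have the same measure and telescope.\<close>
  have step: "c2 * (V * (real (Suc n) * r) ^ DIM('a) - V * (real n * r) ^ DIM('a)) \<le>
      measure lborel (cball x (real (Suc n) * r) \<inter> E x) - measure lborel (cball x (real n * r) \<inter> E x)"
    if n: "n \<ge> n0" for n x
  proof -
    define D where "D = cball x (real (Suc n) * r) - cball x (real n * r)"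
    have sub: "cball x (real n * r) \<subseteq> cball x (real (Suc n) * r)" using r by (intro subset_cball mult_right_mono) auto
    have an: "annulus n x r = D \<union> sphere x (real n * r)"
      using r by (auto simp: annulus_def D_def dist_norm algebra_simps)
    have sph: "sphere x (real n * r) \<in> null_sets lborel"
      using negligible_sphere[of x "real n * r"] by (auto simp: null_sets_completion_iff negligible_iff_null_sets)
    have Dm: "D \<in> sets borel" by (simp add: D_def)
    have "measure lborel (annulus n x r) = measure lborel D"
      unfolding an using sph Dm by (intro measure_Un_null_set) auto
    also have "\<dots> = V * (real (Suc n) * r) ^ DIM('a) - V * (real n * r) ^ DIM('a)"
      unfolding D_def ball[of x, symmetric] using sub emeasure_lborel_cball_finite[of x "real (Suc n) * r"]
      by (intro measure_Diff) auto
    finally have m1: "measure lborel (annulus n x r) = V * (real (Suc n) * r) ^ DIM('a) - V * (real n * r) ^ DIM('a)" .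
    have "measure lborel (E x \<inter> annulus n x r) = measure lborel ((E x \<inter> D) \<union> (E x \<inter> sphere x (real n * r)))"
      unfolding an by (simp add: Int_Un_distrib)
    also have "\<dots> = measure lborel (E x \<inter> D)"
      using Dm null_set_Int1[OF sph, of "E x"] by (intro measure_Un_null_set) auto
    also have "E x \<inter> D = (cball x (real (Suc n) * r) \<inter> E x) - (cball x (real n * r) \<inter> E x)" by (auto simp: D_def)
    also have "measure lborel \<dots> = measure lborel (cball x (real (Suc n) * r) \<inter> E x) - measure lborel (cball x (real n * r) \<inter> E x)"
      using finE[of x] sub by (intro measure_Diff) auto
    finally show ?thesis using dens[OF n, of x] unfolding E_def[symmetric] m1 by simp
  qed
  have tele: "c2 * (V * (real (n + i) * r) ^ DIM('a) - V * (real n * r) ^ DIM('a)) \<le>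
      measure lborel (cball x (real (n + i) * r) \<inter> E x) - measure lborel (cball x (real n * r) \<inter> E x)"
    if n: "n \<ge> n0" for n i x
  proof (induction i)
    case (Suc i)
    show ?case using Suc step[of "n + i" x] n by (simp add: algebra_simps)
  qed simp
  \<comment> \<open>Telescoping from n to 2 n gives 2^d - 1 times the volume of the inner ball, and
    this factor is at least 1 since d \<ge> 1.\<close>
  have shell: "c2 * V * (real n * r) ^ DIM('a) \<le> measure lborel ((cball x (2 * (real n * r)) - cball x (real n * r)) \<inter> E x)"
    if n: "n \<ge> n0" for n x
  proof -
    define q where "q = real n * r"
    have q: "q \<ge> 0" using r by (simp add: q_def)
    have "q ^ DIM('a) \<le> (2 * q) ^ DIM('a) - q ^ DIM('a)"
    proof -
      have "2 * q ^ DIM('a) \<le> 2 ^ DIM('a) * q ^ DIM('a)"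
        using power_increasing[of 1 "DIM('a)" "2::real"] q by (intro mult_right_mono) (auto simp: Suc_le_eq)
      then show ?thesis by (simp add: power_mult_distrib)
    qed
    then have "c2 * V * q ^ DIM('a) \<le> c2 * V * ((2 * q) ^ DIM('a) - q ^ DIM('a))"
      using c2 V by (intro mult_left_mono) auto
    also have "\<dots> = c2 * (V * (real (n + n) * r) ^ DIM('a) - V * (real n * r) ^ DIM('a))"
      by (simp add: q_def algebra_simps)
    also have "\<dots> \<le> measure lborel (cball x (real (n + n) * r) \<inter> E x) - measure lborel (cball x (real n * r) \<inter> E x)"
      by (rule tele[OF n])
    also have "real (n + n) * r = 2 * q" by (simp add: q_def)
    also have "measure lborel (cball x (2 * q) \<inter> E x) - measure lborel (cball x (real n * r) \<inter> E x) =
        measure lborel ((cball x (2 * q) \<inter> E x) - (cball x q \<inter> E x))"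
      using finE[of x] q unfolding q_def[symmetric] by (intro measure_Diff[symmetric]) auto
    also have "(cball x (2 * q) \<inter> E x) - (cball x q \<inter> E x) = (cball x (2 * q) - cball x q) \<inter> E x" by auto
    finally show ?thesis by (simp add: q_def)
  qed
  define d where "d = real DIM('a)"
  define C' where "C' = 2 * \<rho> + 2 * r"
  have C': "C' > 0" using \<rho> r by (simp add: C'_def)
  define c0 where "c0 = s * (c1\<^sup>2 * 2 powr (- 2 * \<beta>) * (c2 * V)) * C' powr (d - 2 * \<beta>)"
  have c0: "c0 > 0" using s c1 c2 V C' by (simp add: c0_def)
  \<comment> \<open>Guarantees \<open>n \<ge> n0\<close> for the index chosen below.\<close>
  define L0 where "L0 = max 1 (real n0 * r / (2 * \<rho>))"
  have key: "ennreal (c0 * L powr (2 * (d - \<beta>))) \<le> energy L" if L: "L \<ge> L0" for L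
  proof -
    have L1: "L \<ge> 1" and Ln: "L \<ge> real n0 * r / (2 * \<rho>)" using L by (auto simp: L0_def)
    then have Lpos: "L > 0" by simp
    define n where "n = Suc (nat \<lceil>2 * \<rho> * L / r\<rceil>)"
    have nl: "real n > 2 * \<rho> * L / r" unfolding n_def by linarith
    have "0 \<le> 2 * \<rho> * L / r" using \<rho> r Lpos by simp
    then have nu: "real n \<le> 2 * \<rho> * L / r + 2" unfolding n_def by linarith
    have "real n0 \<le> 2 * \<rho> * L / r" using Ln \<rho> r by (simp add: field_simps)
    then have n: "n \<ge> n0" using nl by linarith
    define q where "q = real n * r"
    have ql: "q > 2 * \<rho> * L" using nl r by (simp add: q_def field_simps)
    have "q \<le> 2 * \<rho> * L + 2 * r" using nu r by (simp add: q_def field_simps)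
    also have "\<dots> \<le> C' * L" using L1 r by (simp add: C'_def algebra_simps)
    finally have qu: "q \<le> C' * L" .
    have q0: "q > 0" using ql \<rho> Lpos by (smt (verit) mult_pos_pos)
    define m where "m = c1\<^sup>2 * (2 * q) powr (- 2 * \<beta>)"
    have m: "m \<ge> 0" by (simp add: m_def)
    have \<beta>0: "\<beta> > 0" using \<beta> by (smt (verit) divide_nonneg_nonneg of_nat_0_le_iff)
    define G where "G x = (cball x (2 * q) - cball x q) \<inter> E x" for x
    have Gm [measurable]: "G x \<in> sets borel" for x unfolding G_def by measurable
    have wG: "m \<le> w x y" if "y \<in> G x" for x y
    proof -
      have xy: "norm (x - y) \<le> 2 * q" "norm (x - y) > 0"
        using that q0 by (auto simp: G_def dist_norm)
      have "(2 * q) powr (- \<beta>) \<le> norm (x - y) powr (- \<beta>)"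
        using xy \<beta>0 by (intro powr_mono2') auto
      then have "c1 * (2 * q) powr (- \<beta>) \<le> c1 * norm (x - y) powr (- \<beta>)" using c1 by simp
      also have "\<dots> \<le> sqrt (w x y)" using that by (simp add: G_def E_def)
      finally have "(c1 * (2 * q) powr (- \<beta>))\<^sup>2 \<le> (sqrt (w x y))\<^sup>2"
        using c1 by (intro power_mono) auto
      moreover have "(c1 * (2 * q) powr (- \<beta>))\<^sup>2 = m"
        using q0 by (simp add: m_def power_mult_distrib power2_eq_square powr_add[symmetric])
      ultimately show ?thesis using w_nonneg by simp
    qed
    have inner: "ennreal ((scaled L x)\<^sup>2) * ennreal (m * (c2 * V * q ^ DIM('a))) \<le>
        (\<integral>\<^sup>+y. ennreal ((scaled L x - scaled L y)\<^sup>2 * w x y) \<partial>lborel)" for x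
    proof (cases "norm x > \<rho> * L")
      case True
      then show ?thesis by (simp add: scaled_zero[OF Lpos])
    next
      case False
      have "ennreal (c2 * V * q ^ DIM('a)) \<le> ennreal (measure lborel (G x))"
        unfolding G_def q_def by (intro ennreal_leI shell n)
      also have "\<dots> = emeasure lborel (G x)"
      proof (rule emeasure_eq_ennreal_measure[symmetric])
        have "emeasure lborel (G x) \<le> emeasure lborel (cball x (2 * q))" by (intro emeasure_mono) (auto simp: G_def)
        then show "emeasure lborel (G x) \<noteq> top"
          using emeasure_lborel_cball_finite[of x "2 * q"] by (auto simp: top_unique)
      qed
      finally have G: "ennreal (c2 * V * q ^ DIM('a)) \<le> emeasure lborel (G x)" .
      have "ennreal ((scaled L x)\<^sup>2) * ennreal (m * (c2 * V * q ^ DIM('a))) =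
          ennreal ((scaled L x)\<^sup>2 * m) * ennreal (c2 * V * q ^ DIM('a))"
        using m c2 V q0 by (simp add: ennreal_mult[symmetric] mult_ac)
      also have "\<dots> \<le> ennreal ((scaled L x)\<^sup>2 * m) * emeasure lborel (G x)" by (intro mult_left_mono G) simp
      also have "\<dots> = (\<integral>\<^sup>+y. ennreal ((scaled L x)\<^sup>2 * m) * indicator (G x) y \<partial>lborel)"
        by (simp add: nn_integral_cmult_indicator)
      also have "\<dots> \<le> (\<integral>\<^sup>+y. ennreal ((scaled L x - scaled L y)\<^sup>2 * w x y) \<partial>lborel)"
      proof (rule nn_integral_mono)
        fix y
        show "ennreal ((scaled L x)\<^sup>2 * m) * indicator (G x) y \<le> ennreal ((scaled L x - scaled L y)\<^sup>2 * w x y)"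
        proof (cases "y \<in> G x")
          case True
          then have "norm (x - y) > q" by (simp add: G_def dist_norm)
          moreover have "norm (x - y) \<le> norm x + norm y" by (rule norm_triangle_ineq4)
          ultimately have "norm y > \<rho> * L" using False ql by linarith
          then have "scaled L y = 0" by (rule scaled_zero[OF Lpos])
          moreover have "(scaled L x)\<^sup>2 * m \<le> (scaled L x)\<^sup>2 * w x y" by (intro mult_left_mono wG True) simp
          ultimately show ?thesis using True by (simp add: ennreal_leI)
        qed simp
      qed
      finally show ?thesis .
    qed
    have "c0 * L powr (2 * (d - \<beta>)) \<le> L ^ DIM('a) * s * (m * (c2 * V * q ^ DIM('a)))"
    proof -
      \<comment> \<open>The exponent is negative because \<beta> > d / 2, so it is the upper bound
        on \<open>q\<close> that yields a lower bound here.\<close>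
      have "(C' * L) powr (d - 2 * \<beta>) \<le> q powr (d - 2 * \<beta>)"
        using q0 qu \<beta> by (intro powr_mono2') (auto simp: d_def)
      then have le: "C' powr (d - 2 * \<beta>) * L powr (d - 2 * \<beta>) \<le> q powr (d - 2 * \<beta>)"
        using C' Lpos by (simp add: powr_mult)
      have "m * q ^ DIM('a) = c1\<^sup>2 * 2 powr (- 2 * \<beta>) * q powr (d - 2 * \<beta>)"
        using q0 by (simp add: m_def powr_mult d_def powr_realpow[symmetric] powr_add[symmetric] mult.assoc)
      then have mq: "m * (c2 * V * q ^ DIM('a)) = c1\<^sup>2 * 2 powr (- 2 * \<beta>) * (c2 * V) * q powr (d - 2 * \<beta>)"
        by (simp add: mult_ac)
      have Ld: "L powr (2 * (d - \<beta>)) = L ^ DIM('a) * L powr (d - 2 * \<beta>)"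
        using Lpos by (simp add: d_def powr_realpow[symmetric] powr_add[symmetric])
      have "c0 * L powr (2 * (d - \<beta>)) = L ^ DIM('a) * s * (c1\<^sup>2 * 2 powr (- 2 * \<beta>) * (c2 * V))
          * (C' powr (d - 2 * \<beta>) * L powr (d - 2 * \<beta>))"
        unfolding Ld c0_def by (simp only: mult_ac)
      also have "\<dots> \<le> L ^ DIM('a) * s * (c1\<^sup>2 * 2 powr (- 2 * \<beta>) * (c2 * V)) * q powr (d - 2 * \<beta>)"
        using s c1 c2 V Lpos by (intro mult_left_mono le) auto
      also have "\<dots> = L ^ DIM('a) * s * (m * (c2 * V * q ^ DIM('a)))" unfolding mq by (simp only: mult_ac)
      finally show ?thesis .
    qed
    then have "ennreal (c0 * L powr (2 * (d - \<beta>))) \<le> ennreal (L ^ DIM('a) * s * (m * (c2 * V * q ^ DIM('a))))"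
      by (rule ennreal_leI)
    also have "\<dots> = (\<integral>\<^sup>+x. ennreal ((scaled L x)\<^sup>2) \<partial>lborel) * ennreal (m * (c2 * V * q ^ DIM('a)))"
      unfolding scaled_norm[OF Lpos] using m c2 V q0 s Lpos by (intro ennreal_mult) auto
    also have "\<dots> = (\<integral>\<^sup>+x. ennreal ((scaled L x)\<^sup>2) * ennreal (m * (c2 * V * q ^ DIM('a))) \<partial>lborel)"
      by (rule nn_integral_multc[symmetric]) measurable
    also have "\<dots> \<le> energy L" by (intro nn_integral_mono inner)
    finally show ?thesis .
  qed
  have "L0 > 0" by (simp add: L0_def)
  then show ?thesis using c0 key unfolding d_def by blast
qed

end

section \<open>Case (ii.c): Taylor expansion with bounded derivatives\<close>

lemma bounded_if_zero_outside_compact: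
  fixes g :: "'a::real_normed_vector \<Rightarrow> 'b::real_normed_vector"
  assumes "continuous_on UNIV g" "compact B" "\<And>x. x \<notin> B \<Longrightarrow> g x = 0"
  obtains A where "A > 0" "\<And>x. norm (g x) \<le> A"
proof -
  have "compact (g ` B)"
    using compact_continuous_image[OF continuous_on_subset[OF assms(1) subset_UNIV] assms(2)] .
  then have "bounded (g ` B)" by (rule compact_imp_bounded)
  then obtain A where "\<forall>y\<in>g ` B. norm y \<le> A" unfolding bounded_iff by (elim exE)
  then have A: "norm (g x) \<le> A" if "x \<in> B" for x using that by (rule bspec[OF _ imageI])
  have "norm (g x) \<le> max A 1" for x
  proof (cases "x \<in> B")
    case True
    then show ?thesis by (intro max.coboundedI1 A)
  next
    case False
    then show ?thesis by (simp add: assms(3))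
  qed
  moreover have "max A 1 > 0" by simp
  ultimately show ?thesis using that by metis
qed

lemma derivative_zero_outside_closed:
  fixes f :: "'a::real_normed_vector \<Rightarrow> 'b::real_normed_vector"
  assumes "\<And>x. (f has_derivative blinfun_apply (D x)) (at x)" "closed B" "\<And>x. x \<notin> B \<Longrightarrow> f x = 0" "x \<notin> B"
  shows "D x = 0"
proof -
  have "((\<lambda>_. 0) has_derivative blinfun_apply (D x)) (at x)"
  proof (rule has_derivative_transform_within_open[OF assms(1)[of x]])
    show "open (- B)" using assms(2) by (rule open_Compl)
    show "x \<in> - B" using assms(4) by simp
    show "f y = 0" if "y \<in> - B" for y using that by (simp add: assms(3))
  qed
  then have "blinfun_apply (D x) = (\<lambda>_. 0)"
    using has_derivative_const by (rule has_derivative_unique)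
  then show ?thesis by (intro blinfun_eqI) simp
qed

text \<open>Compact support bounds both derivatives. The bound on the second makes \<open>D\<close>
  Lipschitz, and the mean value inequality for \<phi> minus its linear part at x gives the
  remainder; the factor 1/2 of Taylor's formula is given away.\<close>

lemma C2_Taylor:
  fixes \<phi> :: "'a::euclidean_space \<Rightarrow> real"
  assumes C2: "C2_function \<phi>" and B: "compact B" "\<And>x. x \<notin> B \<Longrightarrow> \<phi> x = 0"
  obtains D A where "\<And>x. (\<phi> has_derivative blinfun_apply (D x)) (at x)" "continuous_on UNIV D"
    "A > 0" "\<And>x. norm (D x) \<le> A" "\<And>x y. \<bar>\<phi> y - \<phi> x - blinfun_apply (D x) (y - x)\<bar> \<le> A * (norm (y - x))\<^sup>2"
proof -
  obtain D :: "'a \<Rightarrow> 'a \<Rightarrow>\<^sub>L real" and D2 :: "'a \<Rightarrow> 'a \<Rightarrow>\<^sub>L 'a \<Rightarrow>\<^sub>L real"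
    where D: "\<And>x. (\<phi> has_derivative blinfun_apply (D x)) (at x)"
      and D2: "\<And>x. (D has_derivative blinfun_apply (D2 x)) (at x)"
      and cont: "continuous_on UNIV D2"
    using C2 unfolding C2_function_def by blast
  have cl: "closed B" using B(1) by (rule compact_imp_closed)
  have D0: "D x = 0" if "x \<notin> B" for x by (rule derivative_zero_outside_closed[OF D cl B(2) that])
  have D20: "D2 x = 0" if "x \<notin> B" for x by (rule derivative_zero_outside_closed[OF D2 cl D0 that])
  have contD: "continuous_on UNIV D"
    by (rule has_derivative_continuous_on) (rule has_derivative_at_withinI[OF D2])
  obtain A1 where A1: "A1 > 0" "\<And>x. norm (D x) \<le> A1"
    using bounded_if_zero_outside_compact[OF contD B(1) D0] by blast
  obtain A2 where A2: "A2 > 0" "\<And>x. norm (D2 x) \<le> A2"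
    using bounded_if_zero_outside_compact[OF cont B(1) D20] by blast
  have lip: "norm (D y - D x) \<le> A2 * norm (y - x)" for x y
    by (rule differentiable_bound[of UNIV D "\<lambda>x. blinfun_apply (D2 x)"])
      (use D2 A2 in \<open>auto simp: norm_blinfun.rep_eq[symmetric]\<close>)
  have rem: "\<bar>\<phi> y - \<phi> x - blinfun_apply (D x) (y - x)\<bar> \<le> A2 * (norm (y - x))\<^sup>2" for x y
  proof -
    have "norm ((\<phi> y - blinfun_apply (D x) y) - (\<phi> x - blinfun_apply (D x) x)) \<le> (A2 * norm (y - x)) * norm (y - x)"
    proof (rule differentiable_bound[where S = "cball x (norm (y - x))" and f' = "\<lambda>z. blinfun_apply (D z - D x)"])
      fix z assume z: "z \<in> cball x (norm (y - x))"
      show "((\<lambda>y. \<phi> y - blinfun_apply (D x) y) has_derivative blinfun_apply (D z - D x)) (at z within cball x (norm (y - x)))"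
      proof -
        have "((\<lambda>y. \<phi> y - blinfun_apply (D x) y) has_derivative (\<lambda>h. blinfun_apply (D z) h - blinfun_apply (D x) h))
            (at z within cball x (norm (y - x)))"
          by (intro has_derivative_diff has_derivative_at_withinI[OF D] bounded_linear_imp_has_derivative
              blinfun.bounded_linear_right)
        moreover have "(\<lambda>h. blinfun_apply (D z) h - blinfun_apply (D x) h) = blinfun_apply (D z - D x)"
          by (simp add: fun_eq_iff blinfun.diff_left)
        ultimately show ?thesis by simp
      qed
      have "norm (D z - D x) \<le> A2 * norm (z - x)" by (rule lip)
      also have "\<dots> \<le> A2 * norm (y - x)"
        using z A2(1) by (intro mult_left_mono) (auto simp: dist_norm norm_minus_commute)
      finally show "onorm (blinfun_apply (D z - D x)) \<le> A2 * norm (y - x)"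
        by (simp add: norm_blinfun.rep_eq)
    qed (auto simp: dist_norm norm_minus_commute)
    then show ?thesis by (simp add: blinfun.diff_right power2_eq_square mult.assoc algebra_simps)
  qed
  show ?thesis
  proof (rule that[of D "max A1 A2"])
    show "norm (D x) \<le> max A1 A2" for x using A1(2)[of x] by simp
    show "\<bar>\<phi> y - \<phi> x - blinfun_apply (D x) (y - x)\<bar> \<le> max A1 A2 * (norm (y - x))\<^sup>2" for x y
      using rem[of y x] mult_right_mono[of A2 "max A1 A2" "(norm (y - x))\<^sup>2"] by simp
  qed (use D contD A1 in auto)
qed

text \<open>Otherwise \<phi> would be constant, and the constant is zero outside the support,
  contradicting \<open>s > 0\<close>.\<close>

lemma (in bump) gradient_nonzero:
  assumes D: "\<And>x. (\<phi> has_derivative blinfun_apply (D x)) (at x)"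
  obtains x where "D x \<noteq> 0"
proof (rule ccontr)
  assume "\<not> thesis"
  then have "D x = 0" for x using that by blast
  then have "(\<phi> has_derivative (\<lambda>h. 0)) (at x within UNIV)" for x
    using D[of x] by (simp add: zero_blinfun.rep_eq)
  then obtain c where c: "\<And>x. \<phi> x = c"
    using has_derivative_zero_constant[of UNIV \<phi>] by auto
  obtain b :: 'a where b: "b \<in> Basis" using nonempty_Basis by blast
  have "norm ((\<rho> + 1) *\<^sub>R b) > \<rho>" using b \<rho>(1) by simp
  then have "c = 0" using \<rho>(2) c by metis
  then have "(\<integral>\<^sup>+x. ennreal ((\<phi> x)\<^sup>2) \<partial>lborel) = 0" using c by simp
  then show False using s by simp
qed

context bump_weight
begin

text \<open>Where the gradient is bounded away from zero, the squared first order term contributes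
  at least order L^-2 per point by the second moment bound, uniformly in the direction of the
  gradient. Its product with the remainder is only of order L^-3 by the third moment bound. The
  points concerned fill a volume of order L^d.\<close>

lemma energy_smooth:
  assumes C2: "C2_function \<phi>"
    and third: "(SUP x. \<integral>\<^sup>+y. ennreal (norm (x - y) ^ 3 * w x y) \<partial>lborel) < \<infinity>"
    and second: "(INF x. INF u\<in>sphere 0 1. \<integral>\<^sup>+y. ennreal (\<bar>(y - x) \<bullet> u\<bar>\<^sup>2 * w x y) \<partial>lborel) > 0"
  shows "\<exists>c0>0. \<exists>L0>0. \<forall>L\<ge>L0. ennreal (c0 * (L ^ DIM('a) / L\<^sup>2)) \<le> energy L"
proof -
  have zero: "\<phi> x = 0" if "x \<notin> cball 0 \<rho>" for x using that \<rho>(2)[of x] by simp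
  obtain D A where D: "\<And>x. (\<phi> has_derivative blinfun_apply (D x)) (at x)" and contD: "continuous_on UNIV D"
    and A: "A > 0" "\<And>x. norm (D x) \<le> A" "\<And>x y. \<bar>\<phi> y - \<phi> x - blinfun_apply (D x) (y - x)\<bar> \<le> A * (norm (y - x))\<^sup>2"
    using C2_Taylor[OF C2 compact_cball zero] by blast
  \<comment> \<open>The gradient as a vector, which turns the derivative into an inner product with
    a direction.\<close>
  define g where "g x = (\<Sum>b\<in>Basis. blinfun_apply (D x) b *\<^sub>R b)" for x
  have Dg: "blinfun_apply (D x) v = v \<bullet> g x" for x v
  proof -
    have "blinfun_apply (D x) v = blinfun_apply (D x) (\<Sum>b\<in>Basis. (v \<bullet> b) *\<^sub>R b)" by (simp add: euclidean_representation)
    also have "\<dots> = (\<Sum>b\<in>Basis. (v \<bullet> b) * blinfun_apply (D x) b)" by (simp add: blinfun.sum_right blinfun.scaleR_right)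
    also have "\<dots> = v \<bullet> g x" by (simp add: g_def inner_sum_right mult.commute)
    finally show ?thesis .
  qed
  have contg: "continuous_on UNIV g" unfolding g_def by (intro continuous_intros contD)
  obtain x0 where "D x0 \<noteq> 0" using gradient_nonzero[OF D] by blast
  then have gx0: "g x0 \<noteq> 0" using Dg[of x0] by (auto intro!: blinfun_eqI)
  define \<epsilon> where "\<epsilon> = norm (g x0) / 2"
  have \<epsilon>: "\<epsilon> > 0" using gx0 by (simp add: \<epsilon>_def)
  have "isCont g x0" using contg by (simp add: continuous_on_eq_continuous_at)
  then obtain t where t: "t > 0" "\<And>x. dist x x0 < t \<Longrightarrow> dist (g x) (g x0) < \<epsilon>"
    using \<epsilon> unfolding continuous_at_eps_delta by blast
  have g_lower: "\<epsilon> \<le> norm (g x)" if "x \<in> ball x0 t" for x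
  proof -
    have "norm (g x - g x0) < \<epsilon>" using t(2)[of x] that by (simp add: dist_norm norm_minus_commute)
    moreover have "norm (g x0) \<le> norm (g x) + norm (g x - g x0)" using norm_triangle_ineq4[of "g x" "g x - g x0"] by simp
    ultimately show ?thesis by (simp add: \<epsilon>_def)
  qed
  obtain M3 where M3: "M3 \<ge> 0" "(SUP x. \<integral>\<^sup>+y. ennreal (norm (x - y) ^ 3 * w x y) \<partial>lborel) = ennreal M3"
    using third by (cases "SUP x. \<integral>\<^sup>+y. ennreal (norm (x - y) ^ 3 * w x y) \<partial>lborel") auto
  have third': "(\<integral>\<^sup>+y. ennreal (norm (x - y) ^ 3 * w x y) \<partial>lborel) \<le> ennreal M3" for x
    unfolding M3(2)[symmetric] by (rule SUP_upper) simp
  define I where "I = (INF x. INF u\<in>sphere 0 1. \<integral>\<^sup>+y. ennreal (\<bar>(y - x) \<bullet> u\<bar>\<^sup>2 * w x y) \<partial>lborel)"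
  \<comment> \<open>The infimum may be infinite; any positive real below it will do.\<close>
  obtain \<kappa> where \<kappa>: "\<kappa> > 0" "ennreal \<kappa> \<le> I"
  proof (cases I)
    case (real i)
    then have "i > 0" using second unfolding I_def[symmetric] by simp
    then show ?thesis using real by (intro that[of i]) auto
  next
    case top
    then show ?thesis by (intro that[of 1]) auto
  qed
  have second': "ennreal \<kappa> \<le> (\<integral>\<^sup>+y. ennreal (\<bar>(y - x) \<bullet> u\<bar>\<^sup>2 * w x y) \<partial>lborel)" if "norm u = 1" for x u
  proof -
    have "I \<le> (INF u\<in>sphere 0 1. \<integral>\<^sup>+y. ennreal (\<bar>(y - x) \<bullet> u\<bar>\<^sup>2 * w x y) \<partial>lborel)"
      unfolding I_def by (rule INF_lower) simp
    also have "\<dots> \<le> (\<integral>\<^sup>+y. ennreal (\<bar>(y - x) \<bullet> u\<bar>\<^sup>2 * w x y) \<partial>lborel)"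
      using that by (intro INF_lower) simp
    finally show ?thesis using \<kappa>(2) by simp
  qed
  define V where "V = measure lborel (ball x0 t)"
  have V: "V > 0" unfolding V_def using t by (intro content_ball_pos) simp
  \<comment> \<open>Beyond this scale the error 2 A^2 M3 / L^3 takes at most half of the leading
    term \<epsilon>^2 \<kappa> / L^2.\<close>
  define L0 where "L0 = max 1 (4 * A\<^sup>2 * M3 / (\<epsilon>\<^sup>2 * \<kappa>))"
  have key: "ennreal (\<epsilon>\<^sup>2 * \<kappa> / 2 * V * (L ^ DIM('a) / L\<^sup>2)) \<le> energy L" if L: "L \<ge> L0" for L
  proof -
    have L1: "L \<ge> 1" and L2: "L \<ge> 4 * A\<^sup>2 * M3 / (\<epsilon>\<^sup>2 * \<kappa>)" using L by (auto simp: L0_def)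
    have Lpos: "L > 0" using L1 by simp
    have inner: "ennreal (\<epsilon>\<^sup>2 * \<kappa> / 2 / L\<^sup>2) \<le> (\<integral>\<^sup>+y. ennreal ((scaled L x - scaled L y)\<^sup>2 * w x y) \<partial>lborel)" (is "_ \<le> ?F")
      if x: "x /\<^sub>R L \<in> ball x0 t" for x
    proof -
      define z where "z = x /\<^sub>R L"
      define n where "n = norm (g z)"
      have n: "n \<ge> \<epsilon>" using g_lower[OF x] by (simp add: n_def z_def)
      have n0: "n > 0" using n \<epsilon> by simp
      define u where "u = g z /\<^sub>R n"
      have u: "norm u = 1" using n0 by (simp add: u_def n_def)
      have gu: "g z = n *\<^sub>R u" using n0 by (simp add: u_def)
      \<comment> \<open>With first order term \<open>a\<close> and remainder \<open>r\<close>, (a +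
        r)^2 \<ge> a^2 - 2 |a| |r|, and |a| |r| is at most cubic in |x - y| / L; this is where the
        third moment comes in.\<close>
      have pt: "n\<^sup>2 / L\<^sup>2 * (\<bar>(y - x) \<bullet> u\<bar>\<^sup>2 * w x y) \<le>
          (scaled L x - scaled L y)\<^sup>2 * w x y + 2 * A\<^sup>2 / L ^ 3 * (norm (x - y) ^ 3 * w x y)" for y
      proof -
        define a where "a = blinfun_apply (D z) (y /\<^sub>R L - z)"
        define r where "r = \<phi> (y /\<^sub>R L) - \<phi> z - a"
        define h where "h = norm (x - y) / L"
        have yz: "y /\<^sub>R L - z = (y - x) /\<^sub>R L" by (simp add: z_def scaleR_diff_right)
        have h: "norm (y /\<^sub>R L - z) = h"
          unfolding yz h_def norm_minus_commute[of x y] using Lpos by (simp add: divide_inverse mult.commute)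
        have "\<bar>a\<bar> \<le> norm (D z) * h"
          using norm_blinfun[of "D z" "y /\<^sub>R L - z"] unfolding a_def h real_norm_def .
        also have "\<dots> \<le> A * h" using A(2)[of z] by (intro mult_right_mono) (auto simp: h_def Lpos less_imp_le)
        finally have ab: "\<bar>a\<bar> \<le> A * h" .
        have rb: "\<bar>r\<bar> \<le> A * h\<^sup>2" unfolding r_def a_def h[symmetric] by (rule A(3))
        have "\<bar>a\<bar> * \<bar>r\<bar> \<le> (A * h) * (A * h\<^sup>2)"
          by (rule mult_mono[OF ab rb]) (use A(1) in \<open>auto simp: h_def Lpos less_imp_le\<close>)
        also have "\<dots> = A\<^sup>2 / L ^ 3 * norm (x - y) ^ 3"
          by (simp add: h_def power2_eq_square power3_eq_cube mult_ac)
        finally have "- (a * r) \<le> A\<^sup>2 / L ^ 3 * norm (x - y) ^ 3"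
          using abs_ge_minus_self[of "a * r"] by (simp add: abs_mult)
        moreover have "(scaled L x - scaled L y)\<^sup>2 = (a + r)\<^sup>2"
          unfolding r_def scaled_def z_def by (simp add: power2_commute)
        moreover have "0 \<le> r\<^sup>2" by simp
        ultimately have "a\<^sup>2 \<le> (scaled L x - scaled L y)\<^sup>2 + 2 * (A\<^sup>2 / L ^ 3 * norm (x - y) ^ 3)"
          by (simp add: power2_sum)
        moreover have "a = n / L * ((y - x) \<bullet> u)"
          unfolding a_def Dg gu yz by (simp add: divide_inverse)
        then have "a\<^sup>2 = n\<^sup>2 / L\<^sup>2 * \<bar>(y - x) \<bullet> u\<bar>\<^sup>2" by (simp add: power_mult_distrib power_divide)
        ultimately have "n\<^sup>2 / L\<^sup>2 * \<bar>(y - x) \<bullet> u\<bar>\<^sup>2 \<le> (scaled L x - scaled L y)\<^sup>2 + 2 * (A\<^sup>2 / L ^ 3 * norm (x - y) ^ 3)" by simp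
        from mult_right_mono[OF this w_nonneg[of x y]] show ?thesis by (simp add: algebra_simps)
      qed
      have "ennreal (n\<^sup>2 / L\<^sup>2) * ennreal \<kappa> \<le> ennreal (n\<^sup>2 / L\<^sup>2) * (\<integral>\<^sup>+y. ennreal (\<bar>(y - x) \<bullet> u\<bar>\<^sup>2 * w x y) \<partial>lborel)"
        by (intro mult_left_mono second' u) simp
      also have "\<dots> = (\<integral>\<^sup>+y. ennreal (n\<^sup>2 / L\<^sup>2 * (\<bar>(y - x) \<bullet> u\<bar>\<^sup>2 * w x y)) \<partial>lborel)"
        using w_nonneg by (subst nn_integral_cmult[symmetric], measurable) (simp add: ennreal_mult[symmetric])
      also have "\<dots> \<le> (\<integral>\<^sup>+y. ennreal ((scaled L x - scaled L y)\<^sup>2 * w x y) + ennreal (2 * A\<^sup>2 / L ^ 3) * ennreal (norm (x - y) ^ 3 * w x y) \<partial>lborel)"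
      proof (rule nn_integral_mono)
        fix y
        have "ennreal (n\<^sup>2 / L\<^sup>2 * (\<bar>(y - x) \<bullet> u\<bar>\<^sup>2 * w x y)) \<le>
          ennreal ((scaled L x - scaled L y)\<^sup>2 * w x y + 2 * A\<^sup>2 / L ^ 3 * (norm (x - y) ^ 3 * w x y))"
          by (intro ennreal_leI pt)
        also have "\<dots> = ennreal ((scaled L x - scaled L y)\<^sup>2 * w x y) + ennreal (2 * A\<^sup>2 / L ^ 3 * (norm (x - y) ^ 3 * w x y))"
          using w_nonneg Lpos by (intro ennreal_plus) auto
        also have "ennreal (2 * A\<^sup>2 / L ^ 3 * (norm (x - y) ^ 3 * w x y)) = ennreal (2 * A\<^sup>2 / L ^ 3) * ennreal (norm (x - y) ^ 3 * w x y)"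
          using w_nonneg Lpos by (intro ennreal_mult) auto
        finally show "ennreal (n\<^sup>2 / L\<^sup>2 * (\<bar>(y - x) \<bullet> u\<bar>\<^sup>2 * w x y)) \<le>
          ennreal ((scaled L x - scaled L y)\<^sup>2 * w x y) + ennreal (2 * A\<^sup>2 / L ^ 3) * ennreal (norm (x - y) ^ 3 * w x y)" .
      qed
      also have "\<dots> = ?F + ennreal (2 * A\<^sup>2 / L ^ 3) * (\<integral>\<^sup>+y. ennreal (norm (x - y) ^ 3 * w x y) \<partial>lborel)"
        by (simp add: nn_integral_add nn_integral_cmult)
      also have "\<dots> \<le> ?F + ennreal (2 * A\<^sup>2 / L ^ 3) * ennreal M3"
        by (intro add_left_mono mult_left_mono third') simp
      finally have le: "ennreal (n\<^sup>2 / L\<^sup>2) * ennreal \<kappa> \<le> ?F + ennreal (2 * A\<^sup>2 / L ^ 3) * ennreal M3" .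
      show ?thesis
      proof (cases ?F)
        case (real v)
        have "ennreal (n\<^sup>2 / L\<^sup>2 * \<kappa>) \<le> ennreal (v + 2 * A\<^sup>2 / L ^ 3 * M3)"
        proof -
          have "ennreal (n\<^sup>2 / L\<^sup>2 * \<kappa>) = ennreal (n\<^sup>2 / L\<^sup>2) * ennreal \<kappa>"
            using \<kappa>(1) by (intro ennreal_mult) auto
          also note le
          also have "?F + ennreal (2 * A\<^sup>2 / L ^ 3) * ennreal M3 = ennreal v + ennreal (2 * A\<^sup>2 / L ^ 3 * M3)"
            unfolding real using M3(1) Lpos by (intro arg_cong2[where f = "(+)"] refl ennreal_mult[symmetric]) auto
          also have "\<dots> = ennreal (v + 2 * A\<^sup>2 / L ^ 3 * M3)"
            using real M3(1) Lpos by (intro ennreal_plus[symmetric]) auto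
          finally show ?thesis .
        qed
        then have b1: "n\<^sup>2 / L\<^sup>2 * \<kappa> \<le> v + 2 * A\<^sup>2 / L ^ 3 * M3"
          using real M3(1) Lpos by (subst (asm) ennreal_le_iff) auto
        have "\<epsilon>\<^sup>2 / L\<^sup>2 * \<kappa> \<le> n\<^sup>2 / L\<^sup>2 * \<kappa>"
          using n \<epsilon> \<kappa>(1) Lpos by (intro mult_right_mono divide_right_mono power_mono) auto
        moreover have "2 * A\<^sup>2 / L ^ 3 * M3 \<le> \<epsilon>\<^sup>2 * \<kappa> / 2 / L\<^sup>2"
        proof -
          have "4 * A\<^sup>2 * M3 \<le> L * (\<epsilon>\<^sup>2 * \<kappa>)" using L2 \<epsilon> \<kappa>(1) by (simp add: divide_le_eq)
          then have "4 * A\<^sup>2 * M3 / (2 * L ^ 3) \<le> L * (\<epsilon>\<^sup>2 * \<kappa>) / (2 * L ^ 3)"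
            using Lpos by (intro divide_right_mono) auto
          then show ?thesis using Lpos by (simp add: power2_eq_square power3_eq_cube field_simps)
        qed
        moreover have "\<epsilon>\<^sup>2 / L\<^sup>2 * \<kappa> = \<epsilon>\<^sup>2 * \<kappa> / 2 / L\<^sup>2 + \<epsilon>\<^sup>2 * \<kappa> / 2 / L\<^sup>2" by (simp add: field_simps)
        ultimately have "\<epsilon>\<^sup>2 * \<kappa> / 2 / L\<^sup>2 \<le> v" using b1 by linarith
        then show ?thesis unfolding real by (rule ennreal_leI)
      qed simp
    qed
    define U where "U = (\<lambda>x. x /\<^sub>R L) -` ball x0 t"
    have Um [measurable]: "U \<in> sets borel"
      unfolding U_def by (rule measurable_sets_borel[of _ borel]) auto
    have "emeasure lborel U = (\<integral>\<^sup>+x. indicator U x \<partial>lborel)" by simp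
    also have "\<dots> = (\<integral>\<^sup>+x. indicator (ball x0 t) (x /\<^sub>R L) \<partial>lborel)"
      by (intro nn_integral_cong) (simp add: U_def indicator_def)
    also have "\<dots> = ennreal (L ^ DIM('a)) * emeasure lborel (ball x0 t)"
    proof -
      have "(indicator (ball x0 t) :: 'a \<Rightarrow> ennreal) \<in> borel_measurable borel" by (intro borel_measurable_indicator) auto
      from nn_integral_lborel_scale[OF this Lpos] show ?thesis by simp
    qed
    also have "emeasure lborel (ball x0 t) = ennreal V"
      unfolding V_def using emeasure_lborel_ball_finite[of x0 t] by (intro emeasure_eq_ennreal_measure) auto
    finally have mU: "emeasure lborel U = ennreal (L ^ DIM('a)) * ennreal V" .
    have "ennreal (\<epsilon>\<^sup>2 * \<kappa> / 2 * V * (L ^ DIM('a) / L\<^sup>2)) = ennreal (\<epsilon>\<^sup>2 * \<kappa> / 2 / L\<^sup>2) * emeasure lborel U"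
      unfolding mU using \<kappa>(1) V Lpos by (simp add: ennreal_mult[symmetric] mult_ac)
    also have "\<dots> = (\<integral>\<^sup>+x. ennreal (\<epsilon>\<^sup>2 * \<kappa> / 2 / L\<^sup>2) * indicator U x \<partial>lborel)"
      by (simp add: nn_integral_cmult_indicator)
    also have "\<dots> \<le> energy L"
    proof (rule nn_integral_mono)
      fix x
      show "ennreal (\<epsilon>\<^sup>2 * \<kappa> / 2 / L\<^sup>2) * indicator U x \<le> (\<integral>\<^sup>+y. ennreal ((scaled L x - scaled L y)\<^sup>2 * w x y) \<partial>lborel)"
        using inner[of x] by (cases "x \<in> U") (auto simp: U_def)
    qed
    finally show ?thesis .
  qed
  have "L0 > 0" by (simp add: L0_def)
  moreover have "\<epsilon>\<^sup>2 * \<kappa> / 2 * V > 0" using \<epsilon> \<kappa>(1) V by simp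
  ultimately show ?thesis using key by blast
qed

end

section \<open>The variance lower bound\<close>

lemma nn_integral_lborel_le_density:
  fixes f :: "'a::euclidean_space \<Rightarrow> real"
  assumes [measurable]: "f \<in> borel_measurable borel" "g \<in> borel_measurable borel"
    and "c > 0" and f: "\<And>x. inverse c \<le> f x"
  shows "(\<integral>\<^sup>+x. g x \<partial>lborel) \<le> ennreal c * (\<integral>\<^sup>+x. g x \<partial>density lborel (\<lambda>x. ennreal (f x)))"
proof -
  have "(\<integral>\<^sup>+x. g x \<partial>lborel) \<le> (\<integral>\<^sup>+x. ennreal c * (ennreal (f x) * g x) \<partial>lborel)"
  proof (rule nn_integral_mono)
    fix x
    have "c * inverse c \<le> c * f x" using f[of x] \<open>c > 0\<close> by (intro mult_left_mono) simp_all
    then have "ennreal 1 \<le> ennreal (c * f x)" using \<open>c > 0\<close> by (intro ennreal_leI) simp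
    also have "\<dots> = ennreal c * ennreal (f x)" using \<open>c > 0\<close> by (intro ennreal_mult') simp
    finally have "1 * g x \<le> ennreal c * ennreal (f x) * g x" by (intro mult_right_mono) simp_all
    then show "g x \<le> ennreal c * (ennreal (f x) * g x)" by (simp add: mult.assoc)
  qed
  also have "\<dots> = ennreal c * (\<integral>\<^sup>+x. g x \<partial>density lborel (\<lambda>x. ennreal (f x)))"
    by (simp add: nn_integral_cmult nn_integral_density)
  finally show ?thesis .
qed

text \<open>The one-variable comparison is applied in each variable; in between, the inner integral
  has to be seen to be measurable.\<close>

lemma double_nn_integral_lborel_le_density:
  fixes f :: "'a::euclidean_space \<Rightarrow> real"
  assumes f [measurable]: "f \<in> borel_measurable borel"
    and g: "(\<lambda>(x, y). g x y) \<in> borel_measurable (borel \<Otimes>\<^sub>M borel)"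
    and c: "c > 0" "\<And>x. inverse c \<le> f x"
  shows "(\<integral>\<^sup>+x. \<integral>\<^sup>+y. g x y \<partial>lborel \<partial>lborel) \<le>
    ennreal (c * c) * (\<integral>\<^sup>+x. \<integral>\<^sup>+y. g x y \<partial>density lborel (\<lambda>x. ennreal (f x)) \<partial>density lborel (\<lambda>x. ennreal (f x)))"
proof -
  define \<mu> where "\<mu> = density lborel (\<lambda>x. ennreal (f x))"
  have g' [measurable]: "(\<lambda>z. g (fst z) (snd z)) \<in> borel_measurable (borel \<Otimes>\<^sub>M borel)"
    using g by (simp only: case_prod_unfold)
  have gx: "g x \<in> borel_measurable borel" for x
    using measurable_compose[OF measurable_Pair1'[of x borel borel] g']
    by (simp only: fst_conv snd_conv space_borel UNIV_I)
  have gm: "(\<lambda>z. ennreal (f (snd z)) * g (fst z) (snd z)) \<in> borel_measurable (borel \<Otimes>\<^sub>M borel)"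
    by measurable
  have inner: "(\<integral>\<^sup>+y. g x y \<partial>\<mu>) = (\<integral>\<^sup>+y. ennreal (f y) * g x y \<partial>lborel)" for x
    unfolding \<mu>_def using gx f by (intro nn_integral_density) simp_all
  have meas: "(\<lambda>x. \<integral>\<^sup>+y. g x y \<partial>\<mu>) \<in> borel_measurable borel"
    unfolding inner
    by (rule lborel.borel_measurable_nn_integral)
      (use gm in \<open>simp only: case_prod_unfold measurable_cong_sets[OF sets_pair_measure_cong[OF refl sets_lborel] refl]\<close>)
  have "(\<integral>\<^sup>+x. \<integral>\<^sup>+y. g x y \<partial>lborel \<partial>lborel) \<le> (\<integral>\<^sup>+x. ennreal c * (\<integral>\<^sup>+y. g x y \<partial>\<mu>) \<partial>lborel)"
    unfolding \<mu>_def by (intro nn_integral_mono nn_integral_lborel_le_density f gx c)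
  also have "\<dots> = ennreal c * (\<integral>\<^sup>+x. (\<integral>\<^sup>+y. g x y \<partial>\<mu>) \<partial>lborel)"
    using meas by (intro nn_integral_cmult) simp
  also have "\<dots> \<le> ennreal c * (ennreal c * (\<integral>\<^sup>+x. (\<integral>\<^sup>+y. g x y \<partial>\<mu>) \<partial>\<mu>))"
    using nn_integral_lborel_le_density[OF f meas c] unfolding \<mu>_def[symmetric] by (intro mult_left_mono) auto
  also have "\<dots> = ennreal (c * c) * (\<integral>\<^sup>+x. (\<integral>\<^sup>+y. g x y \<partial>\<mu>) \<partial>\<mu>)"
    using c(1) by (simp add: ennreal_mult mult.assoc)
  finally show ?thesis unfolding \<mu>_def .
qed

text \<open>A strictly positive left-hand side excludes that \<open>ennreal\<close> has truncated a
  negative right-hand side, so the inequality descends to real numbers.\<close>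

lemma power_bound_of_ennreal_bound:
  fixes v :: "real \<Rightarrow> real"
  assumes "q > 0" "c0 > 0" "L0 > 0"
    and le: "\<And>L. L \<ge> L0 \<Longrightarrow> ennreal (c0 * L powr \<eta>) \<le> ennreal (q * v L)"
  shows "\<exists>c\<^sub>0>0. \<exists>L\<^sub>0>0. \<forall>L\<ge>L\<^sub>0. v L \<ge> c\<^sub>0 * L powr \<eta>"
proof (intro exI conjI allI impI)
  show "c0 / q > 0" "L0 > 0" using assms by auto
  fix L assume L: "L \<ge> L0"
  then have "c0 * L powr \<eta> > 0" using assms by simp
  then have "c0 * L powr \<eta> \<le> q * v L" using le[OF L] by (simp add: ennreal_le_iff2)
  then show "c0 / q * L powr \<eta> \<le> v L" using assms(1) by (simp add: field_simps)
qed

theorem theorem1p6: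
  fixes P :: "'w measure"
    and X :: "'w \<Rightarrow> 'a::euclidean_space set"
    and K :: "'a \<Rightarrow> 'a \<Rightarrow> complex"
    and \<mu> :: "'a measure"
    and f \<phi> :: "'a \<Rightarrow> real"
    and \<alpha> b c \<eta> :: real
  assumes alpha: "\<alpha> \<in> {2 / real m | m. m \<ge> 1} \<union> {- 1 / real m | m. m \<ge> 1}"
    and mu: "\<mu> = density lborel (\<lambda>x. ennreal (f x))"
    and f_measurable: "f \<in> borel_measurable borel"
    and c_pos: "c > 0"
    and f_bounds: "\<And>x. inverse c \<le> f x \<and> f x \<le> c"
    and kernel_hermitian: "\<And>x y. K x y = cnj (K y x)"
    and K_bounded: "bounded_kernel \<mu> K"
    and K_hermitian: "L2_hermitian \<mu> (kernel_op \<mu> K)"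
    and K_positive: "L2_positive \<mu> (kernel_op \<mu> K)"
    and K_trace_class: "L2_locally_trace_class \<mu> (kernel_op \<mu> K)"
    and K_diagonal: "diagonal_normalized \<mu> K"
    and K_spectrum: "\<alpha> < 0 \<Longrightarrow> L2_spectrum \<mu> (kernel_op \<mu> K) \<subseteq> complex_of_real ` {0 .. - 1 / \<alpha>}"
    and b_pos: "b > 0"
    and diagonal_bound: "\<And>x. Re (K x x) \<le> b"
    and process: "alpha_determinantal_process P X \<alpha> K \<mu>"
    and phi_measurable: "\<phi> \<in> borel_measurable borel"
    and phi_bounded: "bounded (range \<phi>)"
    and phi_support: "compact (closure {x. \<phi> x \<noteq> 0})"
    and phi_norm: "L2_norm lborel \<phi> > 0"
    and cases:
      "(condition_i \<alpha> K \<mu> \<and> \<eta> = real DIM('a)) \<or>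
       (condition_iia \<alpha> K \<and> \<eta> = real DIM('a) - 4) \<or>
       (\<exists>\<beta>. condition_iib \<alpha> K \<beta> \<and> \<eta> = 2 * (real DIM('a) - \<beta>)) \<or>
       (condition_iic \<alpha> K \<phi> \<and> \<eta> = real DIM('a) - 2)"
  shows "\<exists>c\<^sub>0>0. \<exists>L\<^sub>0>0. \<forall>L\<ge>L\<^sub>0.
    prob_space.variance P (\<lambda>\<omega>. linear_statistic (\<lambda>x. \<phi> (x /\<^sub>R L)) (X \<omega>)) \<ge> c\<^sub>0 * L powr \<eta>"
proof -
  have fpos: "0 \<le> f x" for x using f_bounds[of x] c_pos by (smt (verit) positive_imp_inverse_positive)
  have f_lower: "\<And>x. inverse c \<le> f x" using f_bounds by blast
  have sets_mu: "sets \<mu> = sets borel" by (simp add: mu)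
  have fin: "emeasure \<mu> B < \<infinity>" if "compact B" for B
  proof -
    have B: "B \<in> sets borel" using that by (simp add: borel_compact)
    have "emeasure \<mu> B = (\<integral>\<^sup>+x. ennreal (f x) * indicator B x \<partial>lborel)"
      unfolding mu using f_measurable B by (intro emeasure_density) auto
    also have "\<dots> \<le> (\<integral>\<^sup>+x. ennreal c * indicator B x \<partial>lborel)"
      using f_bounds by (intro nn_integral_mono mult_right_mono ennreal_leI) auto
    also have "\<dots> = ennreal c * emeasure lborel B" using B by (simp add: nn_integral_cmult_indicator)
    also have "\<dots> < \<infinity>" using emeasure_compact_finite[OF that] by (simp add: ennreal_mult_less_top)
    finally show ?thesis .
  qed
  have sf: "sigma_finite_measure \<mu>"
  proof
    show "\<exists>A. countable A \<and> A \<subseteq> sets \<mu> \<and> \<Union> A = space \<mu> \<and> (\<forall>a\<in>A. emeasure \<mu> a \<noteq> \<infinity>)"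
    proof (intro exI[of _ "range (\<lambda>n::nat. cball (0::'a) (real n))"] conjI ballI)
      have "\<exists>n::nat. norm x \<le> real n" for x :: 'a by (rule real_arch_simple)
      then show "\<Union> (range (\<lambda>n::nat. cball (0::'a) (real n))) = space \<mu>" by (auto simp: mu)
      show "emeasure \<mu> a \<noteq> \<infinity>" if "a \<in> range (\<lambda>n::nat. cball (0::'a) (real n))" for a
      proof -
        have "compact a" using that by auto
        then show ?thesis using fin[of a] by simp
      qed
    qed (auto simp: sets_mu)
  qed
  have "positive_kernel \<mu> K"
    by (rule positive_kernel.intro[OF sets_mu sf fin kernel_hermitian K_bounded K_hermitian K_positive K_diagonal])
  then interpret A: alpha_process \<mu> K P X \<alpha>
    using alpha_process_axioms.intro[OF process] by (rule alpha_process.intro)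
  obtain C where C: "C > 0" "\<And>x. \<bar>\<phi> x\<bar> \<le> C"
  proof -
    obtain C where "\<And>x. \<bar>\<phi> x\<bar> \<le> C" using phi_bounded unfolding bounded_iff by auto
    then have "\<bar>\<phi> x\<bar> \<le> max C 1" for x by (meson max.coboundedI1)
    then show ?thesis by (intro that[of "max C 1"]) simp_all
  qed
  obtain \<rho> where \<rho>: "\<rho> > 0" "\<And>x. norm x > \<rho> \<Longrightarrow> \<phi> x = 0"
  proof -
    obtain r where r: "\<And>x. x \<in> closure {x. \<phi> x \<noteq> 0} \<Longrightarrow> norm x \<le> r"
      using compact_imp_bounded[OF phi_support] unfolding bounded_iff by blast
    show ?thesis
    proof (rule that[of "max r 1"])
      fix x :: 'a assume "norm x > max r 1"
      then have "x \<notin> closure {x. \<phi> x \<noteq> 0}" using r[of x] by auto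
      then show "\<phi> x = 0" using closure_subset[of "{x. \<phi> x \<noteq> 0}"] by auto
    qed simp
  qed
  define s where "s = (\<integral>x. (\<phi> x)\<^sup>2 \<partial>lborel)"
  have s: "s > 0" using phi_norm by (simp add: L2_norm_def s_def)
  have s': "(\<integral>\<^sup>+x. ennreal ((\<phi> x)\<^sup>2) \<partial>lborel) = ennreal s"
    unfolding s_def
  proof (rule nn_integral_eq_integral)
    \<comment> \<open>A positive Bochner integral forces integrability, since the integral of a
      non-integrable function is zero by convention.\<close>
    show "integrable lborel (\<lambda>x. (\<phi> x)\<^sup>2)"
      using s not_integrable_integral_eq[of lborel "\<lambda>x. (\<phi> x)\<^sup>2"] unfolding s_def by fastforce
  qed simp
  have bump: "bump \<phi> C \<rho> s" by (rule bump.intro) (fact phi_measurable C \<rho> s s')+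
  interpret bump \<phi> C \<rho> s by (fact bump)
  define V where "V L = prob_space.variance P (\<lambda>\<omega>. linear_statistic (scaled L) (X \<omega>))" for L
  have test: "A.test_function (scaled L)" if "L > 0" for L
    by (rule A.test_functionI[where C = C and B = "cball 0 (\<rho> * L)"]) (auto simp: scaled_bound scaled_zero[OF that])
  have goal: "?thesis \<longleftrightarrow> (\<exists>c\<^sub>0>0. \<exists>L\<^sub>0>0. \<forall>L\<ge>L\<^sub>0. V L \<ge> c\<^sub>0 * L powr \<eta>)"
    unfolding V_def scaled_def[abs_def] ..
  have km: "A.k \<in> borel_measurable borel"
    using A.k_measurable by (simp add: measurable_cong_sets[OF sets_mu refl])
  have wm: "(\<lambda>(x, y). A.w x y) \<in> borel_measurable (borel \<Otimes>\<^sub>M borel)"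
    using A.w_measurable by (simp add: measurable_cong_sets[OF sets_pair_measure_cong[OF sets_mu sets_mu] refl])
  interpret W: bump_weight \<phi> C \<rho> s A.w
    by unfold_locales (use wm in auto)
  \<comment> \<open>The factor \<open>c * c\<close> pays for the change of measure in both
    variables, and \<open>2 / (- \<alpha>)\<close> inverts the coefficient of the increments in the
    variance bound.\<close>
  have energy: "W.energy L \<le> ennreal ((c * c * (2 / (- \<alpha>))) * V L)" if "\<alpha> < 0" "L > 0" for L
  proof -
    have "W.energy L \<le> ennreal (c * c) * (\<integral>\<^sup>+x. \<integral>\<^sup>+y. ennreal ((scaled L x - scaled L y)\<^sup>2 * A.w x y) \<partial>\<mu> \<partial>\<mu>)"
      unfolding mu
      by (rule double_nn_integral_lborel_le_density[OF f_measurable _ c_pos f_lower]) measurable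
    also have "\<dots> \<le> ennreal (c * c) * ennreal (2 / (- \<alpha>) * V L)"
      unfolding V_def
      by (intro mult_left_mono A.increments_le_variance test A.op_norm_le_spectrum_bound that K_spectrum) auto
    also have "\<dots> = ennreal ((c * c * (2 / (- \<alpha>))) * V L)"
      using c_pos by (subst ennreal_mult'[symmetric]) (auto simp: mult.assoc)
    finally show ?thesis .
  qed
  have from_energy: ?thesis
    if neg: "\<alpha> < 0" and ex: "\<exists>c0>0. \<exists>L0>0. \<forall>L\<ge>L0. ennreal (c0 * L powr \<eta>) \<le> W.energy L"
  proof -
    obtain c0 L0 where c0: "c0 > 0" "L0 > 0" "\<And>L. L \<ge> L0 \<Longrightarrow> ennreal (c0 * L powr \<eta>) \<le> W.energy L"
      using ex by blast
    show ?thesis unfolding goal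
    proof (rule power_bound_of_ennreal_bound[where q = "c * c * (2 / (- \<alpha>))" and v = V])
      show "c * c * (2 / - \<alpha>) > 0" using c_pos neg by (intro mult_pos_pos divide_pos_pos) auto
      fix L assume L: "L \<ge> L0"
      then show "ennreal (c0 * L powr \<eta>) \<le> ennreal (c * c * (2 / - \<alpha>) * V L)"
        using order_trans[OF c0(3)[OF L] energy[OF neg]] L c0(2) by simp
    qed (use c0 in auto)
  qed
  \<comment> \<open>The rate L^(d-2) serves both (ii.a), where \<eta> = d - 4, and (ii.c): for L
    \<ge> 1 lowering the exponent only weakens the bound.\<close>
  have square_rate: "\<exists>c0>0. \<exists>L0>0. \<forall>L\<ge>L0. ennreal (c0 * L powr \<eta>) \<le> W.energy L"
    if le: "\<eta> \<le> real DIM('a) - 2" and ex: "\<exists>c0>0. \<exists>L0>0. \<forall>L\<ge>L0. ennreal (c0 * (L ^ DIM('a) / L\<^sup>2)) \<le> W.energy L"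
  proof -
    obtain c0 L0 where c0: "c0 > 0" "L0 > 0" "\<And>L. L \<ge> L0 \<Longrightarrow> ennreal (c0 * (L ^ DIM('a) / L\<^sup>2)) \<le> W.energy L"
      using ex by blast
    have "ennreal (c0 * L powr \<eta>) \<le> W.energy L" if L: "L \<ge> max 1 L0" for L
    proof -
      have "L powr \<eta> \<le> L powr (real DIM('a) - 2)" using le L by (intro powr_mono) auto
      also have "\<dots> = L ^ DIM('a) / L\<^sup>2"
        using L by (simp add: powr_diff powr_realpow)
      finally have "ennreal (c0 * L powr \<eta>) \<le> ennreal (c0 * (L ^ DIM('a) / L\<^sup>2))"
        using c0(1) by (intro ennreal_leI mult_left_mono) auto
      also have "\<dots> \<le> W.energy L" using c0(3)[of L] L by simp
      finally show ?thesis .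
    qed
    moreover have "max 1 L0 > 0" by simp
    ultimately show ?thesis using c0(1) by blast
  qed
  from cases show ?thesis
  proof (elim disjE exE conjE)
    assume i: "condition_i \<alpha> K \<mu>" and \<eta>: "\<eta> = real DIM('a)"
    have "\<alpha> > 0 \<or> \<alpha> < 0" using alpha by auto
    moreover have "- \<alpha> * L2_op_norm \<mu> (kernel_op \<mu> K) < 1" if "\<alpha> < 0"
    proof -
      have "L2_op_norm \<mu> (kernel_op \<mu> K) < inverse \<bar>\<alpha>\<bar>" using i that unfolding condition_i_def by blast
      then show ?thesis using that by (simp add: field_simps)
    qed
    ultimately have "\<alpha> > 0 \<or> \<alpha> < 0 \<and> - \<alpha> * L2_op_norm \<mu> (kernel_op \<mu> K) < 1" by blast
    then obtain \<kappa> where \<kappa>: "\<kappa> > 0" and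
      kV: "\<And>\<psi>. A.test_function \<psi> \<Longrightarrow> (\<integral>\<^sup>+x. ennreal ((\<psi> x)\<^sup>2 * A.k x) \<partial>\<mu>)
        \<le> ennreal (\<kappa> * prob_space.variance P (\<lambda>\<omega>. linear_statistic \<psi> (X \<omega>)))"
      by (rule A.diagonal_integral_le_variance) blast
    have "\<exists>c0>0. \<exists>L0>0. \<forall>L\<ge>L0. ennreal (c0 * L ^ DIM('a)) \<le> (\<integral>\<^sup>+x. ennreal ((scaled L x)\<^sup>2 * A.k x) \<partial>lborel)"
    proof (rule thick_diagonal_bound[OF km])
      fix \<delta> :: real assume "\<delta> > 0"
      then show "\<exists>m>0. \<exists>r>0. \<forall>x. (1 - \<delta>) * measure lborel (cube x r) \<le> measure lborel {y \<in> cube x r. m \<le> A.k y}"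
        using i unfolding condition_i_def A.k_def by blast
    qed
    then obtain c0 L0 where c0: "c0 > 0" "L0 > 0"
      "\<And>L. L \<ge> L0 \<Longrightarrow> ennreal (c0 * L ^ DIM('a)) \<le> (\<integral>\<^sup>+x. ennreal ((scaled L x)\<^sup>2 * A.k x) \<partial>lborel)"
      by blast
    show ?thesis unfolding goal
    proof (rule power_bound_of_ennreal_bound[where q = "c * \<kappa>" and v = V])
      fix L assume L: "L \<ge> L0"
      then have L0: "L > 0" using c0(2) by simp
      have "ennreal (c0 * L powr \<eta>) = ennreal (c0 * L ^ DIM('a))" using L0 by (simp add: \<eta> powr_realpow)
      also have "\<dots> \<le> (\<integral>\<^sup>+x. ennreal ((scaled L x)\<^sup>2 * A.k x) \<partial>lborel)" by (rule c0(3)[OF L])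
      also have "\<dots> \<le> ennreal c * (\<integral>\<^sup>+x. ennreal ((scaled L x)\<^sup>2 * A.k x) \<partial>\<mu>)"
        unfolding mu using km by (intro nn_integral_lborel_le_density f_measurable c_pos f_lower) measurable
      also have "\<dots> \<le> ennreal c * ennreal (\<kappa> * V L)"
        unfolding V_def by (intro mult_left_mono kV test L0) simp
      also have "\<dots> = ennreal (c * \<kappa> * V L)"
        using c_pos by (subst ennreal_mult'[symmetric]) (auto simp: mult.assoc)
      finally show "ennreal (c0 * L powr \<eta>) \<le> ennreal (c * \<kappa> * V L)" .
    qed (use c_pos \<kappa> c0 in auto)
  next
    assume iia: "condition_iia \<alpha> K" and \<eta>: "\<eta> = real DIM('a) - 4"
    then obtain a \<delta> where a: "\<alpha> < 0" "a > 0" "\<delta> > 0" "\<And>x y. norm (x - y) < \<delta> \<Longrightarrow> a \<le> cmod (K x y)"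
      unfolding condition_iia_def by blast
    have "a\<^sup>2 \<le> A.w x y" if "norm (x - y) < \<delta>" for x y
      unfolding A.w_def using a(2) a(4)[OF that] by (intro power_mono) auto
    then have "\<exists>c0>0. \<exists>L0>0. \<forall>L\<ge>L0. ennreal (c0 * (L ^ DIM('a) / L\<^sup>2)) \<le> W.energy L"
      using a(2,3) by (intro W.energy_near_diagonal[of "a\<^sup>2" \<delta>]) auto
    then show ?thesis by (intro from_energy a(1) square_rate) (simp add: \<eta>)
  next
    fix \<beta> assume iib: "condition_iib \<alpha> K \<beta>" and \<eta>: "\<eta> = 2 * (real DIM('a) - \<beta>)"
    then obtain r c1 c2 n0 where p: "\<alpha> < 0" "real DIM('a) / 2 < \<beta>" "r > 0" "c1 > 0" "c2 > 0"
      and dens: "\<And>x n. n \<ge> n0 \<Longrightarrow> c2 * measure lborel (annulus n x r) \<le>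
        measure lborel ({y. cmod (K x y) \<ge> c1 * norm (x - y) powr (- \<beta>)} \<inter> annulus n x r)"
      unfolding condition_iib_def by blast
    have "sqrt (A.w x y) = cmod (K x y)" for x y by (simp add: A.w_def)
    then have "\<exists>c0>0. \<exists>L0>0. \<forall>L\<ge>L0. ennreal (c0 * L powr (2 * (real DIM('a) - \<beta>))) \<le> W.energy L"
      using dens by (intro W.energy_power_decay[OF p(3,4,5,2)]) auto
    then show ?thesis by (intro from_energy p(1)) (simp add: \<eta>)
  next
    assume iic: "condition_iic \<alpha> K \<phi>" and \<eta>: "\<eta> = real DIM('a) - 2"
    then have c: "\<alpha> < 0" "C2_function \<phi>"
      "(SUP x. \<integral>\<^sup>+y. ennreal (norm (x - y) ^ 3 * A.w x y) \<partial>lborel) < \<infinity>"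
      "(INF x. INF u\<in>sphere 0 1. \<integral>\<^sup>+y. ennreal (\<bar>(y - x) \<bullet> u\<bar>\<^sup>2 * A.w x y) \<partial>lborel) > 0"
      unfolding condition_iic_def A.w_def by blast+
    show ?thesis by (intro from_energy c(1) square_rate W.energy_smooth c(2-4)) (simp add: \<eta>)
  qed
qed

end
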